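(* Let $X$ be a resonant Hopf surface with parameters $b$ and $r>1$, and let $\ell$ be an integer with $0<\ell<r$. The nowhere-vanishing $(L_b)^\ell$-twisted trace-free Higgs bundles on $X$ of the form $(\mathcal{O}_X\oplus H,\phi)$ with $H\in\mathrm{Pic}(X)$, $\deg(H)\le0$, up to conjugation by an automorphism of $\mathcal{O}_X\oplus H$, are as follows: (1) $H\simeq(L_b)^{\ell-kr}$ for some $k>0$ and $$\phi=\begin{pmatrix}sy^\ell&x^k\\0&-sy^\ell\end{pmatrix}$$ for some $s\in\mathbb{C}^*$. The $\phi$-invariant sub-line bundles are the first direct summand $\mathcal{O}_X$ and $(L_b)^{-kr}$ under the inclusion $(x^k,-2sy^\ell)$. (2) $H\simeq(L_b)^{-\ell}$ and $$\phi=\begin{pmatrix}0&\beta\\1&0\end{pmatrix}$$ for $\beta\in H^0(X,(L_b)^{2\ell})$. This Higgs field will have irreducible spectral curve if $\beta$ is not a square (only possible when $2\ell=r$). When $\beta=t^2$ for some $t\in H^0(X,(L_b)^\ell)$, the $\phi$-invariant sub-line bundles are $(L_b)^{-\ell}$ under the inclusions $(\pm t,1)$. (3) (only if $\frac r2<\ell<r$) $H\simeq(L_b)^{\ell-r}$ and $$\phi=\begin{pmatrix}0&\beta\\ y^{2\ell-r}&0\end{pmatrix}$$ for $\beta\in H^0(X,(L_b)^r)$ with $\beta(1,0)\neq0$. This Higgs field will always have irreducible spectral curve.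
   Context: A resonant Hopf surface is $X=(\mathbb{C}^2\setminus\{0\})/\langle F\rangle$ with $F(x,y)=(b^rx,by)$, $0<|b|<1$, $r>1$ an integer. For $\tau\in\mathbb{C}^*$, $L_\tau$ is the line bundle on $X$ obtained from $(\mathbb{C}^2\setminus\{0\})\times\mathbb{C}$ by identifying $(p,v)\sim(F(p),\tau v)$; every line bundle is isomorphic to a unique $L_\tau$. Sections of $L_\tau$ are identified with holomorphic functions $s$ on $\mathbb{C}^2\setminus\{0\}$ with $s\circ F=\tau s$. The degree is $\deg(L_\tau)=\log|\tau|/\log|b|$. A $\lambda$-twisted trace-free Higgs bundle is a pair $(E,\phi)$ with $E$ a rank-2 bundle and $\phi\in H^0(X,\mathcal{E}nd_0(E)\otimes\lambda)$, where $\mathcal{E}nd_0(E)$ denotes trace-free endomorphisms. For $E=\mathcal{O}_X\oplus H$, $\phi$ is written as a matrix $\begin{pmatrix}p&q\\ w&-p\end{pmatrix}$ acting on column vectors, with $p\in H^0(X,\lambda)$, $q\in H^0(X,\lambda\otimes H^{-1})$, $w\in H^0(X,\lambda\otimes H)$. An inclusion $(f,g)$ of a line bundle $M$ means the map $M\to\mathcal{O}_X\oplus H$ with components $f\in H^0(X,M^{-1})$, $g\in H^0(X,M^{-1}\otimes H)$. A sub-line bundle $M$ (taken with torsion-free quotient) is $\phi$-invariant if $\phi(M)\subseteq M\otimes\lambda$. The spectral curve is the zero locus of the characteristic polynomial of $\phi$ in the total space of $\lambda$. Listed Higgs fields are determined by their parameters up to conjugation by automorphisms of $E$ unless otherwise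 indicated.
   Formalization: In (2), "only possible when 2ℓ = r" is replaced by "only possible when 2ℓ ≥ r": the original is false, e.g. for r = 3, ℓ = 2 the section β = xy of (L_b)^4 is not a square. *)

theory Defs
  imports "HOL-Analysis.Analysis"
begin

text \<open>
  A resonant Hopf surface \<open>X = (C^2 - 0)/<F>\<close> is given by \<open>b\<close> and \<open>r\<close>. Its line bundles are
  represented by their multipliers: the nonzero complex number \<open>\<tau>\<close> stands for \<open>L_\<tau>\<close>, so tensor
  products, duals and the power \<open>(L_b)^n\<close> become products, inverses and \<open>b powi n\<close>. Sections,
  bundle maps and Higgs fields are represented by their pullbacks to \<open>C^2 - 0\<close>; these are
  functions on all of \<open>C^2\<close> whose value at the origin is irrelevant, and which must therefore be
  compared on \<open>punctured_plane\<close> only.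
\<close>

definition punctured_plane :: "(complex \<times> complex) set" where
  "punctured_plane = UNIV - {(0, 0)}"

definition hopf_map :: "complex \<Rightarrow> nat \<Rightarrow> complex \<times> complex \<Rightarrow> complex \<times> complex" where
  "hopf_map b r = (\<lambda>(x, y). (b ^ r * x, b * y))"

text \<open>Complex differentiability in two and three variables, only used on open sets.\<close>

definition holomorphic2_on :: "(complex \<times> complex \<Rightarrow> complex) \<Rightarrow> (complex \<times> complex) set \<Rightarrow> bool"
  where "holomorphic2_on f S \<longleftrightarrow>
    (\<forall>z\<in>S. \<exists>a c. (f has_derivative (\<lambda>(u, v). a * u + c * v)) (at z))"

definition holomorphic3_on ::
  "((complex \<times> complex) \<times> complex \<Rightarrow> complex) \<Rightarrow> ((complex \<times> complex) \<times> complex) set \<Rightarrow> bool"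
  where "holomorphic3_on f S \<longleftrightarrow>
    (\<forall>z\<in>S. \<exists>a c d. (f has_derivative (\<lambda>((u, v), w). a * u + c * v + d * w)) (at z))"

text \<open>\<open>H0 b r \<tau>\<close> is \<open>H^0(X, L_\<tau>)\<close>. A bundle map from \<open>L_\<sigma>\<close> to \<open>L_\<tau>\<close> is an element of
  \<open>H0 b r (\<tau> / \<sigma>)\<close>.\<close>

definition H0 :: "complex \<Rightarrow> nat \<Rightarrow> complex \<Rightarrow> (complex \<times> complex \<Rightarrow> complex) set" where
  "H0 b r \<tau> = {s. holomorphic2_on s punctured_plane \<and>
                  (\<forall>z\<in>punctured_plane. s (hopf_map b r z) = \<tau> * s z)}"

definition bundle_degree :: "complex \<Rightarrow> complex \<Rightarrow> real" where
  "bundle_degree b \<tau> = ln (cmod \<tau>) / ln (cmod b)"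

text \<open>Sections of \<open>End(E) \<otimes> L_\<mu>\<close> for \<open>E\<close> the direct sum of the trivial bundle and \<open>L_\<tau>\<close>,
  as matrices acting on column vectors.\<close>

definition twisted_End ::
  "complex \<Rightarrow> nat \<Rightarrow> complex \<Rightarrow> complex \<Rightarrow> (complex \<times> complex \<Rightarrow> complex ^ 2 ^ 2) set" where
  "twisted_End b r \<mu> \<tau> = {\<phi>.
      (\<lambda>z. \<phi> z $ 1 $ 1) \<in> H0 b r \<mu> \<and> (\<lambda>z. \<phi> z $ 1 $ 2) \<in> H0 b r (\<mu> / \<tau>) \<and>
      (\<lambda>z. \<phi> z $ 2 $ 1) \<in> H0 b r (\<mu> * \<tau>) \<and> (\<lambda>z. \<phi> z $ 2 $ 2) \<in> H0 b r \<mu>}"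

definition higgs_field ::
  "complex \<Rightarrow> nat \<Rightarrow> complex \<Rightarrow> complex \<Rightarrow> (complex \<times> complex \<Rightarrow> complex ^ 2 ^ 2) \<Rightarrow> bool" where
  "higgs_field b r \<mu> \<tau> \<phi> \<longleftrightarrow>
     \<phi> \<in> twisted_End b r \<mu> \<tau> \<and> (\<forall>z\<in>punctured_plane. trace (\<phi> z) = 0)"

definition nowhere_vanishing :: "(complex \<times> complex \<Rightarrow> 'a::zero) \<Rightarrow> bool" where
  "nowhere_vanishing s \<longleftrightarrow> (\<forall>z\<in>punctured_plane. s z \<noteq> 0)"

definition bundle_automorphism ::
  "complex \<Rightarrow> nat \<Rightarrow> complex \<Rightarrow> (complex \<times> complex \<Rightarrow> complex ^ 2 ^ 2) \<Rightarrow> bool" where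
  "bundle_automorphism b r \<tau> A \<longleftrightarrow>
     A \<in> twisted_End b r 1 \<tau> \<and> (\<forall>z\<in>punctured_plane. invertible (A z))"

definition conjugate ::
  "complex \<Rightarrow> nat \<Rightarrow> complex \<Rightarrow> (complex \<times> complex \<Rightarrow> complex ^ 2 ^ 2)
     \<Rightarrow> (complex \<times> complex \<Rightarrow> complex ^ 2 ^ 2) \<Rightarrow> bool" where
  "conjugate b r \<tau> \<phi> \<psi> \<longleftrightarrow> (\<exists>A. bundle_automorphism b r \<tau> A \<and>
     (\<forall>z\<in>punctured_plane. \<psi> z = A z ** \<phi> z ** matrix_inv (A z)))"

text \<open>The quotient of \<open>E\<close> by the image of \<open>v\<close> is torsion-free: a local section \<open>e\<close> of \<open>E\<close> lies in
  the image as soon as a nonzero multiple of it does. It suffices to test this on \<open>C^2 - 0\<close>, which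
  is locally biholomorphic to \<open>X\<close>.\<close>

definition torsion_free_quotient :: "(complex \<times> complex \<Rightarrow> complex ^ 2) \<Rightarrow> bool" where
  "torsion_free_quotient v \<longleftrightarrow>
     (\<forall>U h m e. open U \<and> connected U \<and> U \<subseteq> punctured_plane \<and>
        holomorphic2_on h U \<and> (\<exists>z\<in>U. h z \<noteq> 0) \<and> holomorphic2_on m U \<and>
        (\<forall>i. holomorphic2_on (\<lambda>z. e z $ i) U) \<and> (\<forall>z\<in>U. h z *s e z = m z *s v z)
      \<longrightarrow> (\<exists>m'. holomorphic2_on m' U \<and> (\<forall>z\<in>U. e z = m' z *s v z)))"

text \<open>\<open>v\<close> has the components \<open>(f, g)\<close> of an inclusion of \<open>L_\<sigma>\<close> in \<open>E\<close>, the direct sum of the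
  trivial bundle and \<open>L_\<tau>\<close>.\<close>

definition sub_line_bundle ::
  "complex \<Rightarrow> nat \<Rightarrow> complex \<Rightarrow> complex \<Rightarrow> (complex \<times> complex \<Rightarrow> complex ^ 2) \<Rightarrow> bool" where
  "sub_line_bundle b r \<tau> \<sigma> v \<longleftrightarrow> \<sigma> \<noteq> 0 \<and>
     (\<lambda>z. v z $ 1) \<in> H0 b r (inverse \<sigma>) \<and> (\<lambda>z. v z $ 2) \<in> H0 b r (inverse \<sigma> * \<tau>) \<and>
     (\<exists>z\<in>punctured_plane. v z \<noteq> 0) \<and> torsion_free_quotient v"

text \<open>Two inclusions define the same sub-line bundle of \<open>E\<close> if they differ by an isomorphism
  of \<open>L_\<sigma>\<close> with \<open>L_\<sigma>'\<close>.\<close>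

definition same_sub_line_bundle ::
  "complex \<Rightarrow> nat \<Rightarrow> complex \<Rightarrow> (complex \<times> complex \<Rightarrow> complex ^ 2)
     \<Rightarrow> complex \<Rightarrow> (complex \<times> complex \<Rightarrow> complex ^ 2) \<Rightarrow> bool" where
  "same_sub_line_bundle b r \<sigma> v \<sigma>' v' \<longleftrightarrow>
     (\<exists>u \<in> H0 b r (\<sigma>' / \<sigma>). nowhere_vanishing u \<and> (\<forall>z\<in>punctured_plane. v z = u z *s v' z))"

text \<open>\<open>\<phi>(M) \<subseteq> M \<otimes> L_\<mu>\<close>: the composite of the inclusion \<open>v\<close> of \<open>M\<close> with \<open>\<phi>\<close> factors through
  \<open>M \<otimes> L_\<mu>\<close>.\<close>

definition higgs_invariant ::
  "complex \<Rightarrow> nat \<Rightarrow> complex \<Rightarrow> (complex \<times> complex \<Rightarrow> complex ^ 2 ^ 2)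
     \<Rightarrow> (complex \<times> complex \<Rightarrow> complex ^ 2) \<Rightarrow> bool" where
  "higgs_invariant b r \<mu> \<phi> v \<longleftrightarrow>
     (\<exists>c \<in> H0 b r \<mu>. \<forall>z\<in>punctured_plane. \<phi> z *v v z = c z *s v z)"

definition invariant_sub_line_bundle ::
  "complex \<Rightarrow> nat \<Rightarrow> complex \<Rightarrow> complex \<Rightarrow> (complex \<times> complex \<Rightarrow> complex ^ 2 ^ 2)
     \<Rightarrow> complex \<Rightarrow> (complex \<times> complex \<Rightarrow> complex ^ 2) \<Rightarrow> bool" where
  "invariant_sub_line_bundle b r \<mu> \<tau> \<phi> \<sigma> v \<longleftrightarrow>
     sub_line_bundle b r \<tau> \<sigma> v \<and> higgs_invariant b r \<mu> \<phi> v"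

text \<open>The total space of \<open>L_\<mu>\<close>, as the set of orbits of \<open>(p, v) \<mapsto> (F p, \<mu> v)\<close>.\<close>

definition bundle_rel ::
  "complex \<Rightarrow> nat \<Rightarrow> complex \<Rightarrow>
     (((complex \<times> complex) \<times> complex) \<times> ((complex \<times> complex) \<times> complex)) set" where
  "bundle_rel b r \<mu> = {((z, v), (z', v')). z \<in> punctured_plane \<and> z' \<in> punctured_plane \<and>
     (\<exists>n. (z', v') = ((hopf_map b r ^^ n) z, \<mu> ^ n * v) \<or>
          (z, v) = ((hopf_map b r ^^ n) z', \<mu> ^ n * v'))}"

definition total_space ::
  "complex \<Rightarrow> nat \<Rightarrow> complex \<Rightarrow> ((complex \<times> complex) \<times> complex) set set" where
  "total_space b r \<mu> = (punctured_plane \<times> UNIV) // bundle_rel b r \<mu>"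

text \<open>For a set \<open>A\<close> of orbits, \<open>\<Union>A\<close> is its preimage in \<open>(C^2 - 0) \<times> C\<close>.\<close>

definition analytic_subset ::
  "complex \<Rightarrow> nat \<Rightarrow> complex \<Rightarrow> ((complex \<times> complex) \<times> complex) set set \<Rightarrow> bool" where
  "analytic_subset b r \<mu> A \<longleftrightarrow> A \<subseteq> total_space b r \<mu> \<and>
     (\<forall>w \<in> punctured_plane \<times> UNIV. \<exists>U Fs. open U \<and> w \<in> U \<and> U \<subseteq> punctured_plane \<times> UNIV \<and>
        finite Fs \<and> (\<forall>f\<in>Fs. holomorphic3_on f U) \<and> \<Union>A \<inter> U = {u \<in> U. \<forall>f\<in>Fs. f u = 0})"

definition irreducible_analytic ::
  "complex \<Rightarrow> nat \<Rightarrow> complex \<Rightarrow> ((complex \<times> complex) \<times> complex) set set \<Rightarrow> bool" where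
  "irreducible_analytic b r \<mu> A \<longleftrightarrow> analytic_subset b r \<mu> A \<and> A \<noteq> {} \<and>
     (\<forall>A1 A2. analytic_subset b r \<mu> A1 \<and> analytic_subset b r \<mu> A2 \<and> A = A1 \<union> A2
        \<longrightarrow> A = A1 \<or> A = A2)"

definition spectral_curve ::
  "complex \<Rightarrow> nat \<Rightarrow> complex \<Rightarrow> (complex \<times> complex \<Rightarrow> complex ^ 2 ^ 2)
     \<Rightarrow> ((complex \<times> complex) \<times> complex) set set" where
  "spectral_curve b r \<mu> \<phi> =
     {bundle_rel b r \<mu> `` {(z, \<eta>)} |z \<eta>. z \<in> punctured_plane \<and> det (mat \<eta> - \<phi> z) = 0}"

definition is_square_section :: "complex \<Rightarrow> nat \<Rightarrow> nat \<Rightarrow> (complex \<times> complex \<Rightarrow> complex) \<Rightarrow> bool"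
  where "is_square_section b r l \<beta> \<longleftrightarrow> (\<exists>t \<in> H0 b r (b ^ l). \<forall>z\<in>punctured_plane. \<beta> z = (t z)\<^sup>2)"

definition higgs1 :: "nat \<Rightarrow> nat \<Rightarrow> complex \<Rightarrow> complex \<times> complex \<Rightarrow> complex ^ 2 ^ 2" where
  "higgs1 l k s = (\<lambda>(x, y). vector [vector [s * y ^ l, x ^ k], vector [0, - (s * y ^ l)]])"

definition higgs2 :: "(complex \<times> complex \<Rightarrow> complex) \<Rightarrow> complex \<times> complex \<Rightarrow> complex ^ 2 ^ 2" where
  "higgs2 \<beta> = (\<lambda>z. vector [vector [0, \<beta> z], vector [1, 0]])"

text \<open>Only meaningful for \<open>r < 2 * l\<close>; otherwise the subtraction truncates.\<close>

definition higgs3 ::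
  "nat \<Rightarrow> nat \<Rightarrow> (complex \<times> complex \<Rightarrow> complex) \<Rightarrow> complex \<times> complex \<Rightarrow> complex ^ 2 ^ 2" where
  "higgs3 r l \<beta> = (\<lambda>(x, y). vector [vector [0, \<beta> (x, y)], vector [y ^ (2 * l - r), 0]])"

end

theory Submission
  imports Defs "HOL-Complex_Analysis.Conformal_Mappings"
begin

text \<open>
  Restricting a section of \<open>L_\<tau>\<close> to the weighted orbits \<open>t \<mapsto> (t\<^sup>r x, t y)\<close> gives a holomorphic
  function \<open>G\<close> on the punctured line with \<open>G (b t) = \<tau> G t\<close>. After multiplication by a power of
  \<open>t\<close> it is bounded near the origin, so comparing Taylor coefficients shows that it is a monomial.
  Sections are therefore quasihomogeneous, and Cauchy's inequality for the entire function
  \<open>x \<mapsto> s (x, 1)\<close> turns them into weighted homogeneous polynomials; no Hartogs theorem is needed.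
  All relevant automorphisms of \<open>O \<oplus> H\<close> are then upper triangular with constant diagonal, and the
  classification reduces to solving for their entries, starting from the fact that some entry
  of a nowhere vanishing Higgs field off the diagonal is nonzero at \<open>(1, 0)\<close>.
\<close>

section \<open>Holomorphic functions of two variables\<close>

text \<open>The multiplier of \<open>H\<close> is pinned down on the curve \<open>y = 0\<close>.
  Because \<open>0 < l < r\<close>, the diagonal of a Higgs field is a multiple of
  \<open>y ^ l\<close> and dies there, which is why an off-diagonal entry has to survive at
  \<open>(1, 0)\<close>. Such an entry contains a pure power of \<open>x\<close>, so its multiplier
  is \<open>b ^ (k * r)\<close>. The degree bound then leaves only multipliers
  \<open>b powi (- int n)\<close> with \<open>n > 0\<close> for \<open>H\<close>, and this
  negativity kills the lower left entry of every automorphism.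

  The parameter \<beta> of the normal forms is minus the determinant, up to a power of
  \<open>y\<close>. That determinant has weight \<open>2 * l < 2 * r\<close>, while \<open>x\<close>
  has weight \<open>r\<close>; hence it is at most linear in \<open>x\<close>, and a spectral curve
  in which \<open>x\<close> really occurs can be solved for \<open>x\<close>. This replaces any
  factorization theory in the proof of irreducibility.

  Functions matter only on the punctured plane. Several identities between sections are therefore
  proved where \<open>y\<close> is nonzero and carried to the axis by the identity theorem, which
  also justifies every cancellation of a section.\<close>

lemma holomorphic2_on_iff:
  "holomorphic2_on f S \<longleftrightarrow>
    (\<forall>z\<in>S. \<exists>a c. (f has_derivative (\<lambda>p. a * fst p + c * snd p)) (at z))"
  by (simp add: holomorphic2_on_def case_prod_beta')

lemma holomorphic2_on_const: "holomorphic2_on (\<lambda>z. k) S"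
  unfolding holomorphic2_on_iff
proof
  fix z :: "complex \<times> complex"
  show "\<exists>a c. ((\<lambda>z. k) has_derivative (\<lambda>p. a * fst p + c * snd p)) (at z)"
    by (rule exI[of _ 0], rule exI[of _ 0]) simp
qed

lemma holomorphic2_on_fst: "holomorphic2_on fst S"
  unfolding holomorphic2_on_iff
proof
  fix z :: "complex \<times> complex"
  show "\<exists>a c. (fst has_derivative (\<lambda>p. a * fst p + c * snd p)) (at z)"
    by (rule exI[of _ 1], rule exI[of _ 0]) (auto intro!: derivative_eq_intros)
qed

lemma holomorphic2_on_snd: "holomorphic2_on snd S"
  unfolding holomorphic2_on_iff
proof
  fix z :: "complex \<times> complex"
  show "\<exists>a c. (snd has_derivative (\<lambda>p. a * fst p + c * snd p)) (at z)"
    by (rule exI[of _ 0], rule exI[of _ 1]) (auto intro!: derivative_eq_intros)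
qed

lemma holomorphic2_on_add:
  assumes "holomorphic2_on f S" "holomorphic2_on g S"
  shows "holomorphic2_on (\<lambda>z. f z + g z) S"
  unfolding holomorphic2_on_iff
proof
  fix z assume "z \<in> S"
  then obtain a c a' c' where "(f has_derivative (\<lambda>p. a * fst p + c * snd p)) (at z)"
    "(g has_derivative (\<lambda>p. a' * fst p + c' * snd p)) (at z)"
    using assms unfolding holomorphic2_on_iff by blast
  then have "((\<lambda>z. f z + g z) has_derivative (\<lambda>p. (a + a') * fst p + (c + c') * snd p)) (at z)"
    by (auto intro!: derivative_eq_intros simp: algebra_simps)
  then show "\<exists>a c. ((\<lambda>z. f z + g z) has_derivative (\<lambda>p. a * fst p + c * snd p)) (at z)" by blast
qed

lemma holomorphic2_on_mult:
  assumes "holomorphic2_on f S" "holomorphic2_on g S"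
  shows "holomorphic2_on (\<lambda>z. f z * g z) S"
  unfolding holomorphic2_on_iff
proof
  fix z assume "z \<in> S"
  then obtain a c a' c' where "(f has_derivative (\<lambda>p. a * fst p + c * snd p)) (at z)"
    "(g has_derivative (\<lambda>p. a' * fst p + c' * snd p)) (at z)"
    using assms unfolding holomorphic2_on_iff by blast
  then have "((\<lambda>z. f z * g z) has_derivative
      (\<lambda>p. (f z * a' + a * g z) * fst p + (f z * c' + c * g z) * snd p)) (at z)"
    by (auto intro!: derivative_eq_intros simp: algebra_simps)
  then show "\<exists>a c. ((\<lambda>z. f z * g z) has_derivative (\<lambda>p. a * fst p + c * snd p)) (at z)" by blast
qed

lemma holomorphic2_on_compose:
  assumes f: "holomorphic2_on f S" and g: "\<And>z. z \<in> S \<Longrightarrow> g field_differentiable (at (f z))"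
  shows "holomorphic2_on (\<lambda>z. g (f z)) S"
  unfolding holomorphic2_on_iff
proof
  fix z assume z: "z \<in> S"
  then obtain a c where f': "(f has_derivative (\<lambda>p. a * fst p + c * snd p)) (at z)"
    using f unfolding holomorphic2_on_iff by blast
  obtain d where "(g has_field_derivative d) (at (f z))"
    using g[OF z] by (auto simp: field_differentiable_def)
  then have "(g has_derivative (\<lambda>h. d * h)) (at (f z))"
    by (simp add: has_field_derivative_def)
  from has_derivative_compose[OF f' this]
  have "((\<lambda>z. g (f z)) has_derivative (\<lambda>p. (d * a) * fst p + (d * c) * snd p)) (at z)"
    by (simp add: algebra_simps)
  then show "\<exists>a c. ((\<lambda>z. g (f z)) has_derivative (\<lambda>p. a * fst p + c * snd p)) (at z)" by blast
qed

lemma holomorphic2_on_inverse: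
  assumes "holomorphic2_on f S" "\<And>z. z \<in> S \<Longrightarrow> f z \<noteq> 0"
  shows "holomorphic2_on (\<lambda>z. inverse (f z)) S"
  by (rule holomorphic2_on_compose[OF assms(1)])
     (auto intro!: field_differentiable_inverse field_differentiable_ident assms(2))

lemma holomorphic2_on_divide:
  assumes "holomorphic2_on f S" "holomorphic2_on g S" "\<And>z. z \<in> S \<Longrightarrow> g z \<noteq> 0"
  shows "holomorphic2_on (\<lambda>z. f z / g z) S"
  using holomorphic2_on_mult[OF assms(1) holomorphic2_on_inverse[OF assms(2,3)]]
  by (simp add: divide_inverse)

lemma holomorphic2_on_power:
  "holomorphic2_on f S \<Longrightarrow> holomorphic2_on (\<lambda>z. f z ^ n) S"
  by (induction n) (auto intro: holomorphic2_on_const holomorphic2_on_mult)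

lemma holomorphic2_on_uminus: "holomorphic2_on f S \<Longrightarrow> holomorphic2_on (\<lambda>z. - f z) S"
  using holomorphic2_on_mult[OF holomorphic2_on_const[of "-1"]] by simp

lemma holomorphic2_on_diff:
  "holomorphic2_on f S \<Longrightarrow> holomorphic2_on g S \<Longrightarrow> holomorphic2_on (\<lambda>z. f z - g z) S"
  using holomorphic2_on_add[OF _ holomorphic2_on_uminus] by simp

lemma holomorphic2_on_sum:
  "(\<And>i. i \<in> I \<Longrightarrow> holomorphic2_on (f i) S) \<Longrightarrow> holomorphic2_on (\<lambda>z. \<Sum>i\<in>I. f i z) S"
  by (induction I rule: infinite_finite_induct)
     (auto intro: holomorphic2_on_const holomorphic2_on_add)

lemmas holomorphic2_intros = holomorphic2_on_const holomorphic2_on_fst holomorphic2_on_snd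
  holomorphic2_on_add holomorphic2_on_mult holomorphic2_on_divide holomorphic2_on_power
  holomorphic2_on_uminus holomorphic2_on_diff holomorphic2_on_sum holomorphic2_on_inverse

lemma holomorphic2_on_subset: "holomorphic2_on f S \<Longrightarrow> T \<subseteq> S \<Longrightarrow> holomorphic2_on f T"
  unfolding holomorphic2_on_def by blast

lemma holomorphic2_on_cong:
  assumes "open S" "\<And>z. z \<in> S \<Longrightarrow> f z = g z"
  shows "holomorphic2_on f S \<longleftrightarrow> holomorphic2_on g S"
  unfolding holomorphic2_on_def
  by (intro ball_cong refl arg_cong[where f=Ex] ext iffI;
      erule has_derivative_transform_within_open[OF _ assms(1)]) (auto simp: assms(2))

lemma holomorphic2_on_imp_continuous_on: "holomorphic2_on f S \<Longrightarrow> continuous_on S f"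
  unfolding holomorphic2_on_def
  by (meson continuous_at_imp_continuous_on has_derivative_continuous)

text \<open>Chain rule along a holomorphic curve. It makes one-variable theory available on weighted
  orbits, on complex lines and on the slice \<open>y = 1\<close>.\<close>

lemma holomorphic2_on_curve:
  assumes f: "holomorphic2_on f S" and g: "g1 holomorphic_on T" "g2 holomorphic_on T" "open T"
    and sub: "\<And>t. t \<in> T \<Longrightarrow> (g1 t, g2 t) \<in> S"
  shows "(\<lambda>t. f (g1 t, g2 t)) holomorphic_on T"
  unfolding holomorphic_on_open[OF \<open>open T\<close>]
proof
  fix t assume t: "t \<in> T"
  obtain a c where f': "(f has_derivative (\<lambda>p. a * fst p + c * snd p)) (at (g1 t, g2 t))"
    using f sub[OF t] unfolding holomorphic2_on_iff by blast
  obtain d1 d2 where "(g1 has_field_derivative d1) (at t)" "(g2 has_field_derivative d2) (at t)"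
    using g t unfolding holomorphic_on_open[OF \<open>open T\<close>] by blast
  then have "((\<lambda>t. (g1 t, g2 t)) has_derivative (\<lambda>h. (d1 * h, d2 * h))) (at t)"
    by (intro has_derivative_Pair) (simp_all add: has_field_derivative_def)
  from has_derivative_compose[OF this f']
  have "((\<lambda>t. f (g1 t, g2 t)) has_derivative (\<lambda>h. (a * d1 + c * d2) * h)) (at t)"
    by (simp add: algebra_simps)
  then show "\<exists>d. ((\<lambda>t. f (g1 t, g2 t)) has_field_derivative d) (at t)"
    unfolding has_field_derivative_def by (rule exI)
qed

text \<open>Local equations in the total space are pulled back along the graph
  \<open>x = g (y, e)\<close>; this turns questions about the part \<open>y \<noteq> 0\<close> of a
  spectral curve into questions in two variables.\<close>

lemma holomorphic2_on_surface:
  assumes f: "holomorphic3_on f S" and g: "holomorphic2_on g T"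
    and sub: "\<And>y e. (y, e) \<in> T \<Longrightarrow> ((g (y, e), y), e) \<in> S"
  shows "holomorphic2_on (\<lambda>p. f ((g p, fst p), snd p)) T"
  unfolding holomorphic2_on_iff
proof
  fix p assume p: "p \<in> T"
  obtain a c d where f':
    "(f has_derivative (\<lambda>q. a * fst (fst q) + c * snd (fst q) + d * snd q)) (at ((g p, fst p), snd p))"
    using f sub[of "fst p" "snd p"] p unfolding holomorphic3_on_def case_prod_beta' by auto
  obtain a' c' where "(g has_derivative (\<lambda>p. a' * fst p + c' * snd p)) (at p)"
    using g p unfolding holomorphic2_on_iff by blast
  then have "((\<lambda>p. ((g p, fst p), snd p)) has_derivative
      (\<lambda>h. ((a' * fst h + c' * snd h, fst h), snd h))) (at p)"
    by (auto intro!: derivative_eq_intros)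
  from has_derivative_compose[OF this f']
  have "((\<lambda>p. f ((g p, fst p), snd p)) has_derivative
      (\<lambda>h. (a * a' + c) * fst h + (a * c' + d) * snd h)) (at p)"
    by (simp add: algebra_simps)
  then show "\<exists>a c. ((\<lambda>p. f ((g p, fst p), snd p)) has_derivative
      (\<lambda>p. a * fst p + c * snd p)) (at p)" by blast
qed

section \<open>The identity theorem for analytic sets\<close>

text \<open>The complex line through a point \<open>w\<close> of \<open>T\<close> and the target
  \<open>z\<close> meets the ball in a convex set, so the one-variable identity theorem on that line
  carries the zeros near \<open>w\<close> to \<open>z\<close>.\<close>

lemma holomorphic2_zero_on_ball:
  assumes f: "holomorphic2_on f (ball p e)" and "open T" and ne: "T \<inter> ball p e \<noteq> {}"
    and zero: "\<And>u. u \<in> T \<inter> ball p e \<Longrightarrow> f u = 0" and z: "z \<in> ball p e"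
  shows "f z = 0"
proof -
  obtain w where w: "w \<in> T \<inter> ball p e" using ne by blast
  define L where "L t = (fst w + t * (fst z - fst w), snd w + t * (snd z - snd w))" for t :: complex
  have cont: "continuous_on UNIV L" unfolding L_def by (intro continuous_intros)
  define D where "D = L -` ball p e"
  have "open D" unfolding D_def by (intro open_vimage cont open_ball)
  \<comment> \<open>\<open>L\<close> is affine, so \<open>D\<close> inherits convexity from the
    ball; convexity provides the connectedness that continuation needs.\<close>
  have "convex D"
    unfolding convex_alt
  proof (intro ballI allI impI)
    fix s t :: complex and u :: real assume st: "s \<in> D" "t \<in> D" and u: "0 \<le> u \<and> u \<le> 1"
    have "L ((1 - u) *\<^sub>R s + u *\<^sub>R t) = (1 - u) *\<^sub>R L s + u *\<^sub>R L t"
      unfolding L_def by (auto simp: scaleR_conv_of_real algebra_simps)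
    also have "\<dots> \<in> ball p e"
      using convex_ball[of p e] st u unfolding convex_alt D_def by blast
    finally show "(1 - u) *\<^sub>R s + u *\<^sub>R t \<in> D" by (simp add: D_def)
  qed
  have "(\<lambda>t. f (L t)) holomorphic_on D"
    unfolding L_def using \<open>open D\<close>
    by (intro holomorphic2_on_curve[OF f] holomorphic_intros) (auto simp: D_def L_def)
  moreover have "open (L -` (T \<inter> ball p e))"
    using \<open>open T\<close> by (intro open_vimage cont) auto
  moreover have "L 0 = w" "L 1 = z" by (auto simp: L_def)
  then have "L -` (T \<inter> ball p e) \<noteq> {}" "1 \<in> D" using w z by (auto simp: D_def)
  ultimately have "f (L 1) = 0"
    using analytic_continuation_open[of "L -` (T \<inter> ball p e)" D "\<lambda>t. f (L t)" "\<lambda>_. 0" 1]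
      \<open>open D\<close> convex_connected[OF \<open>convex D\<close>] zero by (auto simp: D_def)
  with \<open>L 1 = z\<close> show ?thesis by simp
qed

text \<open>The interior of \<open>V\<close> is also closed in \<open>W\<close>: near a limit point
  the local equations vanish on a nonempty open part of a ball, hence on the whole ball.
  Connectedness of \<open>W\<close> then decides.\<close>

lemma analytic_set_dichotomy:
  assumes "open W" "connected W" "V \<subseteq> W"
    and loc: "\<And>p. p \<in> W \<Longrightarrow> \<exists>U Fs. open U \<and> p \<in> U \<and> U \<subseteq> W \<and>
      (\<forall>f\<in>Fs. holomorphic2_on f U) \<and> V \<inter> U = {u \<in> U. \<forall>f\<in>Fs. f u = 0}"
  shows "V = W \<or> interior V = {}"
proof -
  have nbhd: "\<exists>e>0. ball p e \<inter> interior V = {} \<and> ball p e \<subseteq> W" if p: "p \<in> W" "p \<notin> interior V" for p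
  proof -
    obtain U Fs where U: "open U" "p \<in> U" "U \<subseteq> W" "\<forall>f\<in>Fs. holomorphic2_on f U"
      "V \<inter> U = {u \<in> U. \<forall>f\<in>Fs. f u = 0}" using loc[OF p(1)] by blast
    obtain e where e: "e > 0" "ball p e \<subseteq> U" using U(1,2) openE by blast
    have "ball p e \<inter> interior V = {}"
    proof (rule ccontr)
      assume ne: "ball p e \<inter> interior V \<noteq> {}"
      have "f z = 0" if f: "f \<in> Fs" and z: "z \<in> ball p e" for f z
      proof (rule holomorphic2_zero_on_ball[OF _ open_interior[of V] _ _ z])
        show "holomorphic2_on f (ball p e)"
          using U(4) f e(2) holomorphic2_on_subset by blast
        show "interior V \<inter> ball p e \<noteq> {}" using ne by blast
        fix u assume "u \<in> interior V \<inter> ball p e"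
        then have "u \<in> V \<inter> U" using interior_subset e(2) by blast
        then show "f u = 0" using U(5) f by blast
      qed
      then have "ball p e \<subseteq> V" using U(5) e(2) by blast
      then have "p \<in> interior V" using e(1) by (meson centre_in_ball interiorI open_ball)
      with p(2) show False by blast
    qed
    with e U(3) show ?thesis by blast
  qed
  have "open (W - interior V)"
    unfolding open_contains_ball using nbhd by blast
  with connectedD[OF \<open>connected W\<close> open_interior[of V] this]
  have "interior V \<inter> W = {} \<or> (W - interior V) \<inter> W = {}" by blast
  then show ?thesis using interior_subset[of V] \<open>V \<subseteq> W\<close> by blast
qed

text \<open>The set where \<open>f\<close> and \<open>g\<close> disagree is open and lies in
  \<open>V\<close>, which has no interior points.\<close>

lemma eq_on_dense_open:
  fixes f g :: "'a::topological_space \<Rightarrow> 'b::t2_space"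
  assumes "open U" "continuous_on U f" "continuous_on U g" "interior V = {}"
    and eq: "\<And>z. z \<in> U - V \<Longrightarrow> f z = g z" and z: "z \<in> U"
  shows "f z = g z"
proof (rule ccontr)
  assume "f z \<noteq> g z"
  have "open {u \<in> U. f u \<noteq> g u}"
  proof -
    have "open {x :: 'b \<times> 'b. fst x \<noteq> snd x}"
      by (intro open_Collect_neq continuous_intros)
    then have "open (U \<inter> (\<lambda>u. (f u, g u)) -` {x. fst x \<noteq> snd x})"
      using assms(1-3) by (intro continuous_open_preimage continuous_intros)
    moreover have "U \<inter> (\<lambda>u. (f u, g u)) -` {x. fst x \<noteq> snd x} = {u \<in> U. f u \<noteq> g u}" by auto
    ultimately show ?thesis by simp
  qed
  moreover have "{u \<in> U. f u \<noteq> g u} \<subseteq> V" using eq by blast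
  ultimately show False
    using \<open>interior V = {}\<close> interior_maximal z \<open>f z \<noteq> g z\<close> by blast
qed

lemma holomorphic2_interior_zeros:
  assumes "open U" "connected U" "holomorphic2_on h U" "\<exists>z\<in>U. h z \<noteq> 0"
  shows "interior {z \<in> U. h z = 0} = {}"
proof -
  have "{z \<in> U. h z = 0} = U \<or> interior {z \<in> U. h z = 0} = {}"
  proof (rule analytic_set_dichotomy[OF assms(1,2)], blast)
    fix p assume "p \<in> U"
    then show "\<exists>U' Fs. open U' \<and> p \<in> U' \<and> U' \<subseteq> U \<and> (\<forall>f\<in>Fs. holomorphic2_on f U') \<and>
        {z \<in> U. h z = 0} \<inter> U' = {u \<in> U'. \<forall>f\<in>Fs. f u = 0}"
      using assms(1,3) by (intro exI[of _ U] exI[of _ "{h}"]) auto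
  qed
  with assms(4) show ?thesis by blast
qed

text \<open>The factor \<open>h\<close> is nonzero on a dense set and continuity does the rest. This
  serves as the integral domain property in the later divisions by sections.\<close>

lemma holomorphic2_mult_cancel:
  assumes "open U" "connected U" "holomorphic2_on h U" "\<exists>z\<in>U. h z \<noteq> 0"
    and "holomorphic2_on f U" "holomorphic2_on g U"
    and eq: "\<And>z. z \<in> U \<Longrightarrow> h z * f z = h z * g z" and "z \<in> U"
  shows "f z = g z"
proof (rule eq_on_dense_open[OF assms(1) _ _ holomorphic2_interior_zeros[OF assms(1-4)] _ assms(8)])
  show "continuous_on U f" "continuous_on U g"
    using assms(5,6) holomorphic2_on_imp_continuous_on by blast+
  fix z assume "z \<in> U - {z \<in> U. h z = 0}"
  then show "f z = g z" using eq[of z] by auto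
qed

lemma open_punctured_plane: "open punctured_plane"
  unfolding punctured_plane_def by (simp add: open_Diff)

lemma connected_punctured_plane: "connected punctured_plane"
proof -
  have "connected (- {(0, 0) :: complex \<times> complex})"
    by (rule connected_punctured_universe) simp
  then show ?thesis by (simp add: punctured_plane_def Compl_eq_Diff_UNIV)
qed

lemma mem_punctured_plane: "(x, y) \<in> punctured_plane \<longleftrightarrow> x \<noteq> 0 \<or> y \<noteq> 0"
  by (auto simp: punctured_plane_def)

section \<open>Sections of line bundles\<close>

text \<open>The moduli of the powers of \<open>b\<close> are strictly decreasing. Equations between
  multipliers thereby become equations between weights.\<close>

lemma powi_inject:
  fixes b :: complex
  assumes b: "0 < cmod b" "cmod b < 1" and eq: "b powi m = b powi n"
  shows "m = n"
proof -
  have *: "\<not> m < n" if "b powi m = b powi n" for m n :: int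
  proof
    assume "m < n"
    then have "cmod b powi n < cmod b powi m" using b by (intro power_int_strict_decreasing) auto
    with that show False by (metis norm_power_int order_less_irrefl)
  qed
  show ?thesis using *[OF eq] *[OF eq[symmetric]] by linarith
qed

lemma entire_quasiperiodic:
  fixes b \<kappa> :: complex
  assumes b: "0 < cmod b" "cmod b < 1" and g: "g holomorphic_on UNIV"
    and gb: "\<And>t. g (b * t) = \<kappa> * g t"
  shows "(\<forall>t. g t = 0) \<or> (\<exists>n. \<kappa> = b ^ n \<and> (\<forall>t. g t = t ^ n * g 1))"
proof -
  define D where "D n = (deriv ^^ n) g 0 / fact n" for n
  \<comment> \<open>The functional equation is differentiated \<open>n\<close> times at
    \<open>0\<close>, the fixed point of multiplication by \<open>b\<close>. As the powers of
    \<open>b\<close> are distinct, at most one coefficient can survive.\<close>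
  have "b ^ n * D n = \<kappa> * D n" for n
  proof -
    have "(deriv ^^ n) (\<lambda>t. g (b * t)) 0 = b ^ n * (deriv ^^ n) g (b * 0)"
      by (rule higher_deriv_compose_linear[OF g, of UNIV]) auto
    moreover have "(deriv ^^ n) (\<lambda>t. \<kappa> * g t) 0 = \<kappa> * (deriv ^^ n) g 0"
      by (rule higher_deriv_cmult[OF g]) auto
    ultimately show ?thesis by (auto simp: D_def gb)
  qed
  then have D: "D n = 0 \<or> \<kappa> = b ^ n" for n by (metis mult_cancel_right)
  have sums: "(\<lambda>n. D n * t ^ n) sums g t" for t
    using holomorphic_power_series[of g 0 "cmod t + 1" t] holomorphic_on_subset[OF g subset_UNIV]
    by (simp add: D_def)
  show ?thesis
  proof (cases "\<forall>n. D n = 0")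
    case True
    then have "(\<lambda>n. 0) sums g t" for t using sums[of t] by simp
    then have "g t = 0" for t using sums_unique2[OF sums_zero] by metis
    then show ?thesis by blast
  next
    case False
    then obtain n where n: "D n \<noteq> 0" by blast
    have \<kappa>: "\<kappa> = b ^ n" using D n by blast
    have "D m = 0" if "m \<noteq> n" for m
    proof (rule ccontr)
      assume "D m \<noteq> 0"
      then have "b ^ m = b ^ n" using D[of m] \<kappa> by simp
      then have "b powi int m = b powi int n" by simp
      then show False using powi_inject[OF b] that by fastforce
    qed
    then have "(\<lambda>m. D m * t ^ m) sums (\<Sum>m\<in>{n}. D m * t ^ m)" for t
      by (intro sums_finite) auto
    then have "g t = D n * t ^ n" for t using sums_unique2[OF sums] by fastforce
    then show ?thesis using \<kappa> by auto
  qed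
qed

text \<open>The annulus \<open>cmod b \<le> cmod t \<le> 1\<close> is compact and its translates
  under multiplication by \<open>b\<close> fill the punctured disc; each step inwards costs a factor
  \<kappa>, which does not increase the modulus.\<close>

lemma quasiperiodic_bounded:
  fixes b \<kappa> :: complex
  assumes b: "0 < cmod b" "cmod b < 1" and H: "continuous_on (- {0}) H"
    and Hb: "\<And>t. t \<noteq> 0 \<Longrightarrow> H (b * t) = \<kappa> * H t" and \<kappa>: "cmod \<kappa> \<le> 1"
  shows "\<exists>M. \<forall>t. t \<noteq> 0 \<and> cmod t \<le> 1 \<longrightarrow> cmod (H t) \<le> M"
proof -
  define K where "K = cball 0 1 - ball (0::complex) (cmod b)"
  have "compact K" unfolding K_def by (intro compact_diff) auto
  moreover have "continuous_on K H"
    by (rule continuous_on_subset[OF H]) (use b in \<open>auto simp: K_def\<close>)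
  ultimately have "bounded (H ` K)" by (simp add: compact_continuous_image compact_imp_bounded)
  then obtain M where M: "\<And>t. t \<in> K \<Longrightarrow> cmod (H t) \<le> M" by (auto simp: bounded_iff)
  have *: "cmod (H t) \<le> M" if "t \<noteq> 0" "cmod t \<le> 1" "cmod b ^ Suc k \<le> cmod t" for k t
    using that
  proof (induction k arbitrary: t)
    case 0
    then show ?case by (intro M) (auto simp: K_def)
  next
    case (Suc k)
    show ?case
    proof (cases "cmod b \<le> cmod t")
      case True
      then show ?thesis using Suc.prems by (intro M) (auto simp: K_def)
    next
      case False
      have "b \<noteq> 0" using b by auto
      have "cmod (H (t / b)) \<le> M"
        using Suc.prems False b \<open>b \<noteq> 0\<close>
        by (intro Suc.IH) (auto simp: norm_divide field_simps)
      moreover have "H t = \<kappa> * H (t / b)" using Hb[of "t / b"] Suc.prems \<open>b \<noteq> 0\<close> by simp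
      ultimately show ?thesis
        using \<kappa> by (metis mult_left_le_one_le norm_ge_zero norm_mult order_trans)
    qed
  qed
  have "cmod (H t) \<le> M" if t: "t \<noteq> 0" "cmod t \<le> 1" for t
  proof -
    obtain k where "cmod b ^ k < cmod t" using real_arch_pow_inv[OF _ b(2), of "cmod t"] t by auto
    then have "cmod b ^ Suc k \<le> cmod t"
      using b power_decreasing[of k "Suc k" "cmod b"] by linarith
    with * t show ?thesis by blast
  qed
  then show ?thesis by blast
qed

lemma punctured_quasiperiodic:
  fixes b \<tau> :: complex
  assumes b: "0 < cmod b" "cmod b < 1" and G: "G holomorphic_on (- {0})"
    and Gb: "\<And>t. t \<noteq> 0 \<Longrightarrow> G (b * t) = \<tau> * G t"
  shows "(\<forall>t. t \<noteq> 0 \<longrightarrow> G t = 0) \<or> (\<exists>n. \<tau> = b powi n \<and> (\<forall>t. t \<noteq> 0 \<longrightarrow> G t = t powi n * G 1))"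
proof -
  have b0: "b \<noteq> 0" using b by auto
  \<comment> \<open>A factor \<open>t ^ N\<close> changes the multiplier from \<open>\<tau>\<close>
    to \<open>\<tau> * b ^ N\<close>. \<open>N\<close> is taken so large that the new multiplier has
    modulus below 1, which gives boundedness near the origin and a removable singularity.\<close>
  have "(\<lambda>N. cmod \<tau> * cmod b ^ N) \<longlonglongrightarrow> cmod \<tau> * 0"
    using b by (intro tendsto_intros LIMSEQ_realpow_zero) auto
  then have "\<forall>\<^sub>F N in sequentially. cmod \<tau> * cmod b ^ N < 1"
    by (rule order_tendstoD(2)) simp
  then obtain N where N: "cmod \<tau> * cmod b ^ N < 1"
    using eventually_happens'[OF sequentially_bot] by blast
  define \<kappa> where "\<kappa> = \<tau> * b ^ N"
  define H where "H t = t ^ N * G t" for t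
  have H: "H holomorphic_on (- {0})" unfolding H_def by (intro holomorphic_intros G)
  have Hb: "H (b * t) = \<kappa> * H t" if "t \<noteq> 0" for t
    using Gb[OF that] by (simp add: H_def \<kappa>_def power_mult_distrib)
  have "cmod \<kappa> \<le> 1" using N by (simp add: \<kappa>_def norm_mult norm_power)
  then have "\<exists>M. \<forall>t. t \<noteq> 0 \<and> cmod t \<le> 1 \<longrightarrow> cmod (H t) \<le> M"
    by (intro quasiperiodic_bounded[OF b, of H \<kappa>] holomorphic_on_imp_continuous_on H Hb)
  then obtain M where M: "\<And>t. t \<noteq> 0 \<and> cmod t \<le> 1 \<Longrightarrow> cmod (H t) \<le> M" by blast
  have "eventually (\<lambda>t. cmod (H t) \<le> M) (at 0)"
    using M unfolding eventually_at by (intro exI[of _ 1]) auto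
  then obtain g where g: "g holomorphic_on UNIV" "\<And>t. t \<noteq> 0 \<Longrightarrow> g t = H t"
    using holomorphic_on_extend_bounded[of H UNIV 0] H by (auto simp: Compl_eq_Diff_UNIV)
  have gb: "g (b * t) = \<kappa> * g t" for t
  proof (rule analytic_continuation_open[of "- {0}" UNIV "\<lambda>t. g (b * t)" "\<lambda>t. \<kappa> * g t"])
    show "- {0 :: complex} \<noteq> {}" by (metis ComplI empty_iff one_neq_zero singletonD)
    show "(\<lambda>t. g (b * t)) holomorphic_on UNIV"
      using holomorphic_on_compose[of "\<lambda>t. b * t" UNIV g] holomorphic_on_subset[OF g(1)]
      by (auto simp: o_def intro!: holomorphic_intros)
    show "(\<lambda>t. \<kappa> * g t) holomorphic_on UNIV" by (intro holomorphic_intros g)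
    show "g (b * z) = \<kappa> * g z" if "z \<in> - {0}" for z
      using that Hb[of z] g(2)[of z] g(2)[of "b * z"] b0 by simp
  qed auto
  from entire_quasiperiodic[OF b g(1) gb]
  show ?thesis
  proof
    assume "\<forall>t. g t = 0"
    then show ?thesis using g(2) by (simp add: H_def)
  next
    assume "\<exists>n. \<kappa> = b ^ n \<and> (\<forall>t. g t = t ^ n * g 1)"
    then obtain n where n: "\<kappa> = b ^ n" "\<And>t. g t = t ^ n * g 1" by blast
    have "\<tau> = b powi (int n - int N)"
      using n(1) b0 by (simp add: \<kappa>_def power_int_diff field_simps)
    moreover have "G t = t powi (int n - int N) * G 1" if "t \<noteq> 0" for t
      using n(2)[of t] g(2)[OF that] g(2)[of 1] that by (simp add: H_def power_int_diff field_simps)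
    ultimately show ?thesis by blast
  qed
qed

text \<open>Each weighted orbit yields its own exponent, but \<open>\<tau> = b powi n\<close> has
  only one solution, so all orbits on which \<open>s\<close> is nonzero share it; on the others any
  exponent works.\<close>

lemma H0_quasihomogeneous:
  assumes b: "0 < cmod b" "cmod b < 1" and s: "s \<in> H0 b r \<tau>"
  shows "(\<forall>z\<in>punctured_plane. s z = 0) \<or>
    (\<exists>n. \<tau> = b powi n \<and>
      (\<forall>x y t. (x, y) \<in> punctured_plane \<longrightarrow> t \<noteq> 0 \<longrightarrow> s (t ^ r * x, t * y) = t powi n * s (x, y)))"
proof -
  have dich: "s (x, y) = 0 \<and> (\<forall>t. t \<noteq> 0 \<longrightarrow> s (t ^ r * x, t * y) = 0) \<or>
    (\<exists>n. \<tau> = b powi n \<and> (\<forall>t. t \<noteq> 0 \<longrightarrow> s (t ^ r * x, t * y) = t powi n * s (x, y)))"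
    if xy: "(x, y) \<in> punctured_plane" for x y
  proof -
    have mem: "(t ^ r * x, t * y) \<in> punctured_plane" if "t \<noteq> 0" for t
      using xy that by (auto simp: mem_punctured_plane)
    have "(\<lambda>t. s (t ^ r * x, t * y)) holomorphic_on (- {0})"
    proof (rule holomorphic2_on_curve[of s punctured_plane])
      show "holomorphic2_on s punctured_plane" using s by (simp add: H0_def)
    qed (auto intro!: holomorphic_intros mem)
    moreover have "s ((b * t) ^ r * x, b * t * y) = \<tau> * s (t ^ r * x, t * y)" if "t \<noteq> 0" for t
    proof -
      have "s (hopf_map b r (t ^ r * x, t * y)) = \<tau> * s (t ^ r * x, t * y)"
        using s mem[OF that] by (simp add: H0_def)
      then show ?thesis by (simp add: hopf_map_def power_mult_distrib mult_ac)
    qed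
    ultimately have "(\<forall>t. t \<noteq> 0 \<longrightarrow> s (t ^ r * x, t * y) = 0) \<or>
      (\<exists>n. \<tau> = b powi n \<and> (\<forall>t. t \<noteq> 0 \<longrightarrow> s (t ^ r * x, t * y) = t powi n * s (1 ^ r * x, 1 * y)))"
      by (rule punctured_quasiperiodic[OF b])
    then show ?thesis
    proof
      assume *: "\<forall>t. t \<noteq> 0 \<longrightarrow> s (t ^ r * x, t * y) = 0"
      moreover from this have "s (x, y) = 0" by (metis one_neq_zero power_one mult_1)
      ultimately show ?thesis by blast
    qed simp
  qed
  show ?thesis
  proof (cases "\<forall>z\<in>punctured_plane. s z = 0")
    case False
    then obtain x0 y0 where "(x0, y0) \<in> punctured_plane" "s (x0, y0) \<noteq> 0" by auto
    then obtain n where n: "\<tau> = b powi n" using dich[of x0 y0] by blast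
    have "s (t ^ r * x, t * y) = t powi n * s (x, y)"
      if xy: "(x, y) \<in> punctured_plane" and t: "t \<noteq> 0" for x y t
      using dich[OF xy]
    proof
      assume "\<exists>n. \<tau> = b powi n \<and> (\<forall>t. t \<noteq> 0 \<longrightarrow> s (t ^ r * x, t * y) = t powi n * s (x, y))"
      then obtain m where m: "b powi n = b powi m"
        "\<forall>t. t \<noteq> 0 \<longrightarrow> s (t ^ r * x, t * y) = t powi m * s (x, y)" unfolding n by blast
      with powi_inject[OF b m(1)] t show ?thesis by blast
    qed (use t in auto)
    with n show ?thesis by blast
  qed blast
qed

text \<open>The axis \<open>y = 0\<close> is the zero set of \<open>snd\<close>, a factor that can
  be cancelled.\<close>

lemma holomorphic2_eq_off_axis:
  assumes "holomorphic2_on f punctured_plane" "holomorphic2_on g punctured_plane"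
    and eq: "\<And>x y. y \<noteq> 0 \<Longrightarrow> f (x, y) = g (x, y)" and "z \<in> punctured_plane"
  shows "f z = g z"
proof (rule holomorphic2_mult_cancel[OF open_punctured_plane connected_punctured_plane
      holomorphic2_on_snd _ assms(1,2) _ assms(4)])
  show "\<exists>z\<in>punctured_plane. snd z \<noteq> 0"
    by (rule bexI[of _ "(0, 1)"]) (auto simp: mem_punctured_plane)
  show "snd z * f z = snd z * g z" for z
    using eq[of "snd z" "fst z"] by auto
qed

text \<open>Off the axis \<open>s (x, y) = y powi n * g (x / y ^ r)\<close>, where
  \<open>g w = s (w, 1)\<close> is entire. The values \<open>s (1, y)\<close> are bounded for
  \<open>cmod y \<le> 1\<close>, the point \<open>y = 0\<close> included; this limits the growth of
  \<open>g w\<close> to that of \<open>cmod w\<close> to the power \<open>n / r\<close>, so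
  \<open>g\<close> is a polynomial.\<close>

lemma quasihomogeneous_expansion:
  assumes hol: "holomorphic2_on s punctured_plane" and r: "r > 0"
    and hom: "\<And>x y t. (x, y) \<in> punctured_plane \<Longrightarrow> t \<noteq> 0 \<Longrightarrow>
      s (t ^ r * x, t * y) = t powi n * s (x, y)"
    and ne: "z \<in> punctured_plane" "s z \<noteq> 0"
  shows "\<exists>m a. n = int m \<and>
    (\<forall>x y. (x, y) \<in> punctured_plane \<longrightarrow> s (x, y) = (\<Sum>i\<le>m div r. a i * x ^ i * y ^ (m - r * i)))"
proof -
  define g where "g w = s (w, 1)" for w
  define a where "a i = (deriv ^^ i) g 0 / fact i" for i
  have g: "g holomorphic_on UNIV"
    unfolding g_def by (rule holomorphic2_on_curve[OF hol])
      (auto intro!: holomorphic_intros simp: mem_punctured_plane)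
  have s_g: "s (x, y) = y powi n * g (x / y ^ r)" if "y \<noteq> 0" for x y
    using hom[of "x / y ^ r" 1 y] that by (simp add: g_def mem_punctured_plane)
  have "compact ({1 :: complex} \<times> cball (0 :: complex) 1)" by (intro compact_Times) auto
  moreover have "continuous_on ({1} \<times> cball 0 1) s"
    by (rule continuous_on_subset[OF holomorphic2_on_imp_continuous_on[OF hol]])
       (auto simp: mem_punctured_plane)
  ultimately have "bounded (s ` ({1} \<times> cball 0 1))"
    by (simp add: compact_continuous_image compact_imp_bounded)
  then obtain M where M: "\<And>y. cmod y \<le> 1 \<Longrightarrow> cmod (s (1, y)) \<le> M"
    unfolding bounded_iff by fastforce
  have growth: "cmod (g w) \<le> M * \<rho> powi n" if \<rho>: "\<rho> \<ge> 1" and w: "cmod w = \<rho> ^ r" for w \<rho>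
  proof -
    have "w \<noteq> 0" using w \<rho> by auto
    \<comment> \<open>An \<open>r\<close>-th root of \<open>1 / w\<close> moves
      \<open>(w, 1)\<close> along its weighted orbit to \<open>(1, y)\<close>, where the compactness
      bound \<open>M\<close> applies.\<close>
    obtain y where "y \<noteq> 0" and y: "y ^ r = inverse w"
      using exists_complex_root_nonzero[of "inverse w" r] \<open>w \<noteq> 0\<close> r
      by (metis less_numeral_extra(3) nonzero_imp_inverse_nonzero)
    have "cmod y ^ r = inverse \<rho> ^ r"
      using arg_cong[OF y, of cmod] w by (simp add: norm_power norm_inverse power_inverse)
    then have cy: "cmod y = inverse \<rho>"
      using r \<rho> power_eq_iff_eq_base[of r "cmod y" "inverse \<rho>"] by simp
    have "cmod (s (1, y)) = inverse \<rho> powi n * cmod (g w)"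
      using s_g[OF \<open>y \<noteq> 0\<close>, of 1] y \<open>w \<noteq> 0\<close>
      by (simp add: norm_mult norm_power_int cy divide_inverse)
    moreover have "cmod (s (1, y)) \<le> M" using M cy \<rho> by (simp add: inverse_le_1_iff)
    moreover have "0 < \<rho> powi n" using \<rho> by simp
    moreover have "u = inverse P * v \<Longrightarrow> u \<le> M \<Longrightarrow> 0 < P \<Longrightarrow> v \<le> M * P" for u v P :: real
      by (simp add: field_simps) (metis less_imp_le mult.commute mult_left_mono)
    ultimately show ?thesis by (metis power_int_inverse)
  qed
  have a0: "a i = 0" if i: "int (r * i) > n" for i
  proof -
    \<comment> \<open>At radius \<open>\<rho> ^ r\<close> Cauchy's inequality gives
      \<open>cmod (a i) \<le> M * \<rho> powi (n - int (r * i))\<close>. The exponent is at most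
      \<open>-1\<close>, so a single factor \<open>\<rho>\<close> can be kept.\<close>
    have bound: "cmod (a i) * \<rho> \<le> M" if \<rho>: "\<rho> \<ge> 1" for \<rho>
    proof -
      have "cmod ((deriv ^^ i) g 0) \<le> fact i * (M * \<rho> powi n) / (\<rho> ^ r) ^ i"
      proof (rule Cauchy_inequality)
        show "g holomorphic_on ball 0 (\<rho> ^ r)" using g holomorphic_on_subset by blast
        show "continuous_on (cball 0 (\<rho> ^ r)) g"
          using holomorphic_on_imp_continuous_on[OF g] continuous_on_subset by blast
        show "0 < \<rho> ^ r" using \<rho> by simp
        show "cmod (g x) \<le> M * \<rho> powi n" if "cmod (0 - x) = \<rho> ^ r" for x
          using growth[OF \<rho>, of x] that by simp
      qed
      moreover have "(\<rho> ^ r) ^ i = \<rho> powi int (r * i)"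
        by (simp only: power_int_of_nat power_mult)
      moreover have "d / F * (Q / P) \<le> M" if "d \<le> F * (M * P) / Q" "F > 0" "P > 0" "Q > 0"
        for d F P Q :: real
      proof -
        have "d / F * (Q / P) \<le> F * (M * P) / Q / F * (Q / P)"
          using that by (intro mult_right_mono divide_right_mono) auto
        then show ?thesis using that by simp
      qed
      moreover have "0 < \<rho> powi n" "0 < \<rho> powi int (r * i)" "0 < (fact i :: real)"
        using \<rho> by simp_all
      ultimately have "cmod ((deriv ^^ i) g 0) / fact i * (\<rho> powi int (r * i) / \<rho> powi n) \<le> M"
        by metis
      then have "cmod (a i) * \<rho> powi (int (r * i) - n) \<le> M"
        using \<rho> by (simp add: a_def norm_divide power_int_diff)
      moreover have "\<rho> powi 1 \<le> \<rho> powi (int (r * i) - n)"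
        using i \<rho> by (intro power_int_increasing) auto
      then have "cmod (a i) * \<rho> \<le> cmod (a i) * \<rho> powi (int (r * i) - n)"
        by (intro mult_left_mono) auto
      ultimately show ?thesis by linarith
    qed
    show ?thesis
    proof (rule ccontr)
      assume "a i \<noteq> 0"
      then have "cmod (a i) > 0" by simp
      \<comment> \<open>At least 1, as \<open>bound\<close> requires, and large enough to push
        \<open>cmod (a i) * \<rho>\<close> up to \<open>M + 1\<close>.\<close>
      define \<rho> where "\<rho> = max 1 ((M + 1) / cmod (a i))"
      have "(M + 1) / cmod (a i) \<le> \<rho>" by (simp add: \<rho>_def)
      then have "M + 1 \<le> cmod (a i) * \<rho>" using \<open>cmod (a i) > 0\<close> by (simp add: field_simps)
      with bound[of \<rho>] show False by (simp add: \<rho>_def)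
    qed
  qed
  have sums: "(\<lambda>i. a i * w ^ i) sums g w" for w
    using holomorphic_power_series[of g 0 "cmod w + 1" w] holomorphic_on_subset[OF g subset_UNIV]
    by (simp add: a_def)
  \<comment> \<open>For negative \<open>n\<close> even \<open>a 0\<close> falls under
    \<open>a0\<close>. Then \<open>s\<close> would vanish off the axis and hence everywhere.\<close>
  have "n \<ge> 0"
  proof (rule ccontr)
    assume "\<not> n \<ge> 0"
    then have "a i = 0" for i by (intro a0) (use of_nat_0_le_iff[of "r * i"] in linarith)
    then have "g w = 0" for w using sums[of w] sums_unique2[OF sums_zero] by simp
    then have "s (x, y) = 0" if "y \<noteq> 0" for x y using s_g[OF that] by simp
    then have "s z = 0"
      using holomorphic2_eq_off_axis[OF hol holomorphic2_on_const[of 0] _ ne(1)] by simp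
    with ne(2) show False by simp
  qed
  then obtain m where m: "n = int m" using nonneg_int_cases by blast
  have "g w = (\<Sum>i\<le>m div r. a i * w ^ i)" for w
  proof (rule sums_unique2[OF sums sums_finite])
    fix i assume "i \<notin> {..m div r}"
    then have "r * i > m" using r by (simp add: div_less_iff_less_mult mult.commute not_le)
    then have "int (r * i) > n" using m by (simp only: of_nat_less_iff)
    then show "a i * w ^ i = 0" by (simp add: a0)
  qed simp
  note g_eq = this
  have eq: "s (x, y) = (\<Sum>i\<le>m div r. a i * x ^ i * y ^ (m - r * i))" if y: "y \<noteq> 0" for x y
  proof -
    have "s (x, y) = (\<Sum>i\<le>m div r. y ^ m * (a i * (x / y ^ r) ^ i))"
      using s_g[OF y, of x] by (simp add: g_eq m sum_distrib_left)
    also have "\<dots> = (\<Sum>i\<le>m div r. a i * x ^ i * y ^ (m - r * i))"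
    proof (rule sum.cong[OF refl])
      fix i assume "i \<in> {..m div r}"
      then have "r * i \<le> m" using r by (simp add: less_eq_div_iff_mult_less_eq mult.commute)
      then have "y ^ m = y ^ (m - r * i) * (y ^ r) ^ i"
        by (simp flip: power_mult power_add)
      then show "y ^ m * (a i * (x / y ^ r) ^ i) = a i * x ^ i * y ^ (m - r * i)"
        using y by (simp add: power_divide field_simps)
    qed
    finally show ?thesis .
  qed
  have "s (x, y) = (\<Sum>i\<le>m div r. a i * x ^ i * y ^ (m - r * i))"
    if xy: "(x, y) \<in> punctured_plane" for x y
  proof -
    have "s (x, y) = (\<lambda>p. \<Sum>i\<le>m div r. a i * fst p ^ i * snd p ^ (m - r * i)) (x, y)"
      by (rule holomorphic2_eq_off_axis[OF hol _ _ xy]) (auto intro!: holomorphic2_intros eq)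
    then show ?thesis by simp
  qed
  with m show ?thesis by blast
qed

section \<open>Algebra of sections and their multipliers\<close>

lemma H0_const: "(\<lambda>z. c) \<in> H0 b r 1"
  by (simp add: H0_def holomorphic2_on_const)

lemma H0_zero: "(\<lambda>z. 0) \<in> H0 b r \<tau>"
  by (simp add: H0_def holomorphic2_on_const)

lemma H0_fst: "fst \<in> H0 b r (b ^ r)"
  by (auto simp: H0_def holomorphic2_on_fst hopf_map_def)

lemma H0_snd: "snd \<in> H0 b r b"
  by (auto simp: H0_def holomorphic2_on_snd hopf_map_def)

lemma hopf_map_mem:
  assumes "b \<noteq> 0" shows "hopf_map b r z \<in> punctured_plane \<longleftrightarrow> z \<in> punctured_plane"
  using assms by (cases z) (auto simp: hopf_map_def mem_punctured_plane)

lemma H0_add: "f \<in> H0 b r \<tau> \<Longrightarrow> g \<in> H0 b r \<tau> \<Longrightarrow> (\<lambda>z. f z + g z) \<in> H0 b r \<tau>"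
  by (auto simp: H0_def algebra_simps intro: holomorphic2_on_add)

lemma H0_mult:
  "f \<in> H0 b r \<sigma> \<Longrightarrow> g \<in> H0 b r \<tau> \<Longrightarrow> \<sigma> * \<tau> = \<rho> \<Longrightarrow> (\<lambda>z. f z * g z) \<in> H0 b r \<rho>"
  by (auto simp: H0_def algebra_simps intro: holomorphic2_on_mult)

lemma H0_cmult: "f \<in> H0 b r \<tau> \<Longrightarrow> (\<lambda>z. c * f z) \<in> H0 b r \<tau>"
  by (rule H0_mult[OF H0_const]) auto

lemma H0_divide_const: "f \<in> H0 b r \<tau> \<Longrightarrow> (\<lambda>z. f z / c) \<in> H0 b r \<tau>"
  using H0_cmult[of f b r \<tau> "inverse c"] by (simp add: divide_inverse mult.commute)

lemma H0_uminus: "f \<in> H0 b r \<tau> \<Longrightarrow> (\<lambda>z. - f z) \<in> H0 b r \<tau>"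
  using H0_cmult[of f b r \<tau> "-1"] by simp

lemma H0_diff: "f \<in> H0 b r \<tau> \<Longrightarrow> g \<in> H0 b r \<tau> \<Longrightarrow> (\<lambda>z. f z - g z) \<in> H0 b r \<tau>"
  using H0_add[OF _ H0_uminus, of f b r \<tau> g] by simp

lemma H0_power: "f \<in> H0 b r \<tau> \<Longrightarrow> (\<lambda>z. f z ^ n) \<in> H0 b r (\<tau> ^ n)"
  by (auto simp: H0_def power_mult_distrib intro: holomorphic2_on_power)

lemma H0_sum: "(\<And>i. i \<in> I \<Longrightarrow> f i \<in> H0 b r \<tau>) \<Longrightarrow> (\<lambda>z. \<Sum>i\<in>I. f i z) \<in> H0 b r \<tau>"
  by (induction I rule: infinite_finite_induct) (auto intro: H0_zero H0_add)

text \<open>Weight count: \<open>x\<close> contributes \<open>r\<close> and \<open>y\<close>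
  contributes 1, their multipliers being \<open>b ^ r\<close> and \<open>b\<close>.\<close>

lemma H0_monomial:
  assumes "r * i + j = m"
  shows "(\<lambda>z. c * fst z ^ i * snd z ^ j) \<in> H0 b r (b ^ m)"
  by (rule H0_mult[OF H0_cmult[OF H0_power[OF H0_fst]] H0_power[OF H0_snd]])
    (simp add: assms flip: power_mult power_add)

lemma H0_snd_power: "(\<lambda>z. c * snd z ^ j) \<in> H0 b r (b ^ j)"
  using H0_monomial[of r 0 j j c b] by simp

text \<open>For \<open>b \<noteq> 0\<close> the Hopf map keeps points inside the punctured plane, so
  neither defining condition sees the value at the origin.\<close>

lemma H0_cong:
  assumes "b \<noteq> 0" and eq: "\<And>z. z \<in> punctured_plane \<Longrightarrow> f z = g z"
  shows "f \<in> H0 b r \<tau> \<longleftrightarrow> g \<in> H0 b r \<tau>"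
  using holomorphic2_on_cong[OF open_punctured_plane eq] hopf_map_mem[OF \<open>b \<noteq> 0\<close>]
  by (auto simp: H0_def eq)

lemma H0_divide:
  assumes "f \<in> H0 b r \<sigma>" "g \<in> H0 b r \<tau>" "nowhere_vanishing g"
  shows "(\<lambda>z. f z / g z) \<in> H0 b r (\<sigma> / \<tau>)"
  using assms by (auto simp: H0_def nowhere_vanishing_def intro: holomorphic2_on_divide)

section \<open>Sections of a given weight on a fixed Hopf surface\<close>

locale hopf_surface =
  fixes b :: complex and r :: nat
  assumes b_pos: "0 < cmod b" and b_less_1: "cmod b < 1" and r_pos: "0 < r"
begin

lemma b_nonzero: "b \<noteq> 0"
  using b_pos by auto

lemma power_b_inject: "b ^ m = b ^ n \<longleftrightarrow> m = n"
  using powi_inject[OF b_pos b_less_1, of "int m" "int n"] by auto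

lemma H0_nonzero_expansion:
  assumes "s \<in> H0 b r \<tau>" "z \<in> punctured_plane" "s z \<noteq> 0"
  obtains m a where "\<tau> = b ^ m"
    "\<And>x y. (x, y) \<in> punctured_plane \<Longrightarrow> s (x, y) = (\<Sum>i\<le>m div r. a i * x ^ i * y ^ (m - r * i))"
proof -
  obtain n where n: "\<tau> = b powi n" and hom: "\<And>x y t. (x, y) \<in> punctured_plane \<Longrightarrow> t \<noteq> 0 \<Longrightarrow>
      s (t ^ r * x, t * y) = t powi n * s (x, y)"
    using H0_quasihomogeneous[OF b_pos b_less_1 assms(1)] assms(2,3) by blast
  have "holomorphic2_on s punctured_plane" using assms(1) by (simp add: H0_def)
  from quasihomogeneous_expansion[OF this r_pos hom assms(2,3)]
  obtain m a where m: "n = int m" and a: "\<forall>x y. (x, y) \<in> punctured_plane \<longrightarrow>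
    s (x, y) = (\<Sum>i\<le>m div r. a i * x ^ i * y ^ (m - r * i))" by blast
  show ?thesis by (rule that[of m a]) (use n m a in auto)
qed

lemma H0_expansion:
  assumes "s \<in> H0 b r (b ^ m)"
  obtains a where
    "\<And>x y. (x, y) \<in> punctured_plane \<Longrightarrow> s (x, y) = (\<Sum>i\<le>m div r. a i * x ^ i * y ^ (m - r * i))"
proof (cases "\<forall>z\<in>punctured_plane. s z = 0")
  case True
  then show ?thesis by (intro that[of "\<lambda>i. 0"]) simp
next
  case False
  then obtain z where z: "z \<in> punctured_plane" "s z \<noteq> 0" by blast
  obtain n a where "b ^ m = b ^ n" and
    a: "\<And>x y. (x, y) \<in> punctured_plane \<Longrightarrow> s (x, y) = (\<Sum>i\<le>n div r. a i * x ^ i * y ^ (n - r * i))"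
    using H0_nonzero_expansion[OF assms z] by blast
  then have "n = m" using power_b_inject by simp
  with a show ?thesis by (intro that[of a]) simp
qed

text \<open>A nonzero value would force the multiplier to be a power of \<open>b\<close> with
  natural exponent.\<close>

lemma H0_negative:
  assumes "s \<in> H0 b r (b powi (- int n))" "n > 0" "z \<in> punctured_plane"
  shows "s z = 0"
proof (rule ccontr)
  assume "s z \<noteq> 0"
  then show False
  proof (rule H0_nonzero_expansion[OF assms(1,3)])
    fix m assume "b powi (- int n) = b ^ m"
    then have "b powi (- int n) = b powi int m" by simp
    from powi_inject[OF b_pos b_less_1 this] show False using assms(2) by linarith
  qed
qed

text \<open>The variable \<open>x\<close> has weight \<open>r\<close>, too much to occur in weight
  \<open>m < r\<close>.\<close>

lemma H0_low:
  assumes "s \<in> H0 b r (b ^ m)" "m < r"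
  obtains c where "\<And>x y. (x, y) \<in> punctured_plane \<Longrightarrow> s (x, y) = c * y ^ m"
proof -
  obtain a where
    "\<And>x y. (x, y) \<in> punctured_plane \<Longrightarrow> s (x, y) = (\<Sum>i\<le>m div r. a i * x ^ i * y ^ (m - r * i))"
    using H0_expansion[OF assms(1)] by blast
  then show ?thesis using assms(2) by (intro that[of "a 0"]) simp
qed

lemma H0_one:
  assumes "s \<in> H0 b r 1"
  obtains c where "\<And>z. z \<in> punctured_plane \<Longrightarrow> s z = c"
proof -
  have "s \<in> H0 b r (b ^ 0)" using assms by simp
  then obtain c where "\<And>x y. (x, y) \<in> punctured_plane \<Longrightarrow> s (x, y) = c * y ^ 0"
    using H0_low r_pos by blast
  then show ?thesis by (intro that[of c]) auto
qed

text \<open>The weight \<open>r + j < 2 * r\<close> leaves room for at most one factor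
  \<open>x\<close>. This linearity later allows the spectral curve to be solved for
  \<open>x\<close>.\<close>

lemma H0_mid:
  assumes "s \<in> H0 b r (b ^ (r + j))" "j < r"
  obtains a c where "\<And>x y. (x, y) \<in> punctured_plane \<Longrightarrow> s (x, y) = y ^ j * (a * x + c * y ^ r)"
proof -
  obtain a where
    a: "\<And>x y. (x, y) \<in> punctured_plane \<Longrightarrow>
      s (x, y) = (\<Sum>i\<le>(r + j) div r. a i * x ^ i * y ^ (r + j - r * i))"
    using H0_expansion[OF assms(1)] by blast
  have "(r + j) div r = 1" using assms(2) r_pos by simp
  then have "(x, y) \<in> punctured_plane \<Longrightarrow> s (x, y) = y ^ j * (a 1 * x + a 0 * y ^ r)" for x y
    using a[of x y] by (simp add: power_add algebra_simps)
  then show ?thesis by (rule that)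
qed

text \<open>Among the monomials of a fixed weight only a pure power of \<open>x\<close> is nonzero
  at \<open>(1, 0)\<close>, and \<open>x ^ k\<close> has weight \<open>k * r\<close>.\<close>

lemma H0_axis:
  assumes "s \<in> H0 b r \<tau>" "s (1, 0) \<noteq> 0"
  obtains k where "\<tau> = b ^ (k * r)"
proof -
  have "(1, 0) \<in> punctured_plane" by (simp add: mem_punctured_plane)
  from H0_nonzero_expansion[OF assms(1) this assms(2)] obtain m a where
    m: "\<tau> = b ^ m" and
    s: "\<And>x y. (x, y) \<in> punctured_plane \<Longrightarrow> s (x, y) = (\<Sum>i\<le>m div r. a i * x ^ i * y ^ (m - r * i))"
    by blast
  have "(\<Sum>i\<le>m div r. a i * 1 ^ i * 0 ^ (m - r * i)) \<noteq> 0"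
    using s[of 1 0] assms(2) by (simp add: mem_punctured_plane)
  then obtain i where i: "i \<le> m div r" "a i * 1 ^ i * 0 ^ (m - r * i) \<noteq> 0"
    by (meson sum.not_neutral_contains_not_neutral atMost_iff)
  then have "m - r * i = 0" by (metis mult_zero_right neq0_conv zero_power)
  \<comment> \<open>Excludes that \<open>m - r * i\<close> is zero merely through
    truncation.\<close>
  moreover have "r * i \<le> m" using i(1) r_pos by (simp add: less_eq_div_iff_mult_less_eq mult.commute)
  ultimately have "m = i * r" by (simp add: mult.commute)
  with m that show ?thesis by blast
qed

end

section \<open>Conjugation of Higgs fields\<close>

lemma matrix_inv_invertible:
  fixes A :: "'a::semiring_1 ^ 'n ^ 'm"
  assumes "invertible A"
  shows "A ** matrix_inv A = mat 1" "matrix_inv A ** A = mat 1"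
  using someI_ex[OF assms[unfolded invertible_def]] unfolding matrix_inv_def by auto

text \<open>Multiplication by \<open>A z\<close> on the right removes the inverse and leaves a
  condition that is linear in the entries of \<open>A\<close>.\<close>

lemma conjugate_iff:
  "conjugate b r \<tau> \<phi> \<psi> \<longleftrightarrow>
    (\<exists>A. bundle_automorphism b r \<tau> A \<and> (\<forall>z\<in>punctured_plane. \<psi> z ** A z = A z ** \<phi> z))"
proof -
  have *: "Q = A ** P ** matrix_inv A \<longleftrightarrow> Q ** A = A ** P" if "invertible A" for A P Q :: "complex ^ 2 ^ 2"
  proof
    assume "Q = A ** P ** matrix_inv A"
    then show "Q ** A = A ** P"
      by (simp add: matrix_inv_invertible[OF that] flip: matrix_mul_assoc)
  next
    assume "Q ** A = A ** P"
    then have "A ** P ** matrix_inv A = Q ** (A ** matrix_inv A)" by (simp add: matrix_mul_assoc)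
    then show "Q = A ** P ** matrix_inv A" by (simp add: matrix_inv_invertible[OF that])
  qed
  have "bundle_automorphism b r \<tau> A \<and>
      (\<forall>z\<in>punctured_plane. \<psi> z = A z ** \<phi> z ** matrix_inv (A z)) \<longleftrightarrow>
    bundle_automorphism b r \<tau> A \<and> (\<forall>z\<in>punctured_plane. \<psi> z ** A z = A z ** \<phi> z)" for A
  proof (intro conj_cong refl ball_cong)
    fix z assume "bundle_automorphism b r \<tau> A" "z \<in> punctured_plane"
    then show "\<psi> z = A z ** \<phi> z ** matrix_inv (A z) \<longleftrightarrow> \<psi> z ** A z = A z ** \<phi> z"
      unfolding bundle_automorphism_def by (intro *) blast
  qed
  then show ?thesis unfolding conjugate_def by (rule ex_cong1)
qed

lemma mat2_eq_iff:
  fixes A B :: "'a ^ 2 ^ 2"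
  shows "A = B \<longleftrightarrow> A $ 1 $ 1 = B $ 1 $ 1 \<and> A $ 1 $ 2 = B $ 1 $ 2 \<and>
    A $ 2 $ 1 = B $ 2 $ 1 \<and> A $ 2 $ 2 = B $ 2 $ 2"
  by (simp add: vec_eq_iff forall_2 conj_assoc)

text \<open>These are the four entries of \<open>Q ** A = A ** P\<close>, row by row, for the upper
  triangular \<open>A\<close> with rows \<open>(a, c)\<close> and \<open>(0, e)\<close>.\<close>

definition triangular_intertwiner ::
  "complex \<Rightarrow> complex \<Rightarrow> complex \<Rightarrow> complex ^ 2 ^ 2 \<Rightarrow> complex ^ 2 ^ 2 \<Rightarrow> bool" where
  "triangular_intertwiner a e c P Q \<longleftrightarrow>
     Q $ 1 $ 1 * a = a * P $ 1 $ 1 + c * P $ 2 $ 1 \<and>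
     Q $ 1 $ 1 * c + Q $ 1 $ 2 * e = a * P $ 1 $ 2 + c * P $ 2 $ 2 \<and>
     Q $ 2 $ 1 * a = e * P $ 2 $ 1 \<and>
     Q $ 2 $ 1 * c + Q $ 2 $ 2 * e = e * P $ 2 $ 2"

lemma triangular_intertwiner_iff:
  assumes "A $ 1 $ 1 = a" "A $ 1 $ 2 = c" "A $ 2 $ 1 = 0" "A $ 2 $ 2 = e"
  shows "Q ** A = A ** P \<longleftrightarrow> triangular_intertwiner a e c P Q"
  unfolding mat2_eq_iff triangular_intertwiner_def
  by (simp add: matrix_matrix_mult_def sum_2 assms conj_ac)

text \<open>The denominator \<open>ln (cmod b)\<close> is negative and reverses the sign.\<close>

lemma bundle_degree_nonpos_iff:
  assumes "0 < cmod b" "cmod b < 1" "\<tau> \<noteq> 0"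
  shows "bundle_degree b \<tau> \<le> 0 \<longleftrightarrow> 1 \<le> cmod \<tau>"
proof -
  have "ln (cmod b) < 0" using assms by simp
  then show ?thesis using assms(3) by (simp add: bundle_degree_def divide_le_0_iff)
qed

context hopf_surface
begin

lemma norm_powi_ge_1_iff: "1 \<le> cmod (b powi n) \<longleftrightarrow> n \<le> 0"
proof (cases n)
  case (nonneg m)
  then show ?thesis
    using b_pos b_less_1 power_strict_decreasing[of 0 m "cmod b"] by (cases "m = 0") (auto simp: norm_power)
next
  case (neg m)
  have "1 \<le> inverse (cmod b ^ Suc m)"
    using b_pos b_less_1 by (intro one_le_inverse power_le_one) auto
  then show ?thesis using neg by (simp add: norm_mult norm_inverse norm_power power_int_minus del: of_nat_Suc)
qed

text \<open>The lower left entry of an automorphism is a section of \<open>H\<close>, which has a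
  negative power of \<open>b\<close> as multiplier, so it is zero. The diagonal entries are sections
  of the trivial bundle, hence constants, and invertibility makes them nonzero.\<close>

lemma conjugate_triangular_iff:
  assumes "\<tau> = b powi (- int n)" "n > 0"
  shows "conjugate b r \<tau> \<phi> \<psi> \<longleftrightarrow> (\<exists>a e c. a \<noteq> 0 \<and> e \<noteq> 0 \<and> c \<in> H0 b r (b ^ n) \<and>
    (\<forall>z\<in>punctured_plane. triangular_intertwiner a e (c z) (\<phi> z) (\<psi> z)))"
proof
  have inv: "1 / \<tau> = b ^ n" by (simp add: assms(1) power_int_minus inverse_eq_divide)
  {
    assume "conjugate b r \<tau> \<phi> \<psi>"
    then obtain A where A: "A \<in> twisted_End b r 1 \<tau>" "\<forall>z\<in>punctured_plane. invertible (A z)"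
      and eq: "\<forall>z\<in>punctured_plane. \<psi> z ** A z = A z ** \<phi> z"
      unfolding conjugate_iff bundle_automorphism_def by blast
    have H: "(\<lambda>z. A z $ 1 $ 1) \<in> H0 b r 1" "(\<lambda>z. A z $ 1 $ 2) \<in> H0 b r (b ^ n)"
      "(\<lambda>z. A z $ 2 $ 1) \<in> H0 b r \<tau>" "(\<lambda>z. A z $ 2 $ 2) \<in> H0 b r 1"
      using A(1) by (simp_all add: twisted_End_def inv)
    obtain a where a: "\<And>z. z \<in> punctured_plane \<Longrightarrow> A z $ 1 $ 1 = a" using H0_one[OF H(1)] by blast
    obtain e where e: "\<And>z. z \<in> punctured_plane \<Longrightarrow> A z $ 2 $ 2 = e" using H0_one[OF H(4)] by blast
    have z: "\<And>z. z \<in> punctured_plane \<Longrightarrow> A z $ 2 $ 1 = 0"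
      using H0_negative[OF H(3)[unfolded assms(1)] assms(2)] .
    have pp: "(1, 0) \<in> punctured_plane" by (simp add: mem_punctured_plane)
    have "det (A (1, 0)) \<noteq> 0" using A(2) pp invertible_det_nz by blast
    then have "a \<noteq> 0" "e \<noteq> 0" using a[OF pp] e[OF pp] z[OF pp] by (auto simp: det_2)
    moreover have "triangular_intertwiner a e (A z $ 1 $ 2) (\<phi> z) (\<psi> z)"
      if "z \<in> punctured_plane" for z
      using triangular_intertwiner_iff[OF a[OF that] refl z[OF that] e[OF that]] eq that by blast
    ultimately show "\<exists>a e c. a \<noteq> 0 \<and> e \<noteq> 0 \<and> c \<in> H0 b r (b ^ n) \<and>
        (\<forall>z\<in>punctured_plane. triangular_intertwiner a e (c z) (\<phi> z) (\<psi> z))"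
      using H(2) by - (rule exI[of _ a], rule exI[of _ e], rule exI[of _ "\<lambda>z. A z $ 1 $ 2"], blast)
  next
    assume "\<exists>a e c. a \<noteq> 0 \<and> e \<noteq> 0 \<and> c \<in> H0 b r (b ^ n) \<and>
        (\<forall>z\<in>punctured_plane. triangular_intertwiner a e (c z) (\<phi> z) (\<psi> z))"
    then obtain a e c where ae: "a \<noteq> 0" "e \<noteq> 0" and c: "c \<in> H0 b r (b ^ n)"
      and eq: "\<forall>z\<in>punctured_plane. triangular_intertwiner a e (c z) (\<phi> z) (\<psi> z)"
      by blast
    define A :: "complex \<times> complex \<Rightarrow> complex ^ 2 ^ 2" where
      "A z = vector [vector [a, c z], vector [0, e]]" for z
    have A: "A z $ 1 $ 1 = a" "A z $ 1 $ 2 = c z" "A z $ 2 $ 1 = 0" "A z $ 2 $ 2 = e" for z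
      by (simp_all add: A_def)
    have "bundle_automorphism b r \<tau> A"
      using ae c by (simp add: bundle_automorphism_def twisted_End_def invertible_det_nz det_2
          A inv H0_const H0_zero)
    moreover have "\<forall>z\<in>punctured_plane. \<psi> z ** A z = A z ** \<phi> z"
      using eq triangular_intertwiner_iff[OF A] by blast
    ultimately show "conjugate b r \<tau> \<phi> \<psi>" unfolding conjugate_iff by blast
  }
qed

text \<open>The intertwining equations are solved for the entries of \<open>\<phi>\<close>, which
  presents them as combinations of sections with the right multipliers. In this way the properties
  of the models pass to all their conjugates.\<close>

lemma conjugate_higgs_field:
  assumes \<tau>: "\<tau> = b powi (- int n)" "n > 0" and conj: "conjugate b r \<tau> \<phi> \<psi>"
    and higgs: "higgs_field b r \<mu> \<tau> \<psi>" and nv: "nowhere_vanishing \<psi>"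
  shows "higgs_field b r \<mu> \<tau> \<phi>" "nowhere_vanishing \<phi>"
proof -
  obtain a e c where ae: "a \<noteq> 0" "e \<noteq> 0" and c: "c \<in> H0 b r (b ^ n)"
    and eq: "\<And>z. z \<in> punctured_plane \<Longrightarrow> triangular_intertwiner a e (c z) (\<phi> z) (\<psi> z)"
    using conj unfolding conjugate_triangular_iff[OF \<tau>] by blast
  have bn: "b ^ n \<noteq> 0" "\<tau> = 1 / b ^ n" using b_nonzero by (simp_all add: \<tau>(1) power_int_minus inverse_eq_divide)
  have \<psi>: "(\<lambda>z. \<psi> z $ 1 $ 1) \<in> H0 b r \<mu>" "(\<lambda>z. \<psi> z $ 1 $ 2) \<in> H0 b r (\<mu> * b ^ n)"
    "(\<lambda>z. \<psi> z $ 2 $ 1) \<in> H0 b r (\<mu> / b ^ n)" "(\<lambda>z. \<psi> z $ 2 $ 2) \<in> H0 b r \<mu>"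
    "\<And>z. z \<in> punctured_plane \<Longrightarrow> \<psi> z $ 2 $ 2 = - \<psi> z $ 1 $ 1"
    using higgs by (auto simp: higgs_field_def twisted_End_def bn trace_def sum_2 eq_neg_iff_add_eq_0 add.commute)
  have \<phi>21: "\<phi> z $ 2 $ 1 = a / e * \<psi> z $ 2 $ 1" if "z \<in> punctured_plane" for z
    using eq[OF that] ae by (simp add: triangular_intertwiner_def field_simps)
  have \<phi>11: "\<phi> z $ 1 $ 1 = \<psi> z $ 1 $ 1 - c z * \<psi> z $ 2 $ 1 / e" if "z \<in> punctured_plane" for z
  proof -
    have "a * \<phi> z $ 1 $ 1 = a * (\<psi> z $ 1 $ 1 - c z * \<psi> z $ 2 $ 1 / e)"
      using eq[OF that] \<phi>21[OF that] by (simp add: triangular_intertwiner_def algebra_simps)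
    with ae show ?thesis by simp
  qed
  have \<phi>22: "\<phi> z $ 2 $ 2 = \<psi> z $ 2 $ 2 + c z * \<psi> z $ 2 $ 1 / e" if "z \<in> punctured_plane" for z
    using eq[OF that] ae by (simp add: triangular_intertwiner_def field_simps)
  have \<phi>12: "\<phi> z $ 1 $ 2 = (\<psi> z $ 1 $ 1 * c z + \<psi> z $ 1 $ 2 * e - c z * \<phi> z $ 2 $ 2) / a"
    if "z \<in> punctured_plane" for z
    using eq[OF that] ae by (simp add: triangular_intertwiner_def field_simps)
  note cong = H0_cong[OF b_nonzero]
  have cw: "(\<lambda>z. c z * \<psi> z $ 2 $ 1 / e) \<in> H0 b r \<mu>"
    by (intro H0_divide_const H0_mult[OF c \<psi>(3)]) (use bn in simp)
  have 21: "(\<lambda>z. \<phi> z $ 2 $ 1) \<in> H0 b r (\<mu> / b ^ n)"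
    by (subst cong[OF \<phi>21]) (use H0_cmult[OF \<psi>(3), of "a / e"] in simp_all)
  have 11: "(\<lambda>z. \<phi> z $ 1 $ 1) \<in> H0 b r \<mu>"
    by (subst cong[OF \<phi>11]) (auto intro!: H0_diff \<psi>(1) cw)
  have 22: "(\<lambda>z. \<phi> z $ 2 $ 2) \<in> H0 b r \<mu>"
    by (subst cong[OF \<phi>22]) (auto intro!: H0_add \<psi>(4) cw)
  have 12: "(\<lambda>z. \<phi> z $ 1 $ 2) \<in> H0 b r (\<mu> * b ^ n)"
  proof (subst cong[OF \<phi>12], assumption)
    show "(\<lambda>z. (\<psi> z $ 1 $ 1 * c z + \<psi> z $ 1 $ 2 * e - c z * \<phi> z $ 2 $ 2) / a) \<in> H0 b r (\<mu> * b ^ n)"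
      using H0_cmult[OF \<psi>(2), of e]
      by (intro H0_divide_const H0_diff H0_add H0_mult[OF \<psi>(1) c] H0_mult[OF c 22])
        (simp_all add: mult.commute)
  qed
  have "\<phi> z $ 2 $ 2 = - \<phi> z $ 1 $ 1" if "z \<in> punctured_plane" for z
    using \<phi>11[OF that] \<phi>22[OF that] \<psi>(5)[OF that] by simp
  then show "higgs_field b r \<mu> \<tau> \<phi>"
    using 11 12 21 22 by (simp add: higgs_field_def twisted_End_def bn trace_def sum_2)
  show "nowhere_vanishing \<phi>"
    unfolding nowhere_vanishing_def
  proof (intro ballI notI)
    fix z assume z: "z \<in> punctured_plane" and "\<phi> z = 0"
    \<comment> \<open>With \<open>\<phi> z = 0\<close> the equations give first the first column of
      \<open>\<psi> z\<close>, because \<open>a \<noteq> 0\<close>, and then the second, because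
      \<open>e \<noteq> 0\<close>.\<close>
    then have "\<psi> z $ 1 $ 1 = 0 \<and> \<psi> z $ 1 $ 2 = 0 \<and> \<psi> z $ 2 $ 1 = 0 \<and> \<psi> z $ 2 $ 2 = 0"
      using eq[OF z] ae by (auto simp: triangular_intertwiner_def)
    then have "\<psi> z = 0" by (simp add: mat2_eq_iff)
    with nv z show False by (simp add: nowhere_vanishing_def)
  qed
qed

section \<open>The three families of models\<close>

lemma higgs1_higgs_field:
  assumes "0 < l" "l \<le> k * r" "k > 0" "s \<noteq> 0"
  shows "higgs_field b r (b ^ l) (b powi (int l - int k * int r)) (higgs1 l k s)"
    and "nowhere_vanishing (higgs1 l k s)"
proof -
  have \<tau>: "b ^ l / b powi (int l - int k * int r) = (b ^ r) ^ k"
    using b_nonzero by (simp add: power_int_diff flip: power_mult of_nat_mult)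
      (simp add: mult.commute)
  show "higgs_field b r (b ^ l) (b powi (int l - int k * int r)) (higgs1 l k s)"
    using H0_snd_power[of s l b r] H0_uminus[OF H0_snd_power[of s l b r]] H0_power[OF H0_fst, of k b r]
    by (simp add: higgs_field_def twisted_End_def higgs1_def case_prod_beta' \<tau> H0_zero trace_def sum_2)
  show "nowhere_vanishing (higgs1 l k s)"
    using assms by (auto simp: nowhere_vanishing_def higgs1_def mat2_eq_iff mem_punctured_plane)
qed

lemma higgs2_higgs_field:
  assumes "\<beta> \<in> H0 b r (b ^ (2 * l))"
  shows "higgs_field b r (b ^ l) (b powi (- int l)) (higgs2 \<beta>)"
    and "nowhere_vanishing (higgs2 \<beta>)"
proof -
  have \<tau>: "b ^ l / b powi (- int l) = b ^ (2 * l)" "b ^ l * b powi (- int l) = 1"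
    using b_nonzero by (simp_all add: power_int_minus divide_inverse mult_2 power_add)
  show "higgs_field b r (b ^ l) (b powi (- int l)) (higgs2 \<beta>)"
    using assms by (simp add: higgs_field_def twisted_End_def higgs2_def \<tau> H0_zero H0_const trace_def sum_2)
  show "nowhere_vanishing (higgs2 \<beta>)"
    by (auto simp: nowhere_vanishing_def higgs2_def mat2_eq_iff)
qed

lemma higgs3_higgs_field:
  assumes "\<beta> \<in> H0 b r (b ^ r)" "\<beta> (1, 0) \<noteq> 0" "r < 2 * l"
  shows "higgs_field b r (b ^ l) (b powi (int l - int r)) (higgs3 r l \<beta>)"
    and "nowhere_vanishing (higgs3 r l \<beta>)"
proof -
  have "b ^ l * b ^ l = b ^ (2 * l - r) * b ^ r" using assms(3) by (simp flip: power_add mult_2)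
  then have \<tau>: "b ^ l / b powi (int l - int r) = b ^ r" "b ^ l * b powi (int l - int r) = b ^ (2 * l - r)"
    using b_nonzero by (simp_all add: power_int_diff field_simps)
  show "higgs_field b r (b ^ l) (b powi (int l - int r)) (higgs3 r l \<beta>)"
    using assms H0_snd_power[of 1 "2 * l - r" b r]
    by (simp add: higgs_field_def twisted_End_def higgs3_def case_prod_beta' \<tau> H0_zero trace_def sum_2)
  show "nowhere_vanishing (higgs3 r l \<beta>)"
    unfolding nowhere_vanishing_def
  proof (intro ballI notI)
    fix z assume z: "z \<in> punctured_plane" and eq: "higgs3 r l \<beta> z = 0"
    obtain x y where xy: "z = (x, y)" by fastforce
    have y: "y = 0" and \<beta>: "\<beta> (x, y) = 0"
      using eq assms(3) by (auto simp: higgs3_def mat2_eq_iff xy)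
    then have x: "x \<noteq> 0" using z by (simp add: xy mem_punctured_plane)
    \<comment> \<open>In weight \<open>r\<close> the section is \<open>a * x + c * y ^ r\<close>
      with \<open>a = \<beta> (1, 0)\<close>, so it has no zero on the punctured axis
      \<open>y = 0\<close>, the only place where the lower left entry vanishes.\<close>
    have "\<beta> \<in> H0 b r (b ^ (r + 0))" using assms(1) by simp
    from H0_mid[OF this r_pos] obtain a c where
      "\<And>x y. (x, y) \<in> punctured_plane \<Longrightarrow> \<beta> (x, y) = y ^ 0 * (a * x + c * y ^ r)" by blast
    from this[of x 0] this[of 1 0] show False
      using x y \<beta> assms(2) r_pos by (auto simp: mem_punctured_plane zero_power)
  qed
qed

section \<open>Reduction to normal form\<close>

lemma bundle_degree_powi_neg:
  "b powi (- int n) \<noteq> 0" "bundle_degree b (b powi (- int n)) \<le> 0"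
  using b_nonzero norm_powi_ge_1_iff[of "- int n"]
  by (simp_all add: bundle_degree_nonpos_iff[OF b_pos b_less_1])

text \<open>Every term of the upper right entry except the one with \<open>x ^ k\<close> is
  divisible by \<open>y ^ l\<close>. A unipotent conjugation removes these terms, and the
  coefficient \<open>a k\<close> is absorbed by the diagonal of the automorphism.\<close>

lemma higgs1_reduction:
  assumes l: "0 < l" "l < r" and k: "k > 0" and s: "s \<noteq> 0"
    and p: "\<And>x y. (x, y) \<in> punctured_plane \<Longrightarrow> \<phi> (x, y) $ 1 $ 1 = s * y ^ l"
    and tr: "\<And>z. z \<in> punctured_plane \<Longrightarrow> \<phi> z $ 2 $ 2 = - \<phi> z $ 1 $ 1"
    and w: "\<And>z. z \<in> punctured_plane \<Longrightarrow> \<phi> z $ 2 $ 1 = 0"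
    and q: "\<And>x y. (x, y) \<in> punctured_plane \<Longrightarrow>
      \<phi> (x, y) $ 1 $ 2 = (\<Sum>i\<le>k. a i * x ^ i * y ^ (k * r - r * i))"
    and ak: "a k \<noteq> 0"
  shows "conjugate b r (b powi (int l - int k * int r)) \<phi> (higgs1 l k s)"
proof -
  have lk: "l < k * r" using l k
    by (metis less_le_trans mult_le_mono1 nat_mult_1 Suc_leI One_nat_def)
  have \<tau>: "b powi (int l - int k * int r) = b powi (- int (k * r - l))" "k * r - l > 0"
    using lk by (simp_all add: of_nat_diff)
  \<comment> \<open>For \<open>i < k\<close> at least \<open>r > l\<close> factors \<open>y\<close>
    remain, so the truncated subtractions are exact.\<close>
  have exp: "r * i + (k * r - r * i - l) = k * r - l" "k * r - r * i = (k * r - r * i - l) + l"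
    if "i < k" for i
  proof -
    have "r * i + r \<le> k * r" using that
      by (metis Suc_leI mult.commute mult_Suc mult_le_mono1 add.commute)
    then show "r * i + (k * r - r * i - l) = k * r - l" "k * r - r * i = (k * r - r * i - l) + l"
      using l by linarith+
  qed
  \<comment> \<open>Chosen to solve \<open>q = a k * x ^ k + 2 * (s * y ^ l) * c\<close>, the upper
    right intertwining equation with diagonal \<open>1\<close> and \<open>a k\<close>; the 2 appears
    because the diagonal entries of the Higgs field differ by \<open>2 * s * y ^ l\<close>.\<close>
  define c where "c z = (\<Sum>i<k. a i / (2 * s) * fst z ^ i * snd z ^ (k * r - r * i - l))" for z
  have c: "c \<in> H0 b r (b ^ (k * r - l))"
    unfolding c_def by (intro H0_sum H0_monomial exp) simp
  have "\<phi> (x, y) $ 1 $ 2 = a k * x ^ k + 2 * (s * y ^ l) * c (x, y)"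
    if "(x, y) \<in> punctured_plane" for x y
  proof -
    have "(\<Sum>i<k. a i * x ^ i * y ^ (k * r - r * i)) = 2 * (s * y ^ l) * c (x, y)"
      unfolding c_def sum_distrib_left
    proof (rule sum.cong[OF refl])
      fix i assume "i \<in> {..<k}"
      then have "y ^ (k * r - r * i) = y ^ (k * r - r * i - l) * y ^ l"
        using exp(2)[of i] by (simp flip: power_add)
      then show "a i * x ^ i * y ^ (k * r - r * i) = 2 * (s * y ^ l) *
          (a i / (2 * s) * fst (x, y) ^ i * snd (x, y) ^ (k * r - r * i - l))"
        using s by (simp add: field_simps)
    qed
    then show ?thesis
      using q[OF that] by (simp add: lessThan_Suc_atMost[symmetric] mult.commute)
  qed
  then have "triangular_intertwiner 1 (a k) (c (x, y)) (\<phi> (x, y)) (higgs1 l k s (x, y))"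
    if "(x, y) \<in> punctured_plane" for x y
    using that p tr w by (simp add: triangular_intertwiner_def higgs1_def algebra_simps)
  then show ?thesis
    unfolding \<tau>(1) conjugate_triangular_iff[OF refl \<tau>(2)]
    using ak c by - (rule exI[of _ 1], rule exI[of _ "a k"], rule exI[of _ c], auto)
qed

text \<open>A nonzero constant in the lower left corner clears the diagonal: the automorphism has
  rows \<open>(w, - p)\<close> and \<open>(0, 1)\<close>, where \<open>p\<close> is the upper left
  entry. The resulting \<beta> is minus the determinant of \<open>\<phi>\<close>.\<close>

lemma higgs2_reduction:
  assumes l: "0 < l" and w0: "w \<noteq> 0"
    and higgs: "higgs_field b r (b ^ l) (b powi (- int l)) \<phi>"
    and w: "\<And>z. z \<in> punctured_plane \<Longrightarrow> \<phi> z $ 2 $ 1 = w"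
  shows "\<exists>\<beta>\<in>H0 b r (b ^ (2 * l)). conjugate b r (b powi (- int l)) \<phi> (higgs2 \<beta>)"
proof -
  have \<tau>: "b ^ l / b powi (- int l) = b ^ (2 * l)"
    using b_nonzero by (simp_all add: power_int_minus divide_inverse mult_2 power_add)
  have p: "(\<lambda>z. \<phi> z $ 1 $ 1) \<in> H0 b r (b ^ l)" and q: "(\<lambda>z. \<phi> z $ 1 $ 2) \<in> H0 b r (b ^ (2 * l))"
    and tr: "\<And>z. z \<in> punctured_plane \<Longrightarrow> \<phi> z $ 2 $ 2 = - \<phi> z $ 1 $ 1"
    using higgs by (auto simp: higgs_field_def twisted_End_def \<tau> trace_def sum_2 eq_neg_iff_add_eq_0 add.commute)
  define \<beta> where "\<beta> z = w * \<phi> z $ 1 $ 2 + \<phi> z $ 1 $ 1 * \<phi> z $ 1 $ 1" for z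
  have "\<beta> \<in> H0 b r (b ^ (2 * l))"
    unfolding \<beta>_def by (intro H0_add H0_cmult q H0_mult[OF p p]) (simp add: mult_2 power_add)
  moreover have "conjugate b r (b powi (- int l)) \<phi> (higgs2 \<beta>)"
    unfolding conjugate_triangular_iff[OF refl l]
    using w0 H0_uminus[OF p] w tr
    by - (rule exI[of _ w], rule exI[of _ 1], rule exI[of _ "\<lambda>z. - \<phi> z $ 1 $ 1"],
        auto simp: triangular_intertwiner_def higgs2_def \<beta>_def)
  ultimately show ?thesis by blast
qed

text \<open>The diagonal can be cleared because the lower left power \<open>y ^ (2 * l - r)\<close>
  divides \<open>s * y ^ l\<close>, with quotient \<open>s * y ^ (r - l)\<close>. Here minus the
  determinant of \<open>\<phi>\<close> is \<open>y ^ (2 * l - r)\<close> times \<beta>.\<close>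

lemma higgs3_reduction:
  assumes l: "l < r" "r < 2 * l" and w0: "w \<noteq> 0"
    and p: "\<And>x y. (x, y) \<in> punctured_plane \<Longrightarrow> \<phi> (x, y) $ 1 $ 1 = s * y ^ l"
    and tr: "\<And>z. z \<in> punctured_plane \<Longrightarrow> \<phi> z $ 2 $ 2 = - \<phi> z $ 1 $ 1"
    and w: "\<And>x y. (x, y) \<in> punctured_plane \<Longrightarrow> \<phi> (x, y) $ 2 $ 1 = w * y ^ (2 * l - r)"
    and q: "(\<lambda>z. \<phi> z $ 1 $ 2) \<in> H0 b r (b ^ r)" "\<phi> (1, 0) $ 1 $ 2 \<noteq> 0"
  shows "\<exists>\<beta>\<in>H0 b r (b ^ r). \<beta> (1, 0) \<noteq> 0 \<and>
    conjugate b r (b powi (int l - int r)) \<phi> (higgs3 r l \<beta>)"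
proof -
  have \<tau>: "b powi (int l - int r) = b powi (- int (r - l))" "r - l > 0"
    using l by (simp_all add: of_nat_diff)
  define \<beta> where "\<beta> z = w * \<phi> z $ 1 $ 2 + s\<^sup>2 * snd z ^ r" for z
  have "\<beta> \<in> H0 b r (b ^ r)"
    unfolding \<beta>_def by (intro H0_add H0_cmult q H0_snd_power)
  moreover have "\<beta> (1, 0) \<noteq> 0"
    using w0 q(2) r_pos by (simp add: \<beta>_def zero_power)
  moreover have "triangular_intertwiner w 1 (- s * y ^ (r - l)) (\<phi> (x, y)) (higgs3 r l \<beta> (x, y))"
    if "(x, y) \<in> punctured_plane" for x y
  proof -
    have "y ^ l = y ^ (r - l) * y ^ (2 * l - r)" "y ^ r = y ^ (r - l) * y ^ l"
      using l by (simp_all flip: power_add)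
    then show ?thesis
      using that p tr w by (simp add: triangular_intertwiner_def higgs3_def \<beta>_def power2_eq_square)
  qed
  then have "conjugate b r (b powi (int l - int r)) \<phi> (higgs3 r l \<beta>)"
    unfolding \<tau>(1) conjugate_triangular_iff[OF refl \<tau>(2)]
    using w0 H0_snd_power[of "- s" "r - l" b r]
    by - (rule exI[of _ w], rule exI[of _ 1], rule exI[of _ "\<lambda>z. - s * snd z ^ (r - l)"], auto)
  ultimately show ?thesis by blast
qed

text \<open>The split is by the off-diagonal entry that is nonzero at \<open>(1, 0)\<close>. The
  lower left one leads to type (2). If only the upper right one is nonzero there, type (1) or (3)
  results according to whether the lower left entry vanishes identically.\<close>

lemma higgs_classification:
  assumes l: "0 < l" "l < r"
    and \<tau>: "\<tau> \<noteq> 0" "bundle_degree b \<tau> \<le> 0"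
    and higgs: "higgs_field b r (b ^ l) \<tau> \<phi>" and nv: "nowhere_vanishing \<phi>"
  shows "(\<exists>k>0. \<tau> = b powi (int l - int k * int r) \<and>
            (\<exists>s. s \<noteq> 0 \<and> conjugate b r \<tau> \<phi> (higgs1 l k s))) \<or>
         (\<tau> = b powi (- int l) \<and>
            (\<exists>\<beta> \<in> H0 b r (b ^ (2 * l)). conjugate b r \<tau> \<phi> (higgs2 \<beta>))) \<or>
         (r < 2 * l \<and> \<tau> = b powi (int l - int r) \<and>
            (\<exists>\<beta> \<in> H0 b r (b ^ r). \<beta> (1, 0) \<noteq> 0 \<and> conjugate b r \<tau> \<phi> (higgs3 r l \<beta>)))"
    (is "?C1 \<or> ?C2 \<or> ?C3")
proof -
  have norm: "1 \<le> cmod \<tau>" using \<tau> bundle_degree_nonpos_iff[OF b_pos b_less_1] by blast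
  have p: "(\<lambda>z. \<phi> z $ 1 $ 1) \<in> H0 b r (b ^ l)" and q: "(\<lambda>z. \<phi> z $ 1 $ 2) \<in> H0 b r (b ^ l / \<tau>)"
    and w: "(\<lambda>z. \<phi> z $ 2 $ 1) \<in> H0 b r (b ^ l * \<tau>)"
    and tr: "\<And>z. z \<in> punctured_plane \<Longrightarrow> \<phi> z $ 2 $ 2 = - \<phi> z $ 1 $ 1"
    using higgs by (auto simp: higgs_field_def twisted_End_def trace_def sum_2 eq_neg_iff_add_eq_0 add.commute)
  obtain s where s: "\<And>x y. (x, y) \<in> punctured_plane \<Longrightarrow> \<phi> (x, y) $ 1 $ 1 = s * y ^ l"
    using H0_low[OF p l(2)] by blast
  have pp: "(1, 0) \<in> punctured_plane" by (simp add: mem_punctured_plane)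
  have C2: ?C2 if w0: "\<phi> (1, 0) $ 2 $ 1 \<noteq> 0"
  proof -
    obtain k where "b ^ l * \<tau> = b ^ (k * r)" using H0_axis[OF w w0] by blast
    then have "\<tau> = b powi (int (k * r) - int l)"
      using b_nonzero by (simp add: power_int_diff field_simps del: of_nat_mult)
    \<comment> \<open>The degree bound gives \<open>k * r \<le> l < r\<close>, so the lower left
      entry has weight 0 and is constant.\<close>
    moreover from this have "int (k * r) - int l \<le> 0" using norm norm_powi_ge_1_iff by simp
    then have "k * r \<le> l" by linarith
    with l(2) have "k = 0" by (cases k) auto
    ultimately have \<tau>: "\<tau> = b powi (- int l)" by simp
    then have "b ^ l * \<tau> = 1" using b_nonzero by (simp add: power_int_minus)
    then obtain w' where w': "\<And>z. z \<in> punctured_plane \<Longrightarrow> \<phi> z $ 2 $ 1 = w'"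
      using H0_one w by metis
    with w0 pp have "w' \<noteq> 0" by metis
    from higgs2_reduction[OF l(1) this higgs[unfolded \<tau>] w'] show ?thesis using \<tau> by simp
  qed
  have C13: "?C1 \<or> ?C3" if q0: "\<phi> (1, 0) $ 1 $ 2 \<noteq> 0" and w0: "\<phi> (1, 0) $ 2 $ 1 = 0"
  proof -
    obtain k where k: "b ^ l / \<tau> = b ^ (k * r)" using H0_axis[OF q q0] by blast
    then have \<tau>': "\<tau> = b powi (int l - int (k * r))"
      using b_nonzero \<tau>(1) by (simp add: power_int_diff field_simps del: of_nat_mult)
    then have "int l - int (k * r) \<le> 0" using norm norm_powi_ge_1_iff by simp
    then have "k > 0" using l(1) by (cases k) auto
    show ?thesis
    proof (cases "\<forall>z\<in>punctured_plane. \<phi> z $ 2 $ 1 = 0")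
      case True
      obtain a where a: "\<And>x y. (x, y) \<in> punctured_plane \<Longrightarrow>
          \<phi> (x, y) $ 1 $ 2 = (\<Sum>i\<le>k. a i * x ^ i * y ^ (k * r - r * i))"
        using H0_expansion[OF q[unfolded k]] r_pos by auto
      \<comment> \<open>At \<open>(1, 0)\<close> only the term \<open>i = k\<close> survives, since
        \<open>0 ^ 0 = 1\<close>; its value is the upper right entry there.\<close>
      have "a k \<noteq> 0"
      proof
        assume "a k = 0"
        have "a i * 1 ^ i * 0 ^ (k * r - r * i) = 0" if "i \<le> k" for i
          using that \<open>a k = 0\<close> r_pos by (cases "i = k") (auto simp: mult.commute[of k r] zero_power)
        then have "(\<Sum>i\<le>k. a i * 1 ^ i * 0 ^ (k * r - r * i)) = 0" by (intro sum.neutral) auto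
        with a[OF pp] q0 show False by simp
      qed
      \<comment> \<open>Otherwise only the upper right entry is left. On the slice
        \<open>y = 1\<close> it is a polynomial of degree \<open>k > 0\<close> in \<open>x\<close>,
        and a root of it is a zero of \<open>\<phi>\<close>.\<close>
      have "s \<noteq> 0"
      proof
        assume "s = 0"
        obtain x where x: "(\<Sum>i\<le>k. a i * x ^ i) = 0"
        proof (rule fundamental_theorem_of_algebra[of a k])
          show "a 0 = 0 \<or> (\<exists>i\<in>{1..k}. a i \<noteq> 0)"
            using \<open>a k \<noteq> 0\<close> \<open>k > 0\<close> by (intro disjI2 bexI[of _ k]) auto
        qed
        have x1: "(x, 1) \<in> punctured_plane" by (simp add: mem_punctured_plane)
        have "\<phi> (x, 1) = 0"
          unfolding mat2_eq_iff using a[OF x1] x s[OF x1] tr[OF x1] True x1 \<open>s = 0\<close> by simp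
        with nv x1 show False by (simp add: nowhere_vanishing_def)
      qed
      have w': "\<phi> z $ 2 $ 1 = 0" if "z \<in> punctured_plane" for z using True that by blast
      have "conjugate b r (b powi (int l - int k * int r)) \<phi> (higgs1 l k s)"
        by (rule higgs1_reduction[OF l \<open>k > 0\<close> \<open>s \<noteq> 0\<close> s tr w' a \<open>a k \<noteq> 0\<close>])
      then show ?thesis using \<open>k > 0\<close> \<open>s \<noteq> 0\<close> \<tau>' by auto
    next
      case False
      then obtain z where z: "z \<in> punctured_plane" "\<phi> z $ 2 $ 1 \<noteq> 0" by blast
      have "\<exists>m. b ^ l * \<tau> = b ^ m" by (rule H0_nonzero_expansion[OF w z]) blast
      then obtain m where m: "b ^ l * \<tau> = b ^ m" by blast
      \<comment> \<open>Both off-diagonal entries are nonzero sections now. Their weights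
        \<open>k * r\<close> and \<open>m\<close> add up to \<open>2 * l\<close>, the weight of the
        determinant, which leaves only \<open>k = 1\<close>.\<close>
      have "b powi (2 * int l - int (k * r)) = b powi int m"
      proof -
        have "b powi (2 * int l - int (k * r)) = b powi (int l + (int l - int (k * r)))" by simp
        also have "\<dots> = b ^ l * \<tau>" using b_nonzero by (subst power_int_add) (auto simp: \<tau>')
        finally show ?thesis using m by simp
      qed
      from powi_inject[OF b_pos b_less_1 this] have mk: "2 * l = m + k * r" by linarith
      have "k = 1"
      proof (rule ccontr)
        assume "k \<noteq> 1"
        then have "2 * r \<le> k * r" using \<open>k > 0\<close> by (intro mult_le_mono1) linarith
        then show False using mk l by linarith
      qed
      then have m': "m = 2 * l - r" "r \<le> 2 * l" using mk by simp_all
      have "m < r" using m' l by linarith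
      then obtain w' where w': "\<And>x y. (x, y) \<in> punctured_plane \<Longrightarrow> \<phi> (x, y) $ 2 $ 1 = w' * y ^ (2 * l - r)"
        using H0_low[OF w[unfolded m]] m' by blast
      have "w' \<noteq> 0" using w' z by (metis mult_zero_left surj_pair)
      \<comment> \<open>For \<open>r = 2 * l\<close> the lower left entry would be a nonzero
        constant, against its vanishing at \<open>(1, 0)\<close>.\<close>
      have "r < 2 * l"
      proof (rule ccontr)
        assume "\<not> r < 2 * l"
        with w'[OF pp] w0 \<open>w' \<noteq> 0\<close> show False by simp
      qed
      moreover have "\<exists>\<beta>\<in>H0 b r (b ^ r). \<beta> (1, 0) \<noteq> 0 \<and>
          conjugate b r (b powi (int l - int r)) \<phi> (higgs3 r l \<beta>)"
        by (rule higgs3_reduction[OF l(2) \<open>r < 2 * l\<close> \<open>w' \<noteq> 0\<close> s tr w' _ q0])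
          (use q k \<open>k = 1\<close> in simp_all)
      ultimately show ?thesis using \<tau>' \<open>k = 1\<close> by simp
    qed
  qed
  have "\<phi> (1, 0) \<noteq> 0" using nv pp by (simp add: nowhere_vanishing_def)
  then have "\<phi> (1, 0) $ 1 $ 2 \<noteq> 0 \<or> \<phi> (1, 0) $ 2 $ 1 \<noteq> 0"
    using s[OF pp] tr[OF pp] l(1) by (auto simp: mat2_eq_iff zero_power)
  then show ?thesis using C2 C13 by blast
qed

text \<open>In all three cases \<open>\<tau>\<close> is \<open>b powi (- int n)\<close> with
  \<open>n > 0\<close>, namely \<open>k * r - l\<close>, \<open>l\<close> or \<open>r - l\<close>.
  This gives the degree bound and lets the properties of the model pass to
  \<open>\<phi>\<close>.\<close>

lemma higgs_classification_converse:
  assumes l: "0 < l" "l < r"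
    and cases: "(\<exists>k>0. \<tau> = b powi (int l - int k * int r) \<and>
            (\<exists>s. s \<noteq> 0 \<and> conjugate b r \<tau> \<phi> (higgs1 l k s))) \<or>
         (\<tau> = b powi (- int l) \<and>
            (\<exists>\<beta> \<in> H0 b r (b ^ (2 * l)). conjugate b r \<tau> \<phi> (higgs2 \<beta>))) \<or>
         (r < 2 * l \<and> \<tau> = b powi (int l - int r) \<and>
            (\<exists>\<beta> \<in> H0 b r (b ^ r). \<beta> (1, 0) \<noteq> 0 \<and> conjugate b r \<tau> \<phi> (higgs3 r l \<beta>)))"
  shows "\<tau> \<noteq> 0 \<and> bundle_degree b \<tau> \<le> 0 \<and> higgs_field b r (b ^ l) \<tau> \<phi> \<and> nowhere_vanishing \<phi>"
proof -
  have *: ?thesis if "\<tau> = b powi (- int n)" "n > 0" "conjugate b r \<tau> \<phi> \<psi>"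
    "higgs_field b r (b ^ l) \<tau> \<psi>" "nowhere_vanishing \<psi>" for n \<psi>
    using conjugate_higgs_field[OF that] bundle_degree_powi_neg[of n] that(1) by simp
  from cases show ?thesis
  proof (elim disjE exE conjE bexE)
    fix k s assume k: "k > 0" and s: "s \<noteq> 0" and \<tau>: "\<tau> = b powi (int l - int k * int r)"
      and conj: "conjugate b r \<tau> \<phi> (higgs1 l k s)"
    have "l < k * r" using l k
      by (metis less_le_trans mult_le_mono1 nat_mult_1 Suc_leI One_nat_def)
    then have "\<tau> = b powi (- int (k * r - l))" "k * r - l > 0" using \<tau> by (simp_all add: of_nat_diff)
    moreover have "higgs_field b r (b ^ l) \<tau> (higgs1 l k s)" "nowhere_vanishing (higgs1 l k s)"
      using higgs1_higgs_field[of l k s] \<open>l < k * r\<close> l k s by (simp_all add: \<tau>)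
    ultimately show ?thesis using *[OF _ _ conj] by blast
  next
    fix \<beta> assume "\<tau> = b powi (- int l)" "\<beta> \<in> H0 b r (b ^ (2 * l))" "conjugate b r \<tau> \<phi> (higgs2 \<beta>)"
    then show ?thesis using *[of l "higgs2 \<beta>"] higgs2_higgs_field[of \<beta> l] l by simp
  next
    fix \<beta> assume "r < 2 * l" and \<tau>: "\<tau> = b powi (int l - int r)"
      and "\<beta> \<in> H0 b r (b ^ r)" "\<beta> (1, 0) \<noteq> 0" "conjugate b r \<tau> \<phi> (higgs3 r l \<beta>)"
    moreover have "\<tau> = b powi (- int (r - l))" "r - l > 0" using \<tau> l by (simp_all add: of_nat_diff)
    ultimately show ?thesis using *[of "r - l" "higgs3 r l \<beta>"] higgs3_higgs_field[of \<beta> l] by simp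
  qed
qed

text \<open>All three claims are read off at \<open>(0, 1)\<close>. A triangular intertwiner
  preserves a zero in the lower left corner, where the other two families have the value 1 at this
  point; given that zero, it also preserves the upper left entry, which is \<open>s\<close>.\<close>

lemma conjugate_higgs1:
  assumes l: "0 < l" "l < r" and k: "k > 0"
  shows "conjugate b r (b powi (int l - int k * int r)) (higgs1 l k s) (higgs1 l k s') \<Longrightarrow> s = s'"
    and "\<not> conjugate b r (b powi (int l - int k * int r)) (higgs1 l k s) (higgs2 \<beta>)"
    and "\<not> conjugate b r (b powi (int l - int k * int r)) (higgs1 l k s) (higgs3 r l \<beta>)"
proof -
  have "l < k * r" using l k
    by (metis less_le_trans mult_le_mono1 nat_mult_1 Suc_leI One_nat_def)
  then have \<tau>: "b powi (int l - int k * int r) = b powi (- int (k * r - l))" "k * r - l > 0"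
    by (simp_all add: of_nat_diff)
  have pp: "(0, 1) \<in> punctured_plane" by (simp add: mem_punctured_plane)
  {
    fix \<psi> assume "conjugate b r (b powi (int l - int k * int r)) (higgs1 l k s) \<psi>"
    then have "\<exists>a e c. a \<noteq> 0 \<and> e \<noteq> 0 \<and> triangular_intertwiner a e c (higgs1 l k s (0, 1)) (\<psi> (0, 1))"
      unfolding \<tau>(1) conjugate_triangular_iff[OF refl \<tau>(2)] using pp by metis
  }
  note * = this
  show "conjugate b r (b powi (int l - int k * int r)) (higgs1 l k s) (higgs1 l k s') \<Longrightarrow> s = s'"
    by (drule *) (auto simp: triangular_intertwiner_def higgs1_def)
  show "\<not> conjugate b r (b powi (int l - int k * int r)) (higgs1 l k s) (higgs2 \<beta>)"
    by (rule notI, drule *) (auto simp: triangular_intertwiner_def higgs1_def higgs2_def)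
  show "\<not> conjugate b r (b powi (int l - int k * int r)) (higgs1 l k s) (higgs3 r l \<beta>)"
    by (rule notI, drule *) (auto simp: triangular_intertwiner_def higgs1_def higgs3_def)
qed

text \<open>The upper left relation forces \<open>c z = 0\<close> and the lower left one
  \<open>a = e\<close>, because the models have zero diagonal and lower left entry 1. The upper
  right relation then compares the two sections.\<close>

lemma conjugate_higgs2:
  assumes "0 < l" and conj: "conjugate b r (b powi (- int l)) (higgs2 \<beta>) (higgs2 \<beta>')"
    and z: "z \<in> punctured_plane"
  shows "\<beta> z = \<beta>' z"
proof -
  obtain a e c where "a \<noteq> 0" "triangular_intertwiner a e (c z) (higgs2 \<beta> z) (higgs2 \<beta>' z)"
    using conj z unfolding conjugate_triangular_iff[OF refl \<open>0 < l\<close>] by blast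
  then show ?thesis by (auto simp: triangular_intertwiner_def higgs2_def mult.commute)
qed

text \<open>Wherever \<open>y\<close> is nonzero the lower left entry can be cancelled, which again
  gives \<open>c = 0\<close> and \<open>a = e\<close>; the identity theorem covers the axis.\<close>

lemma conjugate_higgs3:
  assumes l: "l < r" and \<beta>: "\<beta> \<in> H0 b r \<mu>" "\<beta>' \<in> H0 b r \<mu>"
    and conj: "conjugate b r (b powi (int l - int r)) (higgs3 r l \<beta>) (higgs3 r l \<beta>')"
    and z: "z \<in> punctured_plane"
  shows "\<beta> z = \<beta>' z"
proof -
  have \<tau>: "b powi (int l - int r) = b powi (- int (r - l))" "r - l > 0"
    using l by (simp_all add: of_nat_diff)
  obtain a e c where ae: "a \<noteq> 0" "e \<noteq> 0" and
    eq: "\<And>z. z \<in> punctured_plane \<Longrightarrow> triangular_intertwiner a e (c z) (higgs3 r l \<beta> z) (higgs3 r l \<beta>' z)"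
    using conj unfolding \<tau>(1) conjugate_triangular_iff[OF refl \<tau>(2)] by blast
  show ?thesis
  proof (rule holomorphic2_eq_off_axis[OF _ _ _ z])
    show "holomorphic2_on \<beta> punctured_plane" "holomorphic2_on \<beta>' punctured_plane"
      using \<beta> by (simp_all add: H0_def)
    show "\<beta> (x, y) = \<beta>' (x, y)" if "y \<noteq> 0" for x y
      using eq[of "(x, y)"] ae that
      by (auto simp: mem_punctured_plane triangular_intertwiner_def higgs3_def mult.commute)
  qed
qed

end

section \<open>Invariant sub-line bundles\<close>

lemma holomorphic2_on_Un:
  "holomorphic2_on f S \<Longrightarrow> holomorphic2_on f T \<Longrightarrow> holomorphic2_on f (S \<union> T)"
  unfolding holomorphic2_on_def by blast

lemma open_nonzero_set:
  assumes "open U" "holomorphic2_on f U"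
  shows "open {z \<in> U. f z \<noteq> 0}"
proof -
  have "open (U \<inter> f -` (- {0}))"
    using assms by (intro continuous_open_preimage holomorphic2_on_imp_continuous_on) auto
  moreover have "U \<inter> f -` (- {0}) = {z \<in> U. f z \<noteq> 0}" by auto
  ultimately show ?thesis by simp
qed

text \<open>The factor is a quotient of components, holomorphic where the denominator
  \<open>v z $ i\<close> is nonzero. Proportionality of \<open>e\<close> and \<open>v\<close> makes
  the two quotients agree on the overlap, and the two regions cover \<open>U\<close> because
  \<open>v\<close> has no zeros.\<close>

lemma torsion_free_quotient_nowhere_vanishing:
  assumes v: "\<And>i. holomorphic2_on (\<lambda>z. v z $ i) punctured_plane" and nz: "nowhere_vanishing v"
  shows "torsion_free_quotient v"
  unfolding torsion_free_quotient_def
proof (intro allI impI, elim conjE)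
  fix U and h m :: "complex \<times> complex \<Rightarrow> complex" and e :: "complex \<times> complex \<Rightarrow> complex ^ 2"
  assume U: "open U" "connected U" "U \<subseteq> punctured_plane" and h: "holomorphic2_on h U" "\<exists>z\<in>U. h z \<noteq> 0"
    and m: "holomorphic2_on m U" and "\<forall>i. holomorphic2_on (\<lambda>z. e z $ i) U"
    and eq: "\<forall>z\<in>U. h z *s e z = m z *s v z"
  then have e: "holomorphic2_on (\<lambda>z. e z $ i) U" for i by blast
  have v: "holomorphic2_on (\<lambda>z. v z $ i) U" for i using holomorphic2_on_subset[OF v U(3)] .
  have hm: "h z * e z $ i = m z * v z $ i" if "z \<in> U" for z i
    using arg_cong[OF bspec[OF eq that], of "\<lambda>w. w $ i"] by simp
  \<comment> \<open>Proportionality is clear where \<open>h\<close> is nonzero; cancelling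
    \<open>h\<close> extends it to all of \<open>U\<close>.\<close>
  have wedge: "e z $ 1 * v z $ 2 = e z $ 2 * v z $ 1" if "z \<in> U" for z
  proof (rule holomorphic2_mult_cancel[OF U(1,2) h _ _ _ that])
    show "h z * (e z $ 1 * v z $ 2) = h z * (e z $ 2 * v z $ 1)" if "z \<in> U" for z
    proof -
      have "(h z * e z $ 1) * v z $ 2 = (h z * e z $ 2) * v z $ 1"
        unfolding hm[OF that] by (simp only: mult_ac)
      then show ?thesis by (simp only: mult.assoc)
    qed
  qed (rule holomorphic2_on_mult, rule e, rule v)+
  define m' where "m' z = (if v z $ 1 \<noteq> 0 then e z $ 1 / v z $ 1 else e z $ 2 / v z $ 2)" for z
  define V where "V i = {z \<in> U. v z $ i \<noteq> 0}" for i
  have "V 1 \<union> V 2 = U"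
    using nz U(3) by (auto simp: V_def nowhere_vanishing_def vec_eq_iff forall_2)
  have m'_eq: "m' z = e z $ i / v z $ i" if "z \<in> V i" "i = 1 \<or> i = 2" for z i
    using that wedge[of z] by (auto simp: V_def m'_def field_simps)
  have "holomorphic2_on m' (V i)" if "i = 1 \<or> i = 2" for i
  proof -
    have "open (V i)" unfolding V_def by (rule open_nonzero_set[OF U(1) v])
    moreover have "holomorphic2_on (\<lambda>z. e z $ i / v z $ i) (V i)"
      using holomorphic2_on_subset[OF e, of "V i" i] holomorphic2_on_subset[OF v, of "V i" i]
      by (intro holomorphic2_on_divide) (auto simp: V_def)
    ultimately show ?thesis
      using holomorphic2_on_cong[of "V i" m' "\<lambda>z. e z $ i / v z $ i", OF _ m'_eq[OF _ that]] by simp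
  qed
  then have "holomorphic2_on m' U"
    using holomorphic2_on_Un[of m' "V 1" "V 2"] \<open>V 1 \<union> V 2 = U\<close> by simp
  moreover have "e z = m' z *s v z" if "z \<in> U" for z
  proof -
    have "v z $ 1 \<noteq> 0 \<or> v z $ 2 \<noteq> 0" using \<open>V 1 \<union> V 2 = U\<close> that by (auto simp: V_def)
    then show ?thesis
      using wedge[OF that] by (auto simp: vec_eq_iff forall_2 m'_def field_simps)
  qed
  ultimately show "\<exists>m'. holomorphic2_on m' U \<and> (\<forall>z\<in>U. e z = m' z *s v z)"
    by (intro exI[of _ m'] conjI ballI)
qed

lemma H0_inverse:
  assumes "f \<in> H0 b r \<sigma>" "nowhere_vanishing f"
  shows "(\<lambda>z. inverse (f z)) \<in> H0 b r (inverse \<sigma>)"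
  using H0_divide[OF H0_const[of 1] assms] by (simp add: inverse_eq_divide)

context hopf_surface
begin

text \<open>A nowhere vanishing factor changes neither the zeros nor the eigenvalue
  \<open>c\<close>; it only turns the multiplier \<open>\<sigma>'\<close> into
  \<open>\<sigma>\<close>. Torsion-freeness comes from the absence of zeros.\<close>

lemma invariant_sub_line_bundle_if_same:
  assumes W: "(\<lambda>z. W z $ 1) \<in> H0 b r (inverse \<sigma>')" "(\<lambda>z. W z $ 2) \<in> H0 b r (inverse \<sigma>' * \<tau>)"
      "\<sigma>' \<noteq> 0" "nowhere_vanishing W"
    and c: "c \<in> H0 b r \<mu>" "\<And>z. z \<in> punctured_plane \<Longrightarrow> \<phi> z *v W z = c z *s W z"
    and same: "same_sub_line_bundle b r \<sigma> v \<sigma>' W"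
  shows "invariant_sub_line_bundle b r \<mu> \<tau> \<phi> \<sigma> v"
proof -
  obtain u where u: "u \<in> H0 b r (\<sigma>' / \<sigma>)" "nowhere_vanishing u"
    and v: "\<And>z. z \<in> punctured_plane \<Longrightarrow> v z = u z *s W z"
    using same unfolding same_sub_line_bundle_def by blast
  have pp: "(1, 0) \<in> punctured_plane" by (simp add: mem_punctured_plane)
  \<comment> \<open>By the convention \<open>x / 0 = 0\<close> the multiplier of \<open>u\<close>
    would be zero, so \<open>u\<close> would vanish at the Hopf image of
    \<open>(1, 0)\<close>.\<close>
  have "\<sigma> \<noteq> 0"
  proof
    assume "\<sigma> = 0"
    then have "u (hopf_map b r (1, 0)) = 0" using u(1) pp by (simp add: H0_def)
    moreover have "hopf_map b r (1, 0) \<in> punctured_plane"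
      using pp hopf_map_mem[OF b_nonzero] by blast
    ultimately show False using u(2) by (simp add: nowhere_vanishing_def)
  qed
  have vi: "v z $ i = u z * W z $ i" if "z \<in> punctured_plane" for z i using v[OF that] by simp
  have v1: "(\<lambda>z. v z $ 1) \<in> H0 b r (inverse \<sigma>)"
    using H0_mult[OF u(1) W(1)] \<open>\<sigma>' \<noteq> 0\<close> by (subst H0_cong[OF b_nonzero vi]) (simp_all add: field_simps)
  have v2: "(\<lambda>z. v z $ 2) \<in> H0 b r (inverse \<sigma> * \<tau>)"
    using H0_mult[OF u(1) W(2)] \<open>\<sigma>' \<noteq> 0\<close> by (subst H0_cong[OF b_nonzero vi]) (simp_all add: field_simps)
  have "nowhere_vanishing v"
    using u(2) W(4) v by (simp add: nowhere_vanishing_def)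
  moreover have "holomorphic2_on (\<lambda>z. v z $ i) punctured_plane" for i
    using v1 v2 exhaust_2[of i] by (auto simp: H0_def)
  ultimately have "torsion_free_quotient v" by (intro torsion_free_quotient_nowhere_vanishing)
  then have "sub_line_bundle b r \<tau> \<sigma> v"
    using v1 v2 \<open>\<sigma> \<noteq> 0\<close> \<open>nowhere_vanishing v\<close> pp by (auto simp: sub_line_bundle_def nowhere_vanishing_def)
  moreover have "\<phi> z *v v z = c z *s v z" if "z \<in> punctured_plane" for z
  proof -
    have "(\<phi> z *v v z) $ i = u z * (\<phi> z *v W z) $ i" for i
      by (simp add: matrix_vector_mult_def v[OF that] sum_distrib_left mult_ac)
    then have "(\<phi> z *v v z) $ i = (c z *s v z) $ i" for i
      by (simp add: c(2)[OF that] v[OF that] mult_ac)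
    then show ?thesis by (simp add: vec_eq_iff)
  qed
  then have "higgs_invariant b r \<mu> \<phi> v" using c(1) unfolding higgs_invariant_def by blast
  ultimately show ?thesis by (simp add: invariant_sub_line_bundle_def)
qed

text \<open>Torsion-freeness applied to a local section proportional to \<open>v\<close> makes the factor of
  proportionality holomorphic, so no divisibility argument for sections is needed.\<close>

lemma same_sub_line_bundleI:
  assumes v: "sub_line_bundle b r \<tau> \<sigma> v" and "\<tau> \<noteq> 0"
    and W: "(\<lambda>z. W z $ 1) \<in> H0 b r (inverse \<sigma>')" "(\<lambda>z. W z $ 2) \<in> H0 b r (inverse \<sigma>' * \<tau>)"
      "\<sigma>' \<noteq> 0" "nowhere_vanishing W"
    and h: "holomorphic2_on h punctured_plane" "\<exists>z\<in>punctured_plane. h z \<noteq> 0"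
    and m: "holomorphic2_on m punctured_plane"
    and eq: "\<And>z. z \<in> punctured_plane \<Longrightarrow> h z *s W z = m z *s v z"
  shows "same_sub_line_bundle b r \<sigma> v \<sigma>' W"
proof -
  have "\<sigma> \<noteq> 0" and v1: "(\<lambda>z. v z $ 1) \<in> H0 b r (inverse \<sigma>)"
    and v2: "(\<lambda>z. v z $ 2) \<in> H0 b r (inverse \<sigma> * \<tau>)" and tf: "torsion_free_quotient v"
    using v by (auto simp: sub_line_bundle_def)
  have "holomorphic2_on (\<lambda>z. W z $ i) punctured_plane" for i
    using W(1,2) exhaust_2[of i] by (auto simp: H0_def)
  then have "\<exists>m'. holomorphic2_on m' punctured_plane \<and> (\<forall>z\<in>punctured_plane. W z = m' z *s v z)"
    by (intro tf[unfolded torsion_free_quotient_def, rule_format, of punctured_plane h m W] conjI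
        open_punctured_plane connected_punctured_plane h m ballI eq allI order_refl)
  then obtain m' where m': "holomorphic2_on m' punctured_plane"
    and W_eq: "\<And>z. z \<in> punctured_plane \<Longrightarrow> W z = m' z *s v z" by blast
  have m'0: "m' z \<noteq> 0" if "z \<in> punctured_plane" for z
    using W_eq[OF that] W(4) that by (auto simp: nowhere_vanishing_def)
  \<comment> \<open>The multiplier of \<open>m'\<close> is found by comparing \<open>W\<close> and
    \<open>v\<close> at \<open>z\<close> and at its Hopf image, in a component where
    \<open>v z\<close> does not vanish.\<close>
  have "m' \<in> H0 b r (\<sigma> / \<sigma>')"
    unfolding H0_def
  proof (intro CollectI conjI ballI m')
    fix z assume z: "z \<in> punctured_plane"
    then have Fz: "hopf_map b r z \<in> punctured_plane" using hopf_map_mem[OF b_nonzero] by blast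
    have "v z \<noteq> 0" using W_eq[OF z] W(4) z by (auto simp: nowhere_vanishing_def)
    have i1: "m' (hopf_map b r z) * (inverse \<sigma> * v z $ 1) = inverse \<sigma>' * (m' z * v z $ 1)"
    proof -
      have "W (hopf_map b r z) $ 1 = inverse \<sigma>' * W z $ 1" "v (hopf_map b r z) $ 1 = inverse \<sigma> * v z $ 1"
        using W(1) v1 z by (simp_all add: H0_def)
      then show ?thesis by (simp only: W_eq[OF Fz] W_eq[OF z] vector_smult_component)
    qed
    have i2: "m' (hopf_map b r z) * (inverse \<sigma> * \<tau> * v z $ 2) = inverse \<sigma>' * \<tau> * (m' z * v z $ 2)"
    proof -
      have "W (hopf_map b r z) $ 2 = inverse \<sigma>' * \<tau> * W z $ 2"
        "v (hopf_map b r z) $ 2 = inverse \<sigma> * \<tau> * v z $ 2"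
        using W(2) v2 z by (simp_all add: H0_def)
      then show ?thesis by (simp only: W_eq[OF Fz] W_eq[OF z] vector_smult_component)
    qed
    from \<open>v z \<noteq> 0\<close> have "v z $ 1 \<noteq> 0 \<or> \<tau> * v z $ 2 \<noteq> 0"
      using \<open>\<tau> \<noteq> 0\<close> by (simp add: vec_eq_iff forall_2)
    moreover have "(m' (hopf_map b r z) * inverse \<sigma>) * (v z $ 1) = (inverse \<sigma>' * m' z) * (v z $ 1)"
      "(m' (hopf_map b r z) * inverse \<sigma>) * (\<tau> * v z $ 2) = (inverse \<sigma>' * m' z) * (\<tau> * v z $ 2)"
      using i1 i2 by (simp_all only: mult_ac)
    ultimately have "m' (hopf_map b r z) * inverse \<sigma> = inverse \<sigma>' * m' z"
      by (elim disjE) (metis mult_right_cancel)+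
    then show "m' (hopf_map b r z) = \<sigma> / \<sigma>' * m' z"
      using \<open>\<sigma> \<noteq> 0\<close> \<open>\<sigma>' \<noteq> 0\<close> by (simp add: field_simps)
  qed
  then have u: "(\<lambda>z. inverse (m' z)) \<in> H0 b r (\<sigma>' / \<sigma>)"
    using H0_inverse[of m' b r "\<sigma> / \<sigma>'"] m'0 by (simp add: nowhere_vanishing_def)
  have u0: "nowhere_vanishing (\<lambda>z. inverse (m' z))"
    using m'0 by (simp add: nowhere_vanishing_def)
  have "v z = inverse (m' z) *s W z" if "z \<in> punctured_plane" for z
    using W_eq[OF that] m'0[OF that] by (simp add: vec_eq_iff)
  then have W': "\<forall>z\<in>punctured_plane. v z = inverse (m' z) *s W z" by (rule ballI)
  show ?thesis
    unfolding same_sub_line_bundle_def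
  proof (rule bexI)
    show "(\<lambda>z. inverse (m' z)) \<in> H0 b r (\<sigma>' / \<sigma>)" by (rule u)
    show "nowhere_vanishing (\<lambda>z. inverse (m' z)) \<and>
      (\<forall>z\<in>punctured_plane. v z = inverse (m' z) *s W z)" using u0 W' by (rule conjI)
  qed
qed

section \<open>Invariant sub-line bundles of the models\<close>

lemma matrix_vector_mult_2:
  fixes A :: "'a::semiring_1 ^ 2 ^ 2"
  shows "(A *v v) $ 1 = A $ 1 $ 1 * v $ 1 + A $ 1 $ 2 * v $ 2"
    "(A *v v) $ 2 = A $ 2 $ 1 * v $ 1 + A $ 2 $ 2 * v $ 2"
  by (simp_all add: matrix_vector_mult_def sum_2)

text \<open>An eigenvalue has weight \<open>l < r\<close> and is therefore
  \<open>\<gamma> * y ^ l\<close>. The second row says that \<open>(\<gamma> + s) * y ^ l\<close>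
  annihilates the second component of \<open>v\<close>. Either this component vanishes, or
  \<open>\<gamma> = - s\<close> and the first row makes \<open>v\<close> proportional to
  \<open>(x ^ k, - 2 * s * y ^ l)\<close>.\<close>

lemma higgs1_invariant_sub_line_bundle_iff:
  assumes l: "0 < l" "l < r" and k: "k > 0" and s: "s \<noteq> 0"
  shows "invariant_sub_line_bundle b r (b ^ l) (b powi (int l - int k * int r)) (higgs1 l k s) \<sigma> v \<longleftrightarrow>
    same_sub_line_bundle b r \<sigma> v 1 (\<lambda>z. vector [1, 0]) \<or>
    same_sub_line_bundle b r \<sigma> v (b powi (- (int k * int r))) (\<lambda>(x, y). vector [x ^ k, - 2 * s * y ^ l])"
proof -
  let ?\<tau> = "b powi (int l - int k * int r)" and ?\<sigma> = "b powi (- (int k * int r))"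
  define W :: "complex \<times> complex \<Rightarrow> complex ^ 2" where "W = (\<lambda>(x, y). vector [x ^ k, - 2 * s * y ^ l])"
  have W_nth: "W z $ 1 = fst z ^ k" "W z $ 2 = - 2 * s * snd z ^ l" for z
    by (simp_all add: W_def case_prod_beta')
  have \<tau>: "?\<tau> \<noteq> 0" "?\<sigma> \<noteq> 0" "inverse ?\<sigma> = (b ^ r) ^ k" "inverse ?\<sigma> * ?\<tau> = b ^ l"
    using b_nonzero by (simp_all add: power_int_minus power_int_diff flip: power_mult of_nat_mult)
      (simp_all add: mult.commute)
  have W0: "nowhere_vanishing W"
    unfolding nowhere_vanishing_def
  proof (intro ballI notI)
    fix z assume z: "z \<in> punctured_plane" "W z = 0"
    then have "W z $ 1 = 0" "W z $ 2 = 0" by simp_all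
    then show False using z(1) s by (cases z) (auto simp: W_nth mem_punctured_plane)
  qed
  have W1: "(\<lambda>z. W z $ 1) \<in> H0 b r (inverse ?\<sigma>)"
    unfolding W_nth \<tau>(3) by (rule H0_power[OF H0_fst])
  have W2: "(\<lambda>z. W z $ 2) \<in> H0 b r (inverse ?\<sigma> * ?\<tau>)"
    unfolding W_nth \<tau>(4) by (rule H0_snd_power)
  have E: "nowhere_vanishing (\<lambda>z. vector [1, 0] :: complex ^ 2)"
    "(\<lambda>z. (vector [1, 0] :: complex ^ 2) $ 1) \<in> H0 b r (inverse 1)"
    "(\<lambda>z. (vector [1, 0] :: complex ^ 2) $ 2) \<in> H0 b r (inverse 1 * ?\<tau>)"
    by (auto simp: nowhere_vanishing_def vec_eq_iff forall_2 H0_const H0_zero)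
  have \<phi>: "higgs1 l k s z $ 1 $ 1 = s * snd z ^ l" "higgs1 l k s z $ 1 $ 2 = fst z ^ k"
    "higgs1 l k s z $ 2 $ 1 = 0" "higgs1 l k s z $ 2 $ 2 = - (s * snd z ^ l)" for z
    by (simp_all add: higgs1_def case_prod_beta')
  have "invariant_sub_line_bundle b r (b ^ l) ?\<tau> (higgs1 l k s) \<sigma> v"
    if "same_sub_line_bundle b r \<sigma> v 1 (\<lambda>z. vector [1, 0])"
    by (rule invariant_sub_line_bundle_if_same[OF E(2,3) _ E(1) H0_snd_power[of s] _ that])
      (simp_all add: vec_eq_iff forall_2 matrix_vector_mult_2 \<phi>)
  moreover have "invariant_sub_line_bundle b r (b ^ l) ?\<tau> (higgs1 l k s) \<sigma> v"
    if "same_sub_line_bundle b r \<sigma> v ?\<sigma> W"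
    by (rule invariant_sub_line_bundle_if_same[OF W1 W2 \<tau>(2) W0 H0_snd_power[of "- s"] _ that])
      (simp_all add: vec_eq_iff forall_2 matrix_vector_mult_2 \<phi> W_nth)
  moreover have "same_sub_line_bundle b r \<sigma> v 1 (\<lambda>z. vector [1, 0]) \<or> same_sub_line_bundle b r \<sigma> v ?\<sigma> W"
    if inv: "invariant_sub_line_bundle b r (b ^ l) ?\<tau> (higgs1 l k s) \<sigma> v"
  proof -
    have sub: "sub_line_bundle b r ?\<tau> \<sigma> v"
      using inv by (simp add: invariant_sub_line_bundle_def)
    then have hol: "holomorphic2_on (\<lambda>z. v z $ 1) punctured_plane"
      "holomorphic2_on (\<lambda>z. v z $ 2) punctured_plane" and "\<exists>z\<in>punctured_plane. v z \<noteq> 0"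
      by (auto simp: sub_line_bundle_def H0_def)
    then have v0: "\<exists>z\<in>punctured_plane. v z $ 1 \<noteq> 0 \<or> v z $ 2 \<noteq> 0"
      by (auto simp: vec_eq_iff forall_2)
    obtain c where c: "c \<in> H0 b r (b ^ l)"
      "\<And>z. z \<in> punctured_plane \<Longrightarrow> higgs1 l k s z *v v z = c z *s v z"
      using inv unfolding invariant_sub_line_bundle_def higgs_invariant_def by blast
    obtain \<gamma> where \<gamma>: "\<And>x y. (x, y) \<in> punctured_plane \<Longrightarrow> c (x, y) = \<gamma> * y ^ l"
      using H0_low[OF c(1) l(2)] by blast
    have eq1: "s * snd z ^ l * v z $ 1 + fst z ^ k * v z $ 2 = \<gamma> * snd z ^ l * v z $ 1"
      and eq2: "- (s * snd z ^ l) * v z $ 2 = \<gamma> * snd z ^ l * v z $ 2" if "z \<in> punctured_plane" for z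
      using arg_cong[OF c(2)[OF that], of "\<lambda>w. w $ 1"] arg_cong[OF c(2)[OF that], of "\<lambda>w. w $ 2"]
        \<gamma>[of "fst z" "snd z"] that by (simp_all add: matrix_vector_mult_2 \<phi>)
    have cancel: "f z = 0" if f: "holomorphic2_on f punctured_plane"
      and "\<And>z. z \<in> punctured_plane \<Longrightarrow> a * fst z ^ i * snd z ^ j * f z = 0" "a \<noteq> 0" "z \<in> punctured_plane"
      for f z a i j
    proof (rule holomorphic2_mult_cancel[OF open_punctured_plane connected_punctured_plane _ _ f
          holomorphic2_on_const[of 0] _ that(4)])
      show "holomorphic2_on (\<lambda>z. a * fst z ^ i * snd z ^ j) punctured_plane"
        by (intro holomorphic2_intros)
      show "\<exists>z\<in>punctured_plane. a * fst z ^ i * snd z ^ j \<noteq> 0"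
        using \<open>a \<noteq> 0\<close> by (intro bexI[of _ "(1, 1)"]) (auto simp: mem_punctured_plane)
    qed (use that(2) in simp)
    show ?thesis
    proof (cases "\<forall>z\<in>punctured_plane. v z $ 2 = 0")
      case True
      have "same_sub_line_bundle b r \<sigma> v 1 (\<lambda>z. vector [1, 0])"
        by (rule same_sub_line_bundleI[OF sub \<tau>(1) E(2,3) _ E(1) hol(1) _ holomorphic2_on_const[of 1]])
          (use v0 True in \<open>auto simp: vec_eq_iff forall_2\<close>)
      then show ?thesis by blast
    next
      case False
      have "\<gamma> = - s"
      proof (rule ccontr)
        assume "\<gamma> \<noteq> - s"
        then have "\<gamma> + s \<noteq> 0" by (simp add: add_eq_0_iff2)
        then have "v z $ 2 = 0" if "z \<in> punctured_plane" for z
          using eq2 by (intro cancel[OF hol(2), of "\<gamma> + s" 0 l] that)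
            (simp_all add: algebra_simps eq_neg_iff_add_eq_0 neg_eq_iff_add_eq_0)
        with False show False by blast
      qed
      have eq: "fst z ^ k * v z $ 2 = - 2 * s * snd z ^ l * v z $ 1" if "z \<in> punctured_plane" for z
      proof -
        have "fst z ^ k * v z $ 2 = \<gamma> * snd z ^ l * v z $ 1 - s * snd z ^ l * v z $ 1"
          using eq1[OF that] by (metis add_diff_cancel_left')
        then show ?thesis by (simp add: \<open>\<gamma> = - s\<close>)
      qed
      \<comment> \<open>The first component of \<open>v\<close> serves as the factor in front of
        \<open>W\<close> in the torsion-freeness argument, so it must not vanish
        identically.\<close>
      have "\<exists>z\<in>punctured_plane. v z $ 1 \<noteq> 0"
      proof (rule ccontr)
        assume "\<not> (\<exists>z\<in>punctured_plane. v z $ 1 \<noteq> 0)"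
        then have "v z $ 2 = 0" if "z \<in> punctured_plane" for z
          using eq by (intro cancel[OF hol(2), of 1 k 0] that) simp_all
        with False show False by blast
      qed
      moreover have "v z $ 1 *s W z = fst z ^ k *s v z" if "z \<in> punctured_plane" for z
        using eq[OF that] by (simp add: vec_eq_iff forall_2 W_nth mult_ac)
      ultimately have "same_sub_line_bundle b r \<sigma> v ?\<sigma> W"
        by (rule same_sub_line_bundleI[OF sub \<tau>(1) W1 W2 \<tau>(2) W0 hol(1) _
              holomorphic2_on_power[where n = k, OF holomorphic2_on_fst]])
      then show ?thesis by blast
    qed
  qed
  ultimately show ?thesis unfolding W_def by blast
qed

text \<open>The second row makes the first component of \<open>v\<close> equal to \<open>c\<close>
  times the second, and the first row then gives \<open>c ^ 2 = t ^ 2\<close>. Both are constant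
  multiples of \<open>y ^ l\<close> because \<open>l < r\<close>, so the sign is the same
  everywhere.\<close>

lemma higgs2_invariant_sub_line_bundle_iff:
  assumes l: "0 < l" "l < r" and t: "t \<in> H0 b r (b ^ l)"
    and \<beta>: "\<And>z. z \<in> punctured_plane \<Longrightarrow> \<beta> z = (t z)\<^sup>2"
  shows "invariant_sub_line_bundle b r (b ^ l) (b powi (- int l)) (higgs2 \<beta>) \<sigma> v \<longleftrightarrow>
    same_sub_line_bundle b r \<sigma> v (b powi (- int l)) (\<lambda>z. vector [t z, 1]) \<or>
    same_sub_line_bundle b r \<sigma> v (b powi (- int l)) (\<lambda>z. vector [- t z, 1])"
proof -
  let ?\<tau> = "b powi (- int l)"
  have \<tau>: "?\<tau> \<noteq> 0" "inverse ?\<tau> = b ^ l" "inverse ?\<tau> * ?\<tau> = 1"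
    using b_nonzero by (simp_all add: power_int_minus)
  have \<phi>: "higgs2 \<beta> z $ 1 $ 1 = 0" "higgs2 \<beta> z $ 1 $ 2 = \<beta> z"
    "higgs2 \<beta> z $ 2 $ 1 = 1" "higgs2 \<beta> z $ 2 $ 2 = 0" for z
    by (simp_all add: higgs2_def)
  have W: "nowhere_vanishing (\<lambda>z. vector [u z, 1] :: complex ^ 2)"
    "(\<lambda>z. (vector [u z, 1] :: complex ^ 2) $ 1) \<in> H0 b r (inverse ?\<tau>)"
    "(\<lambda>z. (vector [u z, 1] :: complex ^ 2) $ 2) \<in> H0 b r (inverse ?\<tau> * ?\<tau>)"
    if "u \<in> H0 b r (b ^ l)" for u
  proof -
    have "(vector [u z, 1] :: complex ^ 2) \<noteq> 0" for z
      by (metis vector_2(2) zero_index zero_neq_one)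
    then show "nowhere_vanishing (\<lambda>z. vector [u z, 1] :: complex ^ 2)"
      by (simp add: nowhere_vanishing_def)
    show "(\<lambda>z. (vector [u z, 1] :: complex ^ 2) $ 1) \<in> H0 b r (inverse ?\<tau>)"
      using that by (simp add: \<tau>(2))
    show "(\<lambda>z. (vector [u z, 1] :: complex ^ 2) $ 2) \<in> H0 b r (inverse ?\<tau> * ?\<tau>)"
      unfolding \<tau>(3) by (simp add: H0_const)
  qed
  have if_same: "invariant_sub_line_bundle b r (b ^ l) ?\<tau> (higgs2 \<beta>) \<sigma> v"
    if u: "u \<in> H0 b r (b ^ l)" "\<And>z. z \<in> punctured_plane \<Longrightarrow> \<beta> z = (u z)\<^sup>2"
      and same: "same_sub_line_bundle b r \<sigma> v ?\<tau> (\<lambda>z. vector [u z, 1])" for u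
    by (rule invariant_sub_line_bundle_if_same[OF W(2,3)[OF u(1)] \<tau>(1) W(1)[OF u(1)] u(1) _ same])
      (simp_all add: vec_eq_iff forall_2 matrix_vector_mult_2 \<phi> u(2) power2_eq_square)
  have "same_sub_line_bundle b r \<sigma> v ?\<tau> (\<lambda>z. vector [t z, 1]) \<or>
      same_sub_line_bundle b r \<sigma> v ?\<tau> (\<lambda>z. vector [- t z, 1])"
    if inv: "invariant_sub_line_bundle b r (b ^ l) ?\<tau> (higgs2 \<beta>) \<sigma> v"
  proof -
    have sub: "sub_line_bundle b r ?\<tau> \<sigma> v"
      using inv by (simp add: invariant_sub_line_bundle_def)
    then have hol: "holomorphic2_on (\<lambda>z. v z $ 1) punctured_plane"
      "holomorphic2_on (\<lambda>z. v z $ 2) punctured_plane" and v0: "\<exists>z\<in>punctured_plane. v z \<noteq> 0"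
      by (auto simp: sub_line_bundle_def H0_def)
    obtain c where c: "c \<in> H0 b r (b ^ l)"
      "\<And>z. z \<in> punctured_plane \<Longrightarrow> higgs2 \<beta> z *v v z = c z *s v z"
      using inv unfolding invariant_sub_line_bundle_def higgs_invariant_def by blast
    have eq1: "(t z)\<^sup>2 * v z $ 2 = c z * v z $ 1" and eq2: "v z $ 1 = c z * v z $ 2"
      if "z \<in> punctured_plane" for z
      using arg_cong[OF c(2)[OF that], of "\<lambda>w. w $ 1"] arg_cong[OF c(2)[OF that], of "\<lambda>w. w $ 2"]
        \<beta>[OF that] that by (simp_all add: matrix_vector_mult_2 \<phi>)
    have g0: "\<exists>z\<in>punctured_plane. v z $ 2 \<noteq> 0"
      using v0 eq2 by (auto simp: vec_eq_iff forall_2)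
    have sq: "(t z)\<^sup>2 = (c z)\<^sup>2" if "z \<in> punctured_plane" for z
    proof (rule holomorphic2_mult_cancel[OF open_punctured_plane connected_punctured_plane hol(2) g0
          _ _ _ that])
      show "holomorphic2_on (\<lambda>z. (t z)\<^sup>2) punctured_plane" "holomorphic2_on (\<lambda>z. (c z)\<^sup>2) punctured_plane"
        using t c(1) by (auto simp: H0_def intro: holomorphic2_on_power)
      show "v z $ 2 * (t z)\<^sup>2 = v z $ 2 * (c z)\<^sup>2" if "z \<in> punctured_plane" for z
        using eq1[OF that] eq2[OF that] by (simp add: power2_eq_square mult_ac)
    qed
    obtain \<gamma> where \<gamma>: "\<And>x y. (x, y) \<in> punctured_plane \<Longrightarrow> c (x, y) = \<gamma> * y ^ l"
      using H0_low[OF c(1) l(2)] by blast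
    obtain \<theta> where \<theta>: "\<And>x y. (x, y) \<in> punctured_plane \<Longrightarrow> t (x, y) = \<theta> * y ^ l"
      using H0_low[OF t l(2)] by blast
    have "\<theta>\<^sup>2 = \<gamma>\<^sup>2" using sq[of "(0, 1)"] \<gamma>[of 0 1] \<theta>[of 0 1] by (simp add: mem_punctured_plane)
    then have ct: "(\<forall>z\<in>punctured_plane. c z = t z) \<or> (\<forall>z\<in>punctured_plane. c z = - t z)"
      using \<gamma> \<theta> by (auto simp: power2_eq_iff)
    have "same_sub_line_bundle b r \<sigma> v ?\<tau> (\<lambda>z. vector [u z, 1])"
      if u: "u \<in> H0 b r (b ^ l)" "\<forall>z\<in>punctured_plane. c z = u z" for u
      by (rule same_sub_line_bundleI[OF sub \<tau>(1) W(2,3)[OF u(1)] \<tau>(1) W(1)[OF u(1)] hol(2) g0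
            holomorphic2_on_const[of 1]])
        (use eq2 u(2) in \<open>auto simp: vec_eq_iff forall_2 mult.commute\<close>)
    from this[OF t] this[OF H0_uminus[OF t]] ct show ?thesis by blast
  qed
  then show ?thesis using if_same[OF t \<beta>] if_same[OF H0_uminus[OF t]] \<beta> by auto
qed

end

section \<open>Irreducibility of the spectral curve\<close>

text \<open>Orbits of the integers, expressed by natural iterates in either direction. Injectivity
  enters in the case of transitivity where two forward orbits meet: the common iterates are
  cancelled.\<close>

lemma equiv_orbits:
  assumes "inj T"
  shows "equiv S {(w, w'). w \<in> S \<and> w' \<in> S \<and> (\<exists>n. w' = (T ^^ n) w \<or> w = (T ^^ n) w')}"
    (is "equiv S ?R")
proof (rule equivI)
  have cancel: "x = (T ^^ (n - m)) y" if "(T ^^ m) x = (T ^^ n) y" "m \<le> n" for m n x y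
  proof -
    have "(T ^^ m) x = (T ^^ m) ((T ^^ (n - m)) y)"
      using that by (metis comp_apply funpow_add le_add_diff_inverse)
    then show ?thesis using inj_fn[OF assms, of m] by (simp add: inj_eq)
  qed
  show "?R \<subseteq> S \<times> S" by auto
  show "refl_on S ?R" by (auto simp: refl_on_def intro: exI[of _ 0])
  show "sym ?R" by (auto simp: sym_def)
  show "trans ?R"
  proof (rule transI)
    fix x y z assume "(x, y) \<in> ?R" "(y, z) \<in> ?R"
    then obtain m n where S: "x \<in> S" "z \<in> S" and m: "y = (T ^^ m) x \<or> x = (T ^^ m) y"
      and n: "z = (T ^^ n) y \<or> y = (T ^^ n) z" by auto
    have "\<exists>k. z = (T ^^ k) x \<or> x = (T ^^ k) z"
      using m
    proof
      assume y: "y = (T ^^ m) x"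
      from n show ?thesis
      proof
        assume "z = (T ^^ n) y"
        then have "z = (T ^^ (n + m)) x" by (simp add: y funpow_add)
        then show ?thesis by blast
      next
        assume "y = (T ^^ n) z"
        then have "(T ^^ m) x = (T ^^ n) z" using y by simp
        from cancel[OF this] cancel[OF this[symmetric]] show ?thesis by (metis nat_le_linear)
      qed
    next
      assume x: "x = (T ^^ m) y"
      from n show ?thesis
      proof
        assume z: "z = (T ^^ n) y"
        have "m \<le> n \<Longrightarrow> z = (T ^^ (n - m)) x" "n \<le> m \<Longrightarrow> x = (T ^^ (m - n)) z"
          unfolding x z by (simp_all flip: funpow_add comp_apply[of "T ^^ _" "T ^^ _"])
        then show ?thesis by (metis nat_le_linear)
      next
        assume "y = (T ^^ n) z"
        then have "x = (T ^^ (m + n)) z" by (simp add: x funpow_add)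
        then show ?thesis by blast
      qed
    qed
    with S show "(x, z) \<in> ?R" by blast
  qed
qed

text \<open>Classes are nonempty and pairwise disjoint, so a set of orbits is determined by its
  union. Pieces of the spectral curve can thus be compared through their preimages.\<close>

lemma quotient_subset_eq:
  assumes "equiv S R" "A \<subseteq> S // R" "A' \<subseteq> A" "\<Union>A \<subseteq> \<Union>A'"
  shows "A' = A"
proof
  show "A \<subseteq> A'"
  proof
    fix X assume X: "X \<in> A"
    then have "X \<noteq> {}" using assms(1,2) in_quotient_imp_non_empty by blast
    then obtain x where x: "x \<in> X" by blast
    then obtain Y where Y: "Y \<in> A'" "x \<in> Y" using X assms(4) by blast
    then have "X = Y" using quotient_disj[OF assms(1), of X Y] X x assms(2,3) by blast
    with Y show "X \<in> A'" by simp
  qed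
qed (rule assms(3))

lemma holomorphic3_on_imp_continuous_on: "holomorphic3_on f S \<Longrightarrow> continuous_on S f"
  unfolding holomorphic3_on_def
  by (meson continuous_at_imp_continuous_on has_derivative_continuous)

lemma holomorphic3_on_square_minus:
  assumes "holomorphic2_on g S"
  shows "holomorphic3_on (\<lambda>w. (snd w)\<^sup>2 - g (fst w)) (S \<times> UNIV)"
  unfolding holomorphic3_on_def
proof
  fix w assume "w \<in> S \<times> (UNIV :: complex set)"
  then obtain a c where g: "(g has_derivative (\<lambda>p. a * fst p + c * snd p)) (at (fst w))"
    using assms unfolding holomorphic2_on_iff by fastforce
  have "((\<lambda>w. g (fst w)) has_derivative (\<lambda>h. a * fst (fst h) + c * snd (fst h))) (at w)"
    by (rule has_derivative_compose[where f = fst and f' = fst and x = w, OF _ g])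
      (auto intro!: derivative_eq_intros)
  moreover have "((\<lambda>w. (snd w)\<^sup>2) has_derivative (\<lambda>h. 2 * snd w * snd h)) (at w)"
    by (auto intro!: derivative_eq_intros)
  ultimately have "((\<lambda>w. (snd w)\<^sup>2 - g (fst w)) has_derivative
      (\<lambda>h. 2 * snd w * snd h - (a * fst (fst h) + c * snd (fst h)))) (at w)"
    by (rule has_derivative_diff[rotated])
  then have "((\<lambda>w. (snd w)\<^sup>2 - g (fst w)) has_derivative
      (\<lambda>((u, v), t). - a * u + - c * v + 2 * snd w * t)) (at w)"
    by (simp add: case_prod_beta' algebra_simps)
  then show "\<exists>a c d. ((\<lambda>w. (snd w)\<^sup>2 - g (fst w)) has_derivative (\<lambda>((u, v), t). a * u + c * v + d * t)) (at w)"
    by blast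
qed

text \<open>If \<open>V2\<close> misses a point of \<open>W\<close>, its complement is open,
  nonempty and contained in \<open>V1\<close>; then \<open>V1\<close> has interior points and the
  dichotomy makes it everything.\<close>

lemma analytic_set_cover:
  assumes W: "open W" "connected W" and cover: "V1 \<union> V2 = W"
    and loc: "\<And>V p. V = V1 \<or> V = V2 \<Longrightarrow> p \<in> W \<Longrightarrow> \<exists>U Fs. open U \<and> p \<in> U \<and> U \<subseteq> W \<and> finite Fs \<and>
      (\<forall>f\<in>Fs. holomorphic2_on f U) \<and> V \<inter> U = {u \<in> U. \<forall>f\<in>Fs. f u = 0}"
  shows "V1 = W \<or> V2 = W"
proof -
  have "open (W - V2)"
    unfolding open_subopen[of "W - V2"]
  proof
    fix p assume p: "p \<in> W - V2"
    then obtain U Fs where U: "open U" "p \<in> U" "U \<subseteq> W" "\<forall>f\<in>Fs. holomorphic2_on f U"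
      "V2 \<inter> U = {u \<in> U. \<forall>f\<in>Fs. f u = 0}" using loc[of V2 p] by blast
    then obtain f where f: "f \<in> Fs" "f p \<noteq> 0" using p by blast
    have "open {u \<in> U. f u \<noteq> 0}" using U f by (intro open_nonzero_set) auto
    moreover have "{u \<in> U. f u \<noteq> 0} \<subseteq> W - V2" using U(3,5) f(1) by blast
    ultimately show "\<exists>T. open T \<and> p \<in> T \<and> T \<subseteq> W - V2" using U(2) f(2) by blast
  qed
  then have "W - V2 \<subseteq> interior V1" using cover by (intro interior_maximal) auto
  moreover have "V1 = W \<or> interior V1 = {}"
  proof (rule analytic_set_dichotomy[OF W])
    show "V1 \<subseteq> W" using cover by blast
    show "\<exists>U Fs. open U \<and> p \<in> U \<and> U \<subseteq> W \<and> (\<forall>f\<in>Fs. holomorphic2_on f U) \<and>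
        V1 \<inter> U = {u \<in> U. \<forall>f\<in>Fs. f u = 0}" if "p \<in> W" for p
      using loc[OF _ that, of V1] by blast
  qed
  ultimately show ?thesis using cover by blast
qed

context hopf_surface
begin

lemma equiv_bundle_rel:
  assumes "\<mu> \<noteq> 0"
  shows "equiv (punctured_plane \<times> UNIV) (bundle_rel b r \<mu>)"
proof -
  define T where "T w = (hopf_map b r (fst w), \<mu> * snd w)" for w
  have "inj T"
    using assms b_nonzero by (auto simp: inj_def T_def hopf_map_def)
  have T: "(T ^^ n) (z, v) = ((hopf_map b r ^^ n) z, \<mu> ^ n * v)" for n z v
    by (induction n) (simp_all add: T_def)
  have "bundle_rel b r \<mu> = {(w, w'). w \<in> punctured_plane \<times> UNIV \<and> w' \<in> punctured_plane \<times> UNIV \<and>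
      (\<exists>n. w' = (T ^^ n) w \<or> w = (T ^^ n) w')}"
    by (simp add: bundle_rel_def set_eq_iff split_paired_all T)
  then show ?thesis using equiv_orbits[OF \<open>inj T\<close>] by simp
qed

text \<open>As \<open>B\<close> has the square of \<open>\<mu>\<close> as multiplier, the equation
  is invariant under the action defining the total space and cuts out a union of whole
  orbits.\<close>

lemma Union_spectral_curve:
  assumes "\<mu> \<noteq> 0" and B: "B \<in> H0 b r (\<mu>\<^sup>2)"
    and det: "\<And>z \<eta>. z \<in> punctured_plane \<Longrightarrow> det (mat \<eta> - \<phi> z) = \<eta>\<^sup>2 - B z"
  shows "\<Union> (spectral_curve b r \<mu> \<phi>) = {(z, \<eta>). z \<in> punctured_plane \<and> \<eta>\<^sup>2 = B z}" (is "_ = ?Z")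
proof -
  have Fn: "(hopf_map b r ^^ n) z \<in> punctured_plane \<and> B ((hopf_map b r ^^ n) z) = (\<mu>\<^sup>2) ^ n * B z"
    if "z \<in> punctured_plane" for n z
    using that hopf_map_mem[OF b_nonzero] B by (induction n) (auto simp: H0_def)
  have step: "(\<mu> ^ n * \<eta>)\<^sup>2 = B ((hopf_map b r ^^ n) z) \<longleftrightarrow> \<eta>\<^sup>2 = B z" if "z \<in> punctured_plane" for n z \<eta>
    using Fn[OF that, of n] \<open>\<mu> \<noteq> 0\<close> by (simp add: power_mult_distrib power_mult[symmetric] mult.commute[of n])
  have curve: "spectral_curve b r \<mu> \<phi> = {bundle_rel b r \<mu> `` {(z, \<eta>)} |z \<eta>. z \<in> punctured_plane \<and> \<eta>\<^sup>2 = B z}"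
    unfolding spectral_curve_def using det by (auto 4 4)
  show ?thesis
  proof
    show "?Z \<subseteq> \<Union> (spectral_curve b r \<mu> \<phi>)"
    proof
      fix w assume "w \<in> ?Z"
      then obtain z \<eta> where w: "w = (z, \<eta>)" "z \<in> punctured_plane" "\<eta>\<^sup>2 = B z" by blast
      then have "w \<in> bundle_rel b r \<mu> `` {(z, \<eta>)}"
        using equiv_class_self[OF equiv_bundle_rel[OF \<open>\<mu> \<noteq> 0\<close>], of w] by simp
      moreover have "bundle_rel b r \<mu> `` {(z, \<eta>)} \<in> spectral_curve b r \<mu> \<phi>"
        unfolding curve using w by blast
      ultimately show "w \<in> \<Union> (spectral_curve b r \<mu> \<phi>)" by (rule UnionI[rotated])
    qed
    show "\<Union> (spectral_curve b r \<mu> \<phi>) \<subseteq> ?Z"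
    proof
      fix w assume "w \<in> \<Union> (spectral_curve b r \<mu> \<phi>)"
      then obtain z \<eta> where z: "z \<in> punctured_plane" "\<eta>\<^sup>2 = B z" and w: "((z, \<eta>), w) \<in> bundle_rel b r \<mu>"
        unfolding curve by auto
      obtain z' \<eta>' where w': "w = (z', \<eta>')" by fastforce
      obtain n where z': "z' \<in> punctured_plane"
        and "(z', \<eta>') = ((hopf_map b r ^^ n) z, \<mu> ^ n * \<eta>) \<or> (z, \<eta>) = ((hopf_map b r ^^ n) z', \<mu> ^ n * \<eta>')"
        using w unfolding w' bundle_rel_def by blast
      then have "\<eta>'\<^sup>2 = B z'"
        using z step[OF z(1), of n \<eta>] step[OF z', of n \<eta>'] by auto
      with z' show "w \<in> ?Z" by (simp add: w')
    qed
  qed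
qed

text \<open>Away from \<open>y = 0\<close> the curve \<open>\<eta>\<^sup>2 = y\<^sup>m (\<alpha> x + \<gamma> y\<^sup>r)\<close> can be solved for \<open>x\<close>, hence is a
  graph over the connected set of all \<open>(y, \<eta>)\<close> with \<open>y \<noteq> 0\<close>; the points with \<open>y = 0\<close> lie in the
  closure of this graph.\<close>

lemma irreducible_spectral_curve:
  assumes "\<mu> \<noteq> 0" and B: "B \<in> H0 b r (\<mu>\<^sup>2)"
    and det: "\<And>z \<eta>. z \<in> punctured_plane \<Longrightarrow> det (mat \<eta> - \<phi> z) = \<eta>\<^sup>2 - B z"
    and B_eq: "\<And>x y. (x, y) \<in> punctured_plane \<Longrightarrow> B (x, y) = y ^ m * (\<alpha> * x + \<gamma> * y ^ r)"
    and "\<alpha> \<noteq> 0"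
  shows "irreducible_analytic b r \<mu> (spectral_curve b r \<mu> \<phi>)"
proof -
  define S where "S = punctured_plane \<times> (UNIV :: complex set)"
  define A where "A = spectral_curve b r \<mu> \<phi>"
  define Z where "Z = {(z, \<eta>). z \<in> punctured_plane \<and> \<eta>\<^sup>2 = B z}"
  have equiv: "equiv S (bundle_rel b r \<mu>)"
    unfolding S_def by (rule equiv_bundle_rel[OF \<open>\<mu> \<noteq> 0\<close>])
  have UA: "\<Union>A = Z" unfolding A_def Z_def by (rule Union_spectral_curve[OF \<open>\<mu> \<noteq> 0\<close> B det])
  have "open S" unfolding S_def by (intro open_Times open_punctured_plane open_UNIV)
  have AS: "A \<subseteq> total_space b r \<mu>"
    unfolding A_def spectral_curve_def total_space_def by (auto intro!: quotientI)
  have analytic: "analytic_subset b r \<mu> A"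
    unfolding analytic_subset_def
  proof (intro conjI ballI AS)
    fix w :: "(complex \<times> complex) \<times> complex" assume w: "w \<in> punctured_plane \<times> UNIV"
    have "holomorphic3_on (\<lambda>w. (snd w)\<^sup>2 - B (fst w)) S"
      unfolding S_def by (rule holomorphic3_on_square_minus) (use B in \<open>simp add: H0_def\<close>)
    moreover have "\<Union>A \<inter> S = {u \<in> S. \<forall>f\<in>{\<lambda>w. (snd w)\<^sup>2 - B (fst w)}. f u = 0}"
      unfolding UA by (auto simp: Z_def S_def)
    ultimately show "\<exists>U Fs. open U \<and> w \<in> U \<and> U \<subseteq> punctured_plane \<times> UNIV \<and> finite Fs \<and>
        (\<forall>f\<in>Fs. holomorphic3_on f U) \<and> \<Union>A \<inter> U = {u \<in> U. \<forall>f\<in>Fs. f u = 0}"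
      using \<open>open S\<close> w
      by (intro exI[of _ S] exI[of _ "{\<lambda>w. (snd w)\<^sup>2 - B (fst w)}"]) (auto simp: S_def)
  qed
  have "((0, 1), csqrt (B (0, 1))) \<in> Z" by (simp add: Z_def mem_punctured_plane)
  then have "A \<noteq> {}" using UA by blast
  define W where "W = (- {0 :: complex}) \<times> (UNIV :: complex set)"
  have W: "open W" "connected W"
    unfolding W_def by (auto intro!: open_Times connected_Times connected_punctured_universe)
  \<comment> \<open>The equation of the curve solved for \<open>x\<close>, with
    \<open>p = (y, \<eta>)\<close>.\<close>
  define g where "g p = ((snd p)\<^sup>2 / fst p ^ m - \<gamma> * fst p ^ r) / \<alpha>" for p :: "complex \<times> complex"
  have g: "holomorphic2_on g W"
    unfolding g_def using \<open>\<alpha> \<noteq> 0\<close>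
    by (intro holomorphic2_on_divide holomorphic2_on_diff holomorphic2_on_mult holomorphic2_on_power
        holomorphic2_on_fst holomorphic2_on_snd holomorphic2_on_const) (auto simp: W_def)
  define \<Phi> where "\<Phi> p = ((g p, fst p), snd p)" for p
  have \<Phi>_Z: "\<Phi> p \<in> Z" if "p \<in> W" for p
    using that \<open>\<alpha> \<noteq> 0\<close> by (auto simp: \<Phi>_def Z_def W_def mem_punctured_plane B_eq g_def)
  have Z_\<Phi>: "((x, y), \<eta>) = \<Phi> (y, \<eta>)" if "((x, y), \<eta>) \<in> Z" "y \<noteq> 0" for x y \<eta>
    using that \<open>\<alpha> \<noteq> 0\<close> by (auto simp: \<Phi>_def Z_def mem_punctured_plane B_eq g_def)
  have cont: "continuous_on W \<Phi>"
    unfolding \<Phi>_def by (intro continuous_intros holomorphic2_on_imp_continuous_on[OF g])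
  have irr: "A1 = A \<or> A2 = A"
    if A1: "analytic_subset b r \<mu> A1" and A2: "analytic_subset b r \<mu> A2" and A12: "A = A1 \<union> A2" for A1 A2
  proof -
    have loc: "\<exists>U Fs. open U \<and> w \<in> U \<and> U \<subseteq> S \<and> finite Fs \<and>
        (\<forall>f\<in>Fs. holomorphic3_on f U) \<and> \<Union>A' \<inter> U = {u \<in> U. \<forall>f\<in>Fs. f u = 0}"
      if "A' = A1 \<or> A' = A2" "w \<in> S" for A' w
      using that A1 A2 unfolding S_def analytic_subset_def by blast
    \<comment> \<open>The decomposition of the curve is pulled back to the connected parameter set
      \<open>W\<close>, where one of the two pieces has to be everything.\<close>
    define V where "V A' = {p \<in> W. \<Phi> p \<in> \<Union>A'}" for A'
    have "V A1 \<union> V A2 = W"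
    proof -
      have "\<Union>A1 \<union> \<Union>A2 = Z" using UA A12 by blast
      then show ?thesis using \<Phi>_Z unfolding V_def by blast
    qed
    moreover have "\<exists>U Fs. open U \<and> p \<in> U \<and> U \<subseteq> W \<and> finite Fs \<and>
        (\<forall>f\<in>Fs. holomorphic2_on f U) \<and> V A' \<inter> U = {u \<in> U. \<forall>f\<in>Fs. f u = 0}"
      if A': "A' = A1 \<or> A' = A2" and p: "p \<in> W" for A' p
    proof -
      have "\<Phi> p \<in> S" using \<Phi>_Z[OF p] by (auto simp: Z_def S_def)
      from loc[OF A' this] obtain U Fs where U: "open U" "\<Phi> p \<in> U" "U \<subseteq> S" "finite Fs"
        "\<forall>f\<in>Fs. holomorphic3_on f U" "\<Union>A' \<inter> U = {u \<in> U. \<forall>f\<in>Fs. f u = 0}" by blast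
      define U' where "U' = W \<inter> \<Phi> -` U"
      have "open U'"
        unfolding U'_def by (rule continuous_open_preimage[OF cont W(1) U(1)])
      moreover have "holomorphic2_on (\<lambda>p. f (\<Phi> p)) U'" if "f \<in> Fs" for f
        unfolding \<Phi>_def
      proof (rule holomorphic2_on_surface)
        show "holomorphic3_on f U" using U(5) that by blast
        show "holomorphic2_on g U'"
          using g by (rule holomorphic2_on_subset) (auto simp: U'_def)
        show "\<And>y e. (y, e) \<in> U' \<Longrightarrow> ((g (y, e), y), e) \<in> U"
          by (simp add: U'_def \<Phi>_def)
      qed
      moreover have "V A' \<inter> U' = {u \<in> U'. \<forall>f\<in>(\<lambda>f p. f (\<Phi> p)) ` Fs. f u = 0}"
      proof -
        have "\<Phi> u \<in> \<Union>A' \<longleftrightarrow> (\<forall>f\<in>Fs. f (\<Phi> u) = 0)" if "u \<in> U'" for u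
          using U(6) that unfolding U'_def by blast
        then have "{u \<in> U'. \<Phi> u \<in> \<Union>A'} = {u \<in> U'. \<forall>f\<in>Fs. f (\<Phi> u) = 0}" by blast
        moreover have "V A' \<inter> U' = {u \<in> U'. \<Phi> u \<in> \<Union>A'}" unfolding V_def U'_def by blast
        ultimately show ?thesis by (simp del: Union_iff)
      qed
      ultimately show ?thesis
        using U(4) U(2) p
        by (intro exI[of _ U'] exI[of _ "(\<lambda>f p. f (\<Phi> p)) ` Fs"]) (auto simp: U'_def)
    qed
    ultimately have "V A1 = W \<or> V A2 = W"
      using analytic_set_cover[OF W, of "V A1" "V A2"] by blast
    moreover have "A' = A" if A': "A' = A1 \<or> A' = A2" and VW: "V A' = W" for A'
    proof (rule quotient_subset_eq[OF equiv])
      show "A \<subseteq> S // bundle_rel b r \<mu>" using AS by (simp add: total_space_def S_def)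
      show "A' \<subseteq> A" using A' A12 by blast
      have off_axis: "((x, y), \<eta>) \<in> \<Union>A'" if "((x, y), \<eta>) \<in> Z" "y \<noteq> 0" for x y \<eta>
      proof -
        have "(y, \<eta>) \<in> V A'" using VW that(2) by (simp add: W_def)
        then show ?thesis unfolding V_def Z_\<Phi>[OF that] by blast
      qed
      have "((x, 0), \<eta>) \<in> \<Union>A'" if xZ: "((x, 0), \<eta>) \<in> Z" for x \<eta>
      proof -
        have "(x, 0) \<in> punctured_plane" and \<eta>: "\<eta>\<^sup>2 = 0 ^ m * (\<alpha> * x)"
          using xZ r_pos B_eq[of x 0] by (auto simp: Z_def zero_power)
        \<comment> \<open>A square root of \<open>\<alpha> * x\<close> adapted to the given
          endpoint: for \<open>m = 0\<close> it has to be \<open>\<eta>\<close> itself, while for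
          \<open>m > 0\<close> one has \<open>\<eta> = 0\<close> and any root will do.\<close>
        obtain \<kappa> where \<kappa>: "\<kappa>\<^sup>2 = \<alpha> * x" "\<kappa> * 0 ^ m = \<eta>"
        proof (cases "m = 0")
          case True
          then show ?thesis using \<eta> that[of \<eta>] by simp
        next
          case False
          then show ?thesis using \<eta> that[of "csqrt (\<alpha> * x)"] by (simp add: zero_power)
        qed
        \<comment> \<open>A path in the curve that runs into \<open>((x, 0), \<eta>)\<close>. The
          substitution \<open>y = t ^ 2\<close> makes \<open>y ^ m\<close> a square, and the
          correction to \<open>x\<close> keeps \<open>\<alpha> * x + \<gamma> * y ^ r\<close>
          constant along the path, so \<open>\<kappa> * t ^ m\<close> is a root of the
          equation.\<close>
        define c where "c t = ((x - \<gamma> / \<alpha> * t ^ (2 * r), t\<^sup>2), \<kappa> * t ^ m)" for t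
        have c0: "c 0 = ((x, 0), \<eta>)" using r_pos \<kappa>(2) by (simp add: c_def zero_power)
        have cont_c: "isCont c t" for t
          unfolding c_def by (intro continuous_intros)
        have cA: "c t \<in> \<Union>A'" if "t \<noteq> 0" for t
          unfolding c_def
        proof (rule off_axis)
          have "(t\<^sup>2) ^ r = t ^ (2 * r)" "(t\<^sup>2) ^ m = t ^ m * t ^ m" "(\<kappa> * t ^ m)\<^sup>2 = \<alpha> * x * (t ^ m * t ^ m)"
            using \<kappa>(1) by (simp_all add: power_mult power_mult_distrib power2_eq_square)
          then show "((x - \<gamma> / \<alpha> * t ^ (2 * r), t\<^sup>2), \<kappa> * t ^ m) \<in> Z"
            using that \<open>\<alpha> \<noteq> 0\<close> by (simp add: Z_def mem_punctured_plane B_eq algebra_simps)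
        qed (use that in simp)
        have "((x, 0), \<eta>) \<in> S" using xZ by (auto simp: Z_def S_def)
        from loc[OF A' this] obtain U Fs where U: "open U" "((x, 0), \<eta>) \<in> U"
          "\<forall>f\<in>Fs. holomorphic3_on f U" "\<Union>A' \<inter> U = {u \<in> U. \<forall>f\<in>Fs. f u = 0}" by blast
        have c_lim: "(c \<longlongrightarrow> ((x, 0), \<eta>)) (at 0)"
          using cont_c[of 0] unfolding isCont_def c0 .
        then have "\<forall>\<^sub>F t in at 0. c t \<in> U" using U(1,2) by (rule topological_tendstoD)
        moreover have "\<forall>\<^sub>F t in at 0. t \<noteq> (0 :: complex)" by (simp add: eventually_at_filter)
        ultimately have ev: "\<forall>\<^sub>F t in at 0. c t \<in> \<Union>A' \<inter> U"
          by eventually_elim (use cA in blast)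
        \<comment> \<open>The local equations of \<open>A'\<close> hold on the path for small
          \<open>t \<noteq> 0\<close> and pass to its endpoint by continuity.\<close>
        have "f ((x, 0), \<eta>) = 0" if "f \<in> Fs" for f
        proof -
          have "continuous_on U f" using U(3) that holomorphic3_on_imp_continuous_on by blast
          then have "isCont f ((x, 0), \<eta>)" using U(1,2) continuous_on_eq_continuous_at by blast
          then have "((\<lambda>t. f (c t)) \<longlongrightarrow> f ((x, 0), \<eta>)) (at 0)"
            using isCont_tendsto_compose c_lim by blast
          moreover have "\<forall>\<^sub>F t in at 0. f (c t) = 0"
            using ev by eventually_elim (use U(4) that in blast)
          then have "((\<lambda>t. f (c t)) \<longlongrightarrow> 0) (at 0)" by (rule tendsto_eventually)
          ultimately show ?thesis using tendsto_unique[OF at_neq_bot] by blast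
        qed
        with U(2,4) show ?thesis by blast
      qed
      then show "\<Union>A \<subseteq> \<Union>A'"
        unfolding UA using off_axis by (metis (no_types) subsetI surj_pair)
    qed
    ultimately show ?thesis by blast
  qed
  show ?thesis
    unfolding irreducible_analytic_def A_def[symmetric] using analytic \<open>A \<noteq> {}\<close> irr by blast
qed

text \<open>Every constant multiple of \<open>y ^ (2 * l)\<close> is a square, by a square root of
  the constant. A section that is not a square must therefore contain \<open>x\<close>: the weight
  \<open>r\<close> of \<open>x\<close> fits into \<open>2 * l\<close>, and the coefficient of
  \<open>x\<close> is nonzero, as is needed to solve for \<open>x\<close>.\<close>

lemma higgs2_irreducible:
  assumes l: "0 < l" "l < r" and \<beta>: "\<beta> \<in> H0 b r (b ^ (2 * l))"
    and nonsquare: "\<not> is_square_section b r l \<beta>"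
  shows "irreducible_analytic b r (b ^ l) (spectral_curve b r (b ^ l) (higgs2 \<beta>))" "r \<le> 2 * l"
proof -
  have not_power: "\<not> (\<forall>x y. (x, y) \<in> punctured_plane \<longrightarrow> \<beta> (x, y) = c * y ^ (2 * l))" for c
  proof
    assume *: "\<forall>x y. (x, y) \<in> punctured_plane \<longrightarrow> \<beta> (x, y) = c * y ^ (2 * l)"
    have "\<beta> z = (csqrt c * snd z ^ l)\<^sup>2" if "z \<in> punctured_plane" for z
      using *[rule_format, of "fst z" "snd z"] that
      by (simp add: power_mult_distrib mult.commute[of 2 l] power_mult)
    then have "is_square_section b r l \<beta>"
      unfolding is_square_section_def
      by (intro bexI[of _ "\<lambda>z. csqrt c * snd z ^ l"] ballI H0_snd_power)
    with nonsquare show False ..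
  qed
  show "r \<le> 2 * l"
  proof (rule ccontr)
    assume "\<not> r \<le> 2 * l"
    then obtain c where "\<And>x y. (x, y) \<in> punctured_plane \<Longrightarrow> \<beta> (x, y) = c * y ^ (2 * l)"
      using H0_low[OF \<beta>] by (meson not_le)
    with not_power show False by blast
  qed
  then obtain m where m: "2 * l = r + m" using le_Suc_ex by blast
  then have "m < r" using l by linarith
  then obtain \<alpha> \<gamma> where eq: "\<And>x y. (x, y) \<in> punctured_plane \<Longrightarrow> \<beta> (x, y) = y ^ m * (\<alpha> * x + \<gamma> * y ^ r)"
    using H0_mid \<beta> m by metis
  have "\<alpha> \<noteq> 0"
  proof
    assume "\<alpha> = 0"
    then have "\<beta> (x, y) = \<gamma> * y ^ (2 * l)" if "(x, y) \<in> punctured_plane" for x y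
      using eq[OF that] by (simp add: m power_add)
    with not_power show False by blast
  qed
  moreover have "\<beta> \<in> H0 b r ((b ^ l)\<^sup>2)" using \<beta> by (simp add: power_mult[symmetric] mult.commute)
  moreover have "det (mat \<eta> - higgs2 \<beta> z) = \<eta>\<^sup>2 - \<beta> z" for z \<eta>
    by (simp add: det_2 mat_def higgs2_def power2_eq_square)
  ultimately show "irreducible_analytic b r (b ^ l) (spectral_curve b r (b ^ l) (higgs2 \<beta>))"
    using b_nonzero eq by (intro irreducible_spectral_curve[of "b ^ l" \<beta> _ m \<alpha> \<gamma>]) auto
qed

text \<open>Minus the determinant is \<open>y ^ (2 * l - r)\<close> times \<open>\<beta>\<close>,
  and \<open>\<beta> (1, 0)\<close> is the coefficient of \<open>x\<close> in
  \<open>\<beta>\<close>, so the curve can always be solved for \<open>x\<close>.\<close>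

lemma higgs3_irreducible:
  assumes "r < 2 * l" and \<beta>: "\<beta> \<in> H0 b r (b ^ r)" "\<beta> (1, 0) \<noteq> 0"
  shows "irreducible_analytic b r (b ^ l) (spectral_curve b r (b ^ l) (higgs3 r l \<beta>))"
proof -
  have "\<beta> \<in> H0 b r (b ^ (r + 0))" using \<beta>(1) by simp
  then obtain \<alpha> \<gamma> where eq: "\<And>x y. (x, y) \<in> punctured_plane \<Longrightarrow> \<beta> (x, y) = y ^ 0 * (\<alpha> * x + \<gamma> * y ^ r)"
    using H0_mid[OF _ r_pos] by blast
  have "\<alpha> \<noteq> 0" using eq[of 1 0] \<beta>(2) r_pos by (auto simp: mem_punctured_plane zero_power)
  moreover have "(\<lambda>z. \<beta> z * (1 * snd z ^ (2 * l - r))) \<in> H0 b r ((b ^ l)\<^sup>2)"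
    by (rule H0_mult[OF \<beta>(1) H0_snd_power])
      (use assms(1) in \<open>simp add: power_mult[symmetric] mult.commute flip: power_add\<close>)
  moreover have "det (mat \<eta> - higgs3 r l \<beta> z) = \<eta>\<^sup>2 - \<beta> z * (1 * snd z ^ (2 * l - r))" for z \<eta>
    by (simp add: det_2 mat_def higgs3_def case_prod_beta' power2_eq_square)
  ultimately show ?thesis
    using b_nonzero eq
    by (intro irreducible_spectral_curve[of "b ^ l" "\<lambda>z. \<beta> z * (1 * snd z ^ (2 * l - r))" _ "2 * l - r" \<alpha> \<gamma>]) auto
qed

end

theorem proposition5p8:
  fixes b :: complex and r l :: nat
  assumes "0 < cmod b" and "cmod b < 1" and "r > 1" and "0 < l" and "l < r"
  shows
    "(\<comment> \<open>the list\<close>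
      \<forall>\<tau> \<phi>. (\<tau> \<noteq> 0 \<and> bundle_degree b \<tau> \<le> 0 \<and> higgs_field b r (b ^ l) \<tau> \<phi> \<and> nowhere_vanishing \<phi>) \<longleftrightarrow>
         (\<exists>k>0. \<tau> = b powi (int l - int k * int r) \<and>
            (\<exists>s. s \<noteq> 0 \<and> conjugate b r \<tau> \<phi> (higgs1 l k s))) \<or>
         (\<tau> = b powi (- int l) \<and>
            (\<exists>\<beta> \<in> H0 b r (b ^ (2 * l)). conjugate b r \<tau> \<phi> (higgs2 \<beta>))) \<or>
         (r < 2 * l \<and> \<tau> = b powi (int l - int r) \<and>
            (\<exists>\<beta> \<in> H0 b r (b ^ r). \<beta> (1, 0) \<noteq> 0 \<and> conjugate b r \<tau> \<phi> (higgs3 r l \<beta>))))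
     \<and> (\<comment> \<open>type (1)\<close>
      \<forall>k>0. \<forall>s. s \<noteq> 0 \<longrightarrow>
         (\<forall>s'. s' \<noteq> 0 \<and>
            conjugate b r (b powi (int l - int k * int r)) (higgs1 l k s) (higgs1 l k s') \<longrightarrow> s = s') \<and>
         (\<forall>\<beta>. \<not> conjugate b r (b powi (int l - int k * int r)) (higgs1 l k s) (higgs2 \<beta>) \<and>
              (r < 2 * l \<longrightarrow>
                 \<not> conjugate b r (b powi (int l - int k * int r)) (higgs1 l k s) (higgs3 r l \<beta>))) \<and>
         (\<forall>\<sigma> v.
            invariant_sub_line_bundle b r (b ^ l) (b powi (int l - int k * int r)) (higgs1 l k s) \<sigma> v \<longleftrightarrow>
              same_sub_line_bundle b r \<sigma> v 1 (\<lambda>z. vector [1, 0]) \<or>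
              same_sub_line_bundle b r \<sigma> v (b powi (- (int k * int r)))
                (\<lambda>(x, y). vector [x ^ k, - 2 * s * y ^ l])))
     \<and> (\<comment> \<open>type (2)\<close>
      \<forall>\<beta> \<in> H0 b r (b ^ (2 * l)).
         (\<forall>\<beta>' \<in> H0 b r (b ^ (2 * l)).
            conjugate b r (b powi (- int l)) (higgs2 \<beta>) (higgs2 \<beta>') \<longrightarrow>
            (\<forall>z\<in>punctured_plane. \<beta> z = \<beta>' z)) \<and>
         (\<not> is_square_section b r l \<beta> \<longrightarrow>
            irreducible_analytic b r (b ^ l) (spectral_curve b r (b ^ l) (higgs2 \<beta>)) \<and> r \<le> 2 * l) \<and>
         (\<forall>t \<in> H0 b r (b ^ l). (\<forall>z\<in>punctured_plane. \<beta> z = (t z)\<^sup>2) \<longrightarrow>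
            (\<forall>\<sigma> v.
               invariant_sub_line_bundle b r (b ^ l) (b powi (- int l)) (higgs2 \<beta>) \<sigma> v \<longleftrightarrow>
                 same_sub_line_bundle b r \<sigma> v (b powi (- int l)) (\<lambda>z. vector [t z, 1]) \<or>
                 same_sub_line_bundle b r \<sigma> v (b powi (- int l)) (\<lambda>z. vector [- t z, 1]))))
     \<and> (\<comment> \<open>type (3)\<close>
      r < 2 * l \<longrightarrow> (\<forall>\<beta> \<in> H0 b r (b ^ r). \<beta> (1, 0) \<noteq> 0 \<longrightarrow>
         (\<forall>\<beta>' \<in> H0 b r (b ^ r). \<beta>' (1, 0) \<noteq> 0 \<and>
            conjugate b r (b powi (int l - int r)) (higgs3 r l \<beta>) (higgs3 r l \<beta>') \<longrightarrow>
            (\<forall>z\<in>punctured_plane. \<beta> z = \<beta>' z)) \<and>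
         irreducible_analytic b r (b ^ l) (spectral_curve b r (b ^ l) (higgs3 r l \<beta>))))"
proof -
  interpret hopf_surface b r
    using assms by unfold_locales auto
  note l = assms(4,5)
  show ?thesis
  proof (intro conjI allI impI ballI; (elim conjE)?)
    fix \<tau> \<phi>
    show "(\<tau> \<noteq> 0 \<and> bundle_degree b \<tau> \<le> 0 \<and> higgs_field b r (b ^ l) \<tau> \<phi> \<and> nowhere_vanishing \<phi>) \<longleftrightarrow>
         (\<exists>k>0. \<tau> = b powi (int l - int k * int r) \<and>
            (\<exists>s. s \<noteq> 0 \<and> conjugate b r \<tau> \<phi> (higgs1 l k s))) \<or>
         (\<tau> = b powi (- int l) \<and>
            (\<exists>\<beta> \<in> H0 b r (b ^ (2 * l)). conjugate b r \<tau> \<phi> (higgs2 \<beta>))) \<or>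
         (r < 2 * l \<and> \<tau> = b powi (int l - int r) \<and>
            (\<exists>\<beta> \<in> H0 b r (b ^ r). \<beta> (1, 0) \<noteq> 0 \<and> conjugate b r \<tau> \<phi> (higgs3 r l \<beta>)))"
      (is "?L \<longleftrightarrow> ?R")
    proof
      show "?L \<Longrightarrow> ?R" by (elim conjE) (rule higgs_classification[OF l])
      show "?R \<Longrightarrow> ?L" by (rule higgs_classification_converse[OF l])
    qed
  next
    fix k :: nat and s s' assume "k > 0"
      and "conjugate b r (b powi (int l - int k * int r)) (higgs1 l k s) (higgs1 l k s')"
    then show "s = s'" by (rule conjugate_higgs1(1)[OF l])
  next
    fix k :: nat and s \<beta> assume "k > 0"
    then show "\<not> conjugate b r (b powi (int l - int k * int r)) (higgs1 l k s) (higgs2 \<beta>)"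
      by (rule conjugate_higgs1(2)[OF l])
  next
    fix k :: nat and s \<beta> assume "k > 0"
    then show "\<not> conjugate b r (b powi (int l - int k * int r)) (higgs1 l k s) (higgs3 r l \<beta>)"
      by (rule conjugate_higgs1(3)[OF l])
  next
    fix k :: nat and s \<sigma> v assume "k > 0" "s \<noteq> (0 :: complex)"
    then show "invariant_sub_line_bundle b r (b ^ l) (b powi (int l - int k * int r)) (higgs1 l k s) \<sigma> v \<longleftrightarrow>
        same_sub_line_bundle b r \<sigma> v 1 (\<lambda>z. vector [1, 0]) \<or>
        same_sub_line_bundle b r \<sigma> v (b powi (- (int k * int r)))
          (\<lambda>(x, y). vector [x ^ k, - 2 * s * y ^ l])"
      by (rule higgs1_invariant_sub_line_bundle_iff[OF l])
  next
    fix \<beta> \<beta>' z assume "conjugate b r (b powi (- int l)) (higgs2 \<beta>) (higgs2 \<beta>')" "z \<in> punctured_plane"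
    then show "\<beta> z = \<beta>' z" by (rule conjugate_higgs2[OF l(1)])
  next
    fix \<beta> assume "\<beta> \<in> H0 b r (b ^ (2 * l))" "\<not> is_square_section b r l \<beta>"
    then show "irreducible_analytic b r (b ^ l) (spectral_curve b r (b ^ l) (higgs2 \<beta>))" "r \<le> 2 * l"
      by (rule higgs2_irreducible[OF l])+
  next
    fix \<beta> t \<sigma> v assume "t \<in> H0 b r (b ^ l)" "\<forall>z\<in>punctured_plane. \<beta> z = (t z)\<^sup>2"
    then show "invariant_sub_line_bundle b r (b ^ l) (b powi (- int l)) (higgs2 \<beta>) \<sigma> v \<longleftrightarrow>
        same_sub_line_bundle b r \<sigma> v (b powi (- int l)) (\<lambda>z. vector [t z, 1]) \<or>
        same_sub_line_bundle b r \<sigma> v (b powi (- int l)) (\<lambda>z. vector [- t z, 1])"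
      by (intro higgs2_invariant_sub_line_bundle_iff[OF l]) auto
  next
    fix \<beta> \<beta>' z assume "\<beta> \<in> H0 b r (b ^ r)" "\<beta>' \<in> H0 b r (b ^ r)"
      and "conjugate b r (b powi (int l - int r)) (higgs3 r l \<beta>) (higgs3 r l \<beta>')"
      and "z \<in> punctured_plane"
    then show "\<beta> z = \<beta>' z" by (rule conjugate_higgs3[OF l(2)])
  next
    fix \<beta> assume "r < 2 * l" "\<beta> \<in> H0 b r (b ^ r)" "\<beta> (1, 0) \<noteq> 0"
    then show "irreducible_analytic b r (b ^ l) (spectral_curve b r (b ^ l) (higgs3 r l \<beta>))"
      by (rule higgs3_irreducible)
  qed
qed

end
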